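(* Let $d\ge1$ and let $Q=(V_Q,E_Q)$ be a finite multigraph (multiple edges and loops allowed) with $n$ vertices, with a weight $k_v\in\{0,1,\dots,d\}$ assigned to each vertex $v$, and with $$m=d(n-1)+\sum_{v\in V_Q}\Big[dk_v-\binom{k_v+1}{2}\Big]+\binom{d+1}{2}$$ edges. Then $Q$, with these vertex weights, is the quotient graph $G/\Gamma$ of an infinitesimally rigid mixed plate-and-bar $d$-periodic framework in $\mathbb{R}^d$ (vertex orbit $v$ consisting of $k_v$-dimensional plates) if and only if for every nonempty $F\subseteq E_Q$, $$|F|\le d(n_F-\omega_F)+\sum_{v\in V_F}\Big[dk_v-\binom{k_v+1}{2}\Big]+\binom{d+1}{2},$$ where $V_F$ is the set of vertices incident to $F$, $n_F=|V_F|$, and $\omega_F$ is the number of connected components of the graph $(V_F,F)$.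
   Context: Periodic graphs. A $d$-periodic graph is a pair $(G,\Gamma)$, where $G=(V,E)$ is an infinite multigraph (edges join distinct vertices) and $\Gamma\subset \mathrm{Aut}(G)$ is a free Abelian group of rank $d$ acting without fixed points with finitely many vertex orbits and edge orbits. The quotient $G/\Gamma=(V/\Gamma,E/\Gamma)$ is a finite multigraph, possibly with loops. In the mixed plate setting every vertex carries a $\Gamma$-invariant weight $k_v\in\{0,\dots,d\}$, the dimension of the plate it represents. Plates and frameworks. A $k$-dimensional plate is a rigid object in $\mathbb{R}^d$ marked by a $k$-frame (a point together with $k$ orthonormal vectors); bars must be attached at points of the plate, i.e. of the $k$-dimensional affine subspace spanned by the frame. ($k=0$: a point; $k=d$: a body, whose frame is positively oriented.) A placement of a $k$-plate is thus given by $(p,M)$, $p\in\mathbb{R}^d$, $M\in SO(d)$, where only the first $k$ columns of $M$ matter, i.e. by an element of $SE(d)/SO(d-k)$. A mixed plate-and-bar $d$-periodic framework is a connected weighted $d$-periodic graph together with: placements $\tau(i)=(p_i,M_i)$ of a $k_i$-plate for every vertex $i$; an injective homomorphism $\pi$ from $\Gamma$ to the translations of $\mathbb{R}^d$ with image a lattice of rank $d$; and for each edge $e=(i,j)$ attachment points $q^i(e)\in\mathbb{R}^{k_i}\times\{0\}\subset\mathbb{R}^d$ and $q^j(e)\in\mathbb{R}^{k_j}\times\{0\}\subset\mathbb{R}^d$, so that the bar $e$ has endpoints $M_iq^i+p_i$ and $M_jq^j+p_j$. The data are periodic, $\tau(\gamma i)=\pi(\gamma)\tau(i)$ and $q^{\gamma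 i}(\gamma e)=q^i(e)$ for $\gamma\in\Gamma$, and all bars have non-zero length. Infinitesimal rigidity. Choose a basis of $\Gamma$ (so $\Gamma\cong\mathbb{Z}^d$) and let $\Lambda$ be the $d\times d$ matrix whose columns are the corresponding translation vectors. Choose representatives $1,\dots,n$ of the vertex orbits and an orientation of $G/\Gamma$; represent each edge orbit by the edge $e$ originating at a chosen representative $i$, so that its other end is the translate of a representative $j$ by the period $\Lambda c$, $c=C(e)\in\mathbb{Z}^d$. The rigidity matrix is the matrix of the linear system, with one equation for each of the $m$ edge representatives, $$\langle \dot\Lambda c+M_jA_jq^j-M_iA_iq^i+\dot p_j-\dot p_i,\ \Lambda c+M_jq^j-M_iq^i+p_j-p_i\rangle=0$$ in the unknowns $\dot p_i\in\mathbb{R}^d$, $A_i$ skew-symmetric $d\times d$ (taken modulo those supported on the last $d-k_i$ rows and columns, which have no effect) for $i=1,\dots,n$, and $\dot\Lambda\in\mathbb{R}^{d\times d}$. The framework is infinitesimally rigid if this matrix has the maximal possible rank $d(n-1)+\sum_{i=1}^n\big[dk_i-\binom{k_i+1}{2}\big]+\binom{d+1}{2}$, equivalently if the solution space is exactly the $\binom{d+1}{2}$-dimensional space of trivial infinitesimal motions coming from isometries of $\mathbb{R}^d$. *)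

theory Defs
  imports
    "HOL-Analysis.Analysis"
    "HOL-Algebra.Group_Action"
    "HOL-Library.Uprod"
    "HOL-Library.Function_Algebras"
    "HOL-Library.Infinite_Typeclass"
begin

section \<open>Multigraphs\<close>

text \<open>Undirected multigraphs; an edge \<open>e\<close> with \<open>ends G e = Upair v v\<close> is a loop.\<close>

record ('v, 'e) mgraph =
  verts :: "'v set"
  edges :: "'e set"
  ends :: "'e \<Rightarrow> 'v uprod"

definition wf_mgraph :: "('v, 'e) mgraph \<Rightarrow> bool" where
  "wf_mgraph G \<longleftrightarrow> (\<forall>e\<in>edges G. set_uprod (ends G e) \<subseteq> verts G)"

definition finite_mgraph :: "('v, 'e) mgraph \<Rightarrow> bool" where
  "finite_mgraph G \<longleftrightarrow> wf_mgraph G \<and> finite (verts G) \<and> finite (edges G)"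

definition loopless :: "('v, 'e) mgraph \<Rightarrow> bool" where
  "loopless G \<longleftrightarrow> (\<forall>e\<in>edges G. proper_uprod (ends G e))"

definition adjacency :: "('v, 'e) mgraph \<Rightarrow> ('v \<times> 'v) set" where
  "adjacency G = {(u, v). \<exists>e\<in>edges G. ends G e = Upair u v}"

definition connectivity :: "('v, 'e) mgraph \<Rightarrow> ('v \<times> 'v) set" where
  "connectivity G = {(u, v). u \<in> verts G \<and> v \<in> verts G \<and> (u, v) \<in> (adjacency G)\<^sup>*}"

definition connected_mgraph :: "('v, 'e) mgraph \<Rightarrow> bool" where
  "connected_mgraph G \<longleftrightarrow> connectivity G = verts G \<times> verts G"

definition num_components :: "('v, 'e) mgraph \<Rightarrow> nat" where
  "num_components G = card (verts G // connectivity G)"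

text \<open>The subgraph formed by an edge set together with the vertices incident to it.\<close>

definition edge_subgraph :: "('v, 'e) mgraph \<Rightarrow> 'e set \<Rightarrow> ('v, 'e) mgraph" where
  "edge_subgraph G F = \<lparr>verts = (\<Union>e\<in>F. set_uprod (ends G e)), edges = F, ends = ends G\<rparr>"

definition mgraph_iso ::
  "('v \<Rightarrow> 'w) \<Rightarrow> ('e \<Rightarrow> 'f) \<Rightarrow> ('v, 'e) mgraph \<Rightarrow> ('w, 'f) mgraph \<Rightarrow> bool" where
  "mgraph_iso f g G H \<longleftrightarrow> bij_betw f (verts G) (verts H) \<and> bij_betw g (edges G) (edges H)
     \<and> (\<forall>e\<in>edges G. ends H (g e) = map_uprod f (ends G e))"

section \<open>Periodic graphs\<close>

text \<open>An automorphism of a multigraph permutes both the vertices and the edges.\<close>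

definition mgraph_Aut :: "('v, 'e) mgraph \<Rightarrow> (('v \<Rightarrow> 'v) \<times> ('e \<Rightarrow> 'e)) monoid" where
  "mgraph_Aut G = (BijGroup (verts G) \<times>\<times> BijGroup (edges G))
     \<lparr>carrier := {(f, g). f \<in> Bij (verts G) \<and> g \<in> Bij (edges G)
                   \<and> (\<forall>e\<in>edges G. ends G (g e) = map_uprod f (ends G e))}\<rparr>"

abbreviation subgroup_of :: "'a set \<Rightarrow> 'a monoid \<Rightarrow> 'a monoid" where
  "subgroup_of H A \<equiv> A\<lparr>carrier := H\<rparr>"

text \<open>The additive group of a type; at type \<open>int ^ 'd\<close> it is free Abelian of rank \<open>CARD('d)\<close>.\<close>

definition additive_group :: "'a::monoid_add monoid" where
  "additive_group = \<lparr>carrier = UNIV, mult = (+), one = 0\<rparr>"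

definition periodic_graph ::
  "'d::finite itself \<Rightarrow> ('x, 'y) mgraph \<Rightarrow> (('x \<Rightarrow> 'x) \<times> ('y \<Rightarrow> 'y)) set \<Rightarrow> bool" where
  "periodic_graph TYPE('d) G \<Gamma> \<longleftrightarrow>
     wf_mgraph G \<and> loopless G \<and> infinite (verts G)
     \<and> subgroup \<Gamma> (mgraph_Aut G)
     \<and> subgroup_of \<Gamma> (mgraph_Aut G) \<cong> (additive_group :: (int ^ 'd) monoid)
     \<and> (\<forall>\<gamma>\<in>\<Gamma>. \<gamma> \<noteq> \<one>\<^bsub>mgraph_Aut G\<^esub> \<longrightarrow>
          (\<forall>x\<in>verts G. fst \<gamma> x \<noteq> x) \<and> (\<forall>e\<in>edges G. snd \<gamma> e \<noteq> e))
     \<and> finite (orbits (subgroup_of \<Gamma> (mgraph_Aut G)) (verts G) fst)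
     \<and> finite (orbits (subgroup_of \<Gamma> (mgraph_Aut G)) (edges G) snd)"

definition vertex_orbit ::
  "('x, 'y) mgraph \<Rightarrow> (('x \<Rightarrow> 'x) \<times> ('y \<Rightarrow> 'y)) set \<Rightarrow> 'x \<Rightarrow> 'x set" where
  "vertex_orbit G \<Gamma> x = orbit (subgroup_of \<Gamma> (mgraph_Aut G)) fst x"

definition edge_orbit ::
  "('x, 'y) mgraph \<Rightarrow> (('x \<Rightarrow> 'x) \<times> ('y \<Rightarrow> 'y)) set \<Rightarrow> 'y \<Rightarrow> 'y set" where
  "edge_orbit G \<Gamma> e = orbit (subgroup_of \<Gamma> (mgraph_Aut G)) snd e"

text \<open>The choice of the edge in its orbit does not affect the orbits of its endpoints.\<close>

definition quotient_mgraph ::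
  "('x, 'y) mgraph \<Rightarrow> (('x \<Rightarrow> 'x) \<times> ('y \<Rightarrow> 'y)) set \<Rightarrow> ('x set, 'y set) mgraph" where
  "quotient_mgraph G \<Gamma> =
     \<lparr>verts = vertex_orbit G \<Gamma> ` verts G,
      edges = edge_orbit G \<Gamma> ` edges G,
      ends = (\<lambda>O'. map_uprod (vertex_orbit G \<Gamma>) (ends G (SOME e. e \<in> O')))\<rparr>"

section \<open>Mixed plate-and-bar frameworks\<close>

text \<open>
  The ambient space is \<open>real ^ 'd\<close>; the order on \<open>'d\<close> numbers the coordinates, from 0, so
  that a \<open>k\<close>-plate uses the coordinates (and matrix columns) \<open>a\<close> with \<open>coord_index a < k\<close>.
\<close>

definition coord_index :: "'d::{finite,linorder} \<Rightarrow> nat" where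
  "coord_index a = card {b. b < a}"

definition int_vec :: "int ^ 'd \<Rightarrow> real ^ 'd" where
  "int_vec c = (\<chi> a. of_int (c $ a))"

definition full_rank_lattice :: "(real ^ 'd) set \<Rightarrow> bool" where
  "full_rank_lattice L \<longleftrightarrow>
     (\<exists>\<Lambda> :: real ^ 'd ^ 'd. invertible \<Lambda> \<and> L = range (\<lambda>c :: int ^ 'd. \<Lambda> *v int_vec c))"

text \<open>
  \<open>attach F e x\<close> is the attachment point of the bar \<open>e\<close> on the plate \<open>x\<close>, in the coordinates
  of that plate; it is relevant only if \<open>x\<close> is an endpoint of \<open>e\<close>.  Since the graph
  has no loops, \<open>e\<close> and \<open>x\<close> determine the end of the bar.
\<close>

record ('x, 'y, 'd::finite) framework =
  graph :: "('x, 'y) mgraph"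
  symmetries :: "(('x \<Rightarrow> 'x) \<times> ('y \<Rightarrow> 'y)) set"
  weight :: "'x \<Rightarrow> nat"
  pos :: "'x \<Rightarrow> real ^ 'd"
  rot :: "'x \<Rightarrow> real ^ 'd ^ 'd"
  attach :: "'y \<Rightarrow> 'x \<Rightarrow> real ^ 'd"
  period :: "('x \<Rightarrow> 'x) \<times> ('y \<Rightarrow> 'y) \<Rightarrow> real ^ 'd"

definition bar_end :: "('x, 'y, 'd::finite) framework \<Rightarrow> 'y \<Rightarrow> 'x \<Rightarrow> real ^ 'd" where
  "bar_end F e x = rot F x *v attach F e x + pos F x"

text \<open>
  Placements of a \<open>k\<close>-plate are elements of \<open>SE(d)/SO(d-k)\<close>, so their equivariance concerns
  only the first \<open>k\<close> columns of the rotation.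
\<close>

definition mixed_plate_framework ::
  "('x, 'y, 'd::{finite,linorder}) framework \<Rightarrow> bool" where
  "mixed_plate_framework F \<longleftrightarrow>
     periodic_graph TYPE('d) (graph F) (symmetries F)
     \<and> connected_mgraph (graph F)
     \<and> (\<forall>x\<in>verts (graph F). weight F x \<le> CARD('d))
     \<and> (\<forall>\<gamma>\<in>symmetries F. \<forall>x\<in>verts (graph F). weight F (fst \<gamma> x) = weight F x)
     \<and> (\<forall>x\<in>verts (graph F). rotation_matrix (rot F x))
     \<and> period F \<in> hom (subgroup_of (symmetries F) (mgraph_Aut (graph F))) additive_group
     \<and> inj_on (period F) (symmetries F)
     \<and> full_rank_lattice (period F ` symmetries F)
     \<and> (\<forall>\<gamma>\<in>symmetries F. \<forall>x\<in>verts (graph F).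
          pos F (fst \<gamma> x) = pos F x + period F \<gamma>
          \<and> (\<forall>b. coord_index b < weight F x \<longrightarrow>
               column b (rot F (fst \<gamma> x)) = column b (rot F x)))
     \<and> (\<forall>e\<in>edges (graph F). \<forall>x\<in>set_uprod (ends (graph F) e).
          \<forall>a. weight F x \<le> coord_index a \<longrightarrow> attach F e x $ a = 0)
     \<and> (\<forall>\<gamma>\<in>symmetries F. \<forall>e\<in>edges (graph F). \<forall>x\<in>set_uprod (ends (graph F) e).
          attach F (snd \<gamma> e) (fst \<gamma> x) = attach F e x)
     \<and> (\<forall>e\<in>edges (graph F). \<forall>x y. ends (graph F) e = Upair x y \<longrightarrow>
          bar_end F e x \<noteq> bar_end F e y)"

section \<open>Infinitesimal rigidity\<close>

text \<open>
  The choices needed to write down the rigidity matrix: a basis of the period group, given as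
  an isomorphism \<open>\<beta>\<close> from \<open>int ^ 'd\<close>; vertex orbit representatives \<open>R\<close>; and edge orbit
  representatives \<open>S\<close>, where \<open>e \<in> S\<close> runs from \<open>src e\<close> to the translate of \<open>tgt e\<close> by
  \<open>\<beta> (C e)\<close>.
\<close>

record ('x, 'y, 'd::finite) representatives =
  basis :: "int ^ 'd \<Rightarrow> ('x \<Rightarrow> 'x) \<times> ('y \<Rightarrow> 'y)"
  vreps :: "'x set"
  ereps :: "'y set"
  src :: "'y \<Rightarrow> 'x"
  tgt :: "'y \<Rightarrow> 'x"
  shift :: "'y \<Rightarrow> int ^ 'd"

definition valid_representatives ::
  "('x, 'y, 'd::finite) framework \<Rightarrow> ('x, 'y, 'd) representatives \<Rightarrow> bool" where
  "valid_representatives F r \<longleftrightarrow>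
     basis r \<in> iso additive_group (subgroup_of (symmetries F) (mgraph_Aut (graph F)))
     \<and> vreps r \<subseteq> verts (graph F)
     \<and> bij_betw (vertex_orbit (graph F) (symmetries F)) (vreps r)
         (verts (quotient_mgraph (graph F) (symmetries F)))
     \<and> ereps r \<subseteq> edges (graph F)
     \<and> bij_betw (edge_orbit (graph F) (symmetries F)) (ereps r)
         (edges (quotient_mgraph (graph F) (symmetries F)))
     \<and> (\<forall>e\<in>ereps r. src r e \<in> vreps r \<and> tgt r e \<in> vreps r
          \<and> ends (graph F) e = Upair (src r e) (fst (basis r (shift r e)) (tgt r e)))"

definition lattice_matrix ::
  "('x, 'y, 'd::finite) framework \<Rightarrow> ('x, 'y, 'd) representatives \<Rightarrow> real ^ 'd ^ 'd" where
  "lattice_matrix F r = (\<chi> a b. period F (basis r (axis b 1)) $ a)"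

text \<open>
  An infinitesimal motion consists of the derivatives of the positions, the skew-symmetric
  matrices \<open>A\<close> and the derivative of the lattice matrix.
\<close>

type_synonym ('x, 'd) motion = "('x \<Rightarrow> (real ^ 'd)) \<times> ('x \<Rightarrow> real ^ 'd ^ 'd) \<times> (real ^ 'd ^ 'd)"

definition bar_functional ::
  "('x, 'y, 'd::finite) framework \<Rightarrow> ('x, 'y, 'd) representatives \<Rightarrow> 'y
     \<Rightarrow> ('x, 'd) motion \<Rightarrow> real" where
  "bar_functional F r e = (\<lambda>(p', A, \<Lambda>').
     let i = src r e; j = tgt r e; c = int_vec (shift r e);
         q\<^sub>i = attach F e i; q\<^sub>j = attach F e (fst (basis r (shift r e)) j)
     in (\<Lambda>' *v c + rot F j *v (A j *v q\<^sub>j) - rot F i *v (A i *v q\<^sub>i) + p' j - p' i)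
        \<bullet> (lattice_matrix F r *v c + rot F j *v q\<^sub>j - rot F i *v q\<^sub>i + pos F j - pos F i))"

text \<open>
  Coordinates of infinitesimal motions.  Modulo the skew-symmetric matrices supported on
  the coordinates of index at least \<open>k\<close>, a basis of the skew-symmetric matrices is given by
  \<open>E\<^sub>a\<^sub>b - E\<^sub>b\<^sub>a\<close> with \<open>a < b\<close> and \<open>coord_index a < k\<close>.
\<close>

datatype ('x, 'd) unknown = Pos 'x 'd | Rot 'x 'd 'd | Per 'd 'd

definition unknowns ::
  "('x, 'y, 'd::{finite,linorder}) framework \<Rightarrow> 'x set \<Rightarrow> ('x, 'd) unknown set" where
  "unknowns F R =
     {Pos i a | i a. i \<in> R}
     \<union> {Rot i a b | i a b. i \<in> R \<and> a < b \<and> coord_index a < weight F i}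
     \<union> {Per a b | a b. True}"

definition elem_matrix :: "'d \<Rightarrow> 'd \<Rightarrow> real ^ 'd ^ 'd" where
  "elem_matrix a b = (\<chi> r s. if r = a \<and> s = b then 1 else 0)"

fun unit_motion :: "('x, 'd::finite) unknown \<Rightarrow> ('x, 'd) motion" where
  "unit_motion (Pos i a) = ((\<lambda>x. if x = i then axis a 1 else 0), (\<lambda>_. 0), 0)"
| "unit_motion (Rot i a b) =
     ((\<lambda>_. 0), (\<lambda>x. if x = i then elem_matrix a b - elem_matrix b a else 0), 0)"
| "unit_motion (Per a b) = ((\<lambda>_. 0), (\<lambda>_. 0), elem_matrix a b)"

definition rigidity_matrix ::
  "('x, 'y, 'd::finite) framework \<Rightarrow> ('x, 'y, 'd) representatives
     \<Rightarrow> 'y \<Rightarrow> ('x, 'd) unknown \<Rightarrow> real" where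
  "rigidity_matrix F r e u = bar_functional F r e (unit_motion u)"

text \<open>The rank of the matrix with rows \<open>I\<close>, columns \<open>J\<close> and entries \<open>B i j\<close>.\<close>

definition matrix_rank :: "'i set \<Rightarrow> 'j set \<Rightarrow> ('i \<Rightarrow> 'j \<Rightarrow> real) \<Rightarrow> nat" where
  "matrix_rank I J B =
     vector_space.dim (\<lambda>(a::real) f j. a * f j) ((\<lambda>i j. if j \<in> J then B i j else 0) ` I)"

lemma vector_space_fun: "vector_space (\<lambda>(a::real) (f :: 'j \<Rightarrow> real) j. a * f j)"
  by unfold_locales (auto simp: fun_eq_iff algebra_simps)

text \<open>The excess of the dimension of the space of placements of a \<open>k\<close>-plate in
  dimension \<open>d\<close> over the \<open>d\<close> parameters of its position.\<close>

definition plate_dof :: "nat \<Rightarrow> nat \<Rightarrow> int" where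
  "plate_dof d k = int d * int k - int ((k + 1) choose 2)"

definition infinitesimally_rigid ::
  "('x, 'y, 'd::{finite,linorder}) framework \<Rightarrow> bool" where
  "infinitesimally_rigid F \<longleftrightarrow>
     (\<exists>r. valid_representatives F r
        \<and> int (matrix_rank (ereps r) (unknowns F (vreps r)) (rigidity_matrix F r))
          = int CARD('d) * (int (card (vreps r)) - 1)
            + (\<Sum>i\<in>vreps r. plate_dof CARD('d) (weight F i))
            + int ((CARD('d) + 1) choose 2))"

definition is_weighted_quotient ::
  "('v, 'e) mgraph \<Rightarrow> ('v \<Rightarrow> nat) \<Rightarrow> ('x, 'y, 'd::finite) framework \<Rightarrow> bool" where
  "is_weighted_quotient Q k F \<longleftrightarrow>
     (\<exists>f g. mgraph_iso f g Q (quotient_mgraph (graph F) (symmetries F))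
        \<and> (\<forall>v\<in>verts Q. \<forall>x\<in>f v. weight F x = k v))"

end

theory Submission
  imports Defs
begin

text \<open>
  The counts are necessary because a combination of rows that involves only the edges in \<open>F\<close> is
  killed by the translations of every component of \<open>F\<close> and by the rotations of the whole framework.

  Conversely, the right-hand side of the count is a sum of rank functions: \<open>d\<close> graphic matroids, one
  rank-one matroid on all edges for each entry of a symmetric matrix, and one rank-one matroid on the
  edges at \<open>v\<close> for each infinitesimal rotation of the plate \<open>v\<close>.  By Rado's theorem the edges split
  into \<open>d\<close> spanning trees and one edge for each of the other matroids.  Give the \<open>a\<close>-th tree the
  direction \<open>e\<^sub>a\<close>; give the edge of the pair \<open>a \<le> b\<close> a direction along \<open>e\<^sub>a + e\<^sub>b\<close>; and
  attach the edge of the rotation of \<open>v\<close> in the plane of \<open>a\<close> and \<open>b\<close> at the point \<open>e\<^sub>a\<close> of the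
  plate \<open>v\<close>, with period \<open>e\<^sub>b\<close>.  With all other attachment points and all positions at the origin, the
  rigidity matrix is block triangular and its rows are independent.
\<close>

section \<open>Ranks of families of row vectors\<close>

text \<open>All positions of a cell coincide, so the direction of a bar is its period plus the
  difference of its attachment points, and bars of length zero are forbidden. A tree bar, attached
  at origins, therefore cannot have period zero: its row meets a diagonal period column besides the
  position columns, and the tree of direction \<open>a\<close> forms one coupled block with the bar
  of the pair \<open>(a, a)\<close>. Heights on the vertices that rise by one along every tree edge
  decouple it. Combining the position columns of direction \<open>a\<close> with these weights
  reproduces the entry 1 of every tree row in the period column; subtracting leaves only
  \<open>\<sigma> a * (\<sigma> a - \<Delta> a)\<close> in the row of the bar, where
  \<open>\<sigma> a\<close> is its period and \<open>\<Delta> a\<close> its gain in height.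
  Independence asks that \<open>\<sigma> a\<close> be neither 0 nor \<open>\<Delta> a\<close>; a
  difference of exactly one also makes the infinite graph connected. The exact number of edges
  matters twice: rigidity then means that all rows are independent, and conversely the maximal ranks
  of the matroids add up to the number of edges, so each of them is exhausted.\<close>

interpretation fv: vector_space "\<lambda>(a::real) (f :: 'j \<Rightarrow> real) j. a * f j"
  by (rule vector_space_fun)

lemma sum_fun_at: "sum f A x = (\<Sum>a\<in>A. f a x)"
  for f :: "'i \<Rightarrow> 'j \<Rightarrow> real"
  by (induction A rule: infinite_finite_induct) auto

text \<open>Independence of an indexed family, with only the columns in \<open>J\<close> visible.
  Two equal rows with different indices are dependent, which the set of rows would hide.\<close>

definition row_indep :: "'i set \<Rightarrow> 'j set \<Rightarrow> ('i \<Rightarrow> 'j \<Rightarrow> real) \<Rightarrow> bool" where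
  "row_indep I J B \<longleftrightarrow> (\<forall>l. (\<forall>j\<in>J. (\<Sum>i\<in>I. l i * B i j) = 0) \<longrightarrow> (\<forall>i\<in>I. l i = 0))"

lemma row_indepD:
  "row_indep I J B \<Longrightarrow> (\<And>j. j \<in> J \<Longrightarrow> (\<Sum>i\<in>I. l i * B i j) = 0) \<Longrightarrow> i \<in> I \<Longrightarrow> l i = 0"
  unfolding row_indep_def by blast

lemma row_indep_subset:
  assumes "row_indep I J B" "finite I" "I' \<subseteq> I"
  shows "row_indep I' J B"
  unfolding row_indep_def
proof (intro allI impI ballI)
  fix l i assume l: "\<forall>j\<in>J. (\<Sum>i\<in>I'. l i * B i j) = 0" and i: "i \<in> I'"
  have "(\<Sum>i\<in>I. (if i \<in> I' then l i else 0) * B i j) = (\<Sum>i\<in>I'. l i * B i j)" for j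
    by (rule sum.mono_neutral_cong_right) (use assms in auto)
  with row_indepD[OF assms(1), of "\<lambda>i. if i \<in> I' then l i else 0" i] l i assms(3)
  show "l i = 0" by auto
qed

lemma row_indep_reindex:
  assumes "inj_on h I"
  shows "row_indep (h ` I) J B \<longleftrightarrow> row_indep I J (\<lambda>i. B (h i))"
proof
  assume *: "row_indep (h ` I) J B"
  show "row_indep I J (\<lambda>i. B (h i))" unfolding row_indep_def
  proof (intro allI impI ballI)
    fix l i assume l: "\<forall>j\<in>J. (\<Sum>i\<in>I. l i * B (h i) j) = 0" and i: "i \<in> I"
    have "(\<Sum>i\<in>h ` I. l (inv_into I h i) * B i j) = (\<Sum>i\<in>I. l i * B (h i) j)" for j
      using assms by (simp add: sum.reindex)
    with row_indepD[OF *, of "\<lambda>i. l (inv_into I h i)" "h i"] l i show "l i = 0"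
      using assms by auto
  qed
next
  assume *: "row_indep I J (\<lambda>i. B (h i))"
  show "row_indep (h ` I) J B" unfolding row_indep_def
  proof (intro allI impI ballI)
    fix l i assume l: "\<forall>j\<in>J. (\<Sum>i\<in>h ` I. l i * B i j) = 0" and i: "i \<in> h ` I"
    then show "l i = 0"
      using row_indepD[OF *, of "\<lambda>i. l (h i)"] assms by (auto simp: sum.reindex)
  qed
qed

lemma family_independent_iff:
  fixes w :: "'i \<Rightarrow> 'j \<Rightarrow> real"
  assumes "finite I"
  shows "(inj_on w I \<and> fv.independent (w ` I)) \<longleftrightarrow> row_indep I UNIV w"
proof (intro iffI conjI)
  assume *: "inj_on w I \<and> fv.independent (w ` I)"
  show "row_indep I UNIV w"
    unfolding row_indep_def
  proof (intro allI impI ballI)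
    fix l i assume l: "\<forall>j\<in>UNIV. (\<Sum>i\<in>I. l i * w i j) = 0" and i: "i \<in> I"
    have "(\<Sum>v\<in>w ` I. (\<lambda>j. l (inv_into I w v) * v j)) = 0"
      using l * by (auto simp: sum.reindex sum_fun_at fun_eq_iff)
    then have "l (inv_into I w (w i)) = 0"
      using fv.independentD[of "w ` I" "w ` I" "\<lambda>v. l (inv_into I w v)" "w i"] * i assms by auto
    then show "l i = 0" using * i by auto
  qed
next
  assume *: "row_indep I UNIV w"
  show inj: "inj_on w I"
  proof (rule inj_onI, rule ccontr)
    fix x y assume xy: "x \<in> I" "y \<in> I" "w x = w y" "x \<noteq> y"
    let ?l = "\<lambda>i. if i = x then 1 else if i = y then -1 else (0::real)"
    have "(\<Sum>i\<in>I. ?l i * w i j) = (\<Sum>i\<in>{x,y}. ?l i * w i j)" for j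
      by (rule sum.mono_neutral_right) (use xy assms in auto)
    then show False using row_indepD[OF *, of ?l x] xy by auto
  qed
  show "fv.independent (w ` I)"
  proof (rule fv.independent_if_scalars_zero)
    fix f v assume f: "(\<Sum>x\<in>w ` I. (\<lambda>j. f x * x j)) = 0" and v: "v \<in> w ` I"
    have "(\<Sum>i\<in>I. f (w i) * w i j) = 0" for j
      using fun_cong[OF f, of j] inj by (simp add: sum_fun_at sum.reindex)
    then show "f v = 0" using row_indepD[OF *, of "\<lambda>i. f (w i)"] v by auto
  qed (use assms in simp)
qed

text \<open>The ambient function space may have infinite dimension, so a basis is chosen inside
  \<open>S\<close> and enlarged by \<open>x\<close>.\<close>

lemma fv_dim_insert:
  assumes "finite S"
  shows "fv.dim (insert x S) = (if x \<in> fv.span S then fv.dim S else fv.dim S + 1)"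
proof -
  obtain B where B: "B \<subseteq> S" "fv.independent B" "S \<subseteq> fv.span B" "card B = fv.dim S"
    using fv.basis_exists by blast
  have finB: "finite B" using B(1) assms finite_subset by blast
  have span: "fv.span B = fv.span S"
    using fv.span_mono[OF B(1)] fv.span_minimal[OF B(3) fv.subspace_span] by (rule subset_antisym)
  show ?thesis
  proof (cases "x \<in> fv.span S")
    case True
    then have "fv.span (insert x S) = fv.span S" by (rule fv.span_redundant)
    then have "fv.dim (insert x S) = fv.dim S" by (metis fv.dim_span)
    with True show ?thesis by simp
  next
    case False
    then have x: "x \<notin> fv.span B" using span by simp
    have ind: "fv.independent (insert x B)"
      using B(2) x by (simp add: fv.independent_insertI)
    have "card (insert x B) = fv.dim (insert x S)"
    proof (rule fv.basis_card_eq_dim[OF _ _ ind])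
      show "insert x B \<subseteq> insert x S" using B(1) by auto
      show "insert x S \<subseteq> fv.span (insert x B)"
        using B(3) fv.span_mono[of B "insert x B"] by (auto intro: fv.span_base)
    qed
    moreover have "x \<notin> B" using x fv.span_base by blast
    ultimately show ?thesis using False B(4) finB by simp
  qed
qed

lemma fv_dim_image_eq_card_iff:
  assumes "finite I"
  shows "fv.dim (w ` I) = card I \<longleftrightarrow> row_indep I UNIV w"
proof
  assume *: "fv.dim (w ` I) = card I"
  obtain B where B: "B \<subseteq> w ` I" "fv.independent B" "w ` I \<subseteq> fv.span B" "card B = fv.dim (w ` I)"
    using fv.basis_exists by blast
  have "card (w ` I) \<le> card I" using assms by (rule card_image_le)
  then have "B = w ` I" using B(1,4) * assms by (metis card_seteq finite_imageI)
  moreover then have "inj_on w I" using B(4) * assms by (metis eq_card_imp_inj_on)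
  ultimately show "row_indep I UNIV w" using B(2) family_independent_iff[OF assms] by blast
next
  assume "row_indep I UNIV w"
  then show "fv.dim (w ` I) = card I"
    using family_independent_iff[OF assms, of w]
    by (metis card_image fv.dim_eq_card_independent)
qed

text \<open>Since the number of edges is the maximal rank, this is the form in which rigidity is
  used and proved.\<close>

lemma matrix_rank_eq_card_iff:
  assumes "finite I"
  shows "matrix_rank I J B = card I \<longleftrightarrow> row_indep I J B"
proof -
  have "row_indep I UNIV (\<lambda>i j. if j \<in> J then B i j else 0) \<longleftrightarrow> row_indep I J B"
  proof -
    have "(\<Sum>i\<in>I. l i * (if j \<in> J then B i j else 0)) = (if j \<in> J then \<Sum>i\<in>I. l i * B i j else 0)"
      for l :: "'a \<Rightarrow> real" and j
      by (cases "j \<in> J") simp_all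
    then have "(\<forall>j\<in>UNIV. (\<Sum>i\<in>I. l i * (if j \<in> J then B i j else 0)) = 0)
        \<longleftrightarrow> (\<forall>j\<in>J. (\<Sum>i\<in>I. l i * B i j) = 0)" for l
      by auto
    then show ?thesis unfolding row_indep_def by simp
  qed
  then show ?thesis
    unfolding matrix_rank_def fv_dim_image_eq_card_iff[OF assms] .
qed

text \<open>The rows live in the span of the \<open>card J\<close> unit functions. Every upper bound
  below comes from exhibiting few columns on which the rows stay independent.\<close>

lemma row_indep_card_le:
  assumes "finite I" "finite J" "row_indep I J B"
  shows "card I \<le> card J"
proof -
  let ?w = "\<lambda>i j. if j \<in> J then B i j else 0"
  let ?D = "(\<lambda>j x. of_bool (x = j) :: real) ` J"
  have "?w i \<in> fv.span ?D" for i
  proof -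
    have "?w i = (\<Sum>j\<in>J. (\<lambda>x. B i j * of_bool (x = j)))"
      using assms(2) by (auto simp: fun_eq_iff sum_fun_at)
    also have "\<dots> \<in> fv.span ?D"
    proof (rule fv.span_sum)
      fix j assume "j \<in> J"
      then have "(\<lambda>x. of_bool (x = j)) \<in> fv.span ?D" by (intro fv.span_base) auto
      then show "(\<lambda>x. B i j * of_bool (x = j)) \<in> fv.span ?D"
        by (rule fv.span_scale[of "\<lambda>x. of_bool (x = j)"])
    qed
    finally show ?thesis .
  qed
  then have "fv.dim (?w ` I) \<le> card ?D"
    using assms(2) by (intro fv.dim_le_card) auto
  also have "\<dots> \<le> card J" using assms(2) by (rule card_image_le)
  finally show ?thesis
    using assms(3) unfolding matrix_rank_eq_card_iff[OF assms(1), symmetric] matrix_rank_def by linarith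
qed

section \<open>Independent assignments for submodular functions\<close>

text \<open>A normalised polymatroid rank function. Only finite sets are compared because
  \<open>fv.dim\<close> of an infinite independent family is 0.\<close>

definition submod_rank :: "('e set \<Rightarrow> nat) \<Rightarrow> bool" where
  "submod_rank r \<longleftrightarrow> r {} = 0
     \<and> (\<forall>A B. finite B \<longrightarrow> A \<subseteq> B \<longrightarrow> r A \<le> r B)
     \<and> (\<forall>A B. finite A \<longrightarrow> finite B \<longrightarrow> r (A \<union> B) + r (A \<inter> B) \<le> r A + r B)"

text \<open>Diminishing returns imply submodularity: adding the elements of a set one by one raises
  the value over a larger base by at most as much as over a smaller one.\<close>

lemma submod_rank_marginal:
  fixes r :: "'e set \<Rightarrow> nat"
  assumes "r {} = 0"
    and step: "\<And>A e. finite A \<Longrightarrow> r (insert e A) = r A + of_bool (P e A)"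
    and anti: "\<And>A B e. finite B \<Longrightarrow> A \<subseteq> B \<Longrightarrow> P e B \<Longrightarrow> P e A"
  shows "submod_rank r"
proof -
  have mono: "r A \<le> r (A \<union> Z)" if "finite Z" "finite A" for A Z
    using that by (induction Z rule: finite_induct) (auto simp: step)
  have sub: "r (Y \<union> Z) + r X \<le> r (X \<union> Z) + r Y" if "finite Z" "finite Y" "X \<subseteq> Y" for X Y Z
    using that
  proof (induction Z rule: finite_induct)
    case (insert e Z)
    have fin: "finite (X \<union> Z)" "finite (Y \<union> Z)"
      using insert by (auto intro: finite_subset)
    have "of_bool (P e (Y \<union> Z)) \<le> (of_bool (P e (X \<union> Z)) :: nat)"
      using anti[of "Y \<union> Z" "X \<union> Z" e] fin insert.prems by (auto simp: of_bool_def)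
    then show ?case using insert step[OF fin(1)] step[OF fin(2)] by simp
  qed simp
  show ?thesis
    unfolding submod_rank_def
  proof (intro conjI allI impI)
    fix A B :: "'e set" assume "finite B" "A \<subseteq> B"
    then show "r A \<le> r B" using mono[of B A] finite_subset by (metis Un_absorb1)
  next
    fix A B :: "'e set" assume "finite A" "finite B"
    \<comment> \<open>The elements of \<open>B\<close> are added to the base \<open>A\<close> and to
      the smaller base \<open>A \<inter> B\<close>; the latter then becomes
      \<open>B\<close>.\<close>
    then show "r (A \<union> B) + r (A \<inter> B) \<le> r A + r B"
      using sub[of B A "A \<inter> B"] by (simp add: Un_absorb1 Int_absorb2 inf_commute Un_Int_distrib)
  qed fact
qed

lemma submod_rank_meets: "submod_rank (\<lambda>X. of_bool (X \<inter> H \<noteq> {}))"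
  unfolding submod_rank_def of_bool_def by auto

lemma submod_rank_fv_dim: "submod_rank (\<lambda>X. fv.dim (w ` X))"
proof (rule submod_rank_marginal)
  show "fv.dim (w ` {}) = 0" by (metis card.empty finite.emptyI fv.dim_eq_card_independent fv.independent_empty image_empty)
  show "fv.dim (w ` insert e A) = fv.dim (w ` A) + of_bool (w e \<notin> fv.span (w ` A))"
    if "finite A" for A e
    using that by (simp add: fv_dim_insert)
  show "A \<subseteq> B \<Longrightarrow> w e \<notin> fv.span (w ` B) \<Longrightarrow> w e \<notin> fv.span (w ` A)" for A B e
    using fv.span_mono[of "w ` A" "w ` B"] by blast
qed

text \<open>Welsh's proof of Rado's theorem: if neither of two labels can be deleted from \<open>A e\<close>, the
  two violated inequalities contradict submodularity.\<close>

lemma independent_assignment: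
  fixes r :: "'i \<Rightarrow> 'e set \<Rightarrow> nat" and A :: "'e \<Rightarrow> 'i set"
  assumes "finite E" "finite I"
    and r: "\<And>i. i \<in> I \<Longrightarrow> submod_rank (r i)"
    and "\<And>e. e \<in> E \<Longrightarrow> A e \<subseteq> I"
    and "\<And>F. F \<subseteq> E \<Longrightarrow> card F \<le> (\<Sum>i\<in>I. r i {e\<in>F. i \<in> A e})"
  shows "\<exists>\<phi>. \<phi> ` E \<subseteq> I \<and> (\<forall>F\<subseteq>E. card F \<le> (\<Sum>i\<in>I. r i {e\<in>F. \<phi> e = i}))"
  using assms(4,5)
proof (induction "\<Sum>e\<in>E. card (A e)" arbitrary: A rule: less_induct)
  case less
  let ?g = "\<lambda>A F. \<Sum>i\<in>I. r i {e\<in>F. i \<in> A e}"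
  have fin: "finite (A e)" if "e \<in> E" for e
    using less.prems(1)[OF that] assms(2) finite_subset by blast
  \<comment> \<open>The hypothesis for the single edge \<open>e\<close> would bound 1 by a sum of
    ranks of the empty set.\<close>
  have ne: "A e \<noteq> {}" if "e \<in> E" for e
  proof
    assume "A e = {}"
    then have "?g A {e} = (\<Sum>i\<in>I. r i {})" by (intro sum.cong) (auto intro!: arg_cong[where f = "r _"])
    also have "\<dots> = 0" using r by (auto simp: submod_rank_def)
    finally show False using less.prems(2)[of "{e}"] that by simp
  qed
  show ?case
  proof (cases "\<forall>e\<in>E. \<exists>i. A e = {i}")
    case True
    then obtain \<phi> where \<phi>: "\<And>e. e \<in> E \<Longrightarrow> A e = {\<phi> e}" by metis
    have "{e\<in>F. \<phi> e = i} = {e\<in>F. i \<in> A e}" if "F \<subseteq> E" for F i using \<phi> that by auto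
    then show ?thesis using less.prems \<phi> by (intro exI[of _ \<phi>]) auto
  next
    case False
    then obtain e0 where e0: "e0 \<in> E" "\<nexists>i. A e0 = {i}" by blast
    then obtain x where x: "x \<in> A e0" using ne by blast
    with e0 obtain y where y: "y \<in> A e0" "y \<noteq> x" by blast
    define D where "D z = A(e0 := A e0 - {z})" for z
    have D_less: "(\<Sum>e\<in>E. card (D z e)) < (\<Sum>e\<in>E. card (A e))" if "z \<in> A e0" for z
    proof (rule sum_strict_mono_ex1[OF assms(1)])
      show "\<forall>e\<in>E. card (D z e) \<le> card (A e)"
        using fin by (auto simp: D_def card_Diff1_le)
      show "\<exists>e\<in>E. card (D z e) < card (A e)"
        using that e0(1) card_Diff1_less[OF fin[OF e0(1)] that] by (intro bexI[of _ e0]) (simp_all only: D_def fun_upd_same)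
    qed
    have D_sub: "D z e \<subseteq> I" if "e \<in> E" for z e
      using less.prems(1)[OF that] by (auto simp: D_def split: if_splits)
    show ?thesis
    proof (rule ccontr)
      assume contra: "\<not> ?thesis"
      \<comment> \<open>A set avoiding \<open>e0\<close> sees the same lists as before, so a
        violation caused by the deletion contains \<open>e0\<close>.\<close>
      have viol: "\<exists>F\<subseteq>E. e0 \<in> F \<and> ?g (D z) F < card F" if z: "z \<in> A e0" for z
      proof -
        obtain F where F: "F \<subseteq> E" "?g (D z) F < card F"
          using less.hyps[OF D_less[OF z] D_sub] contra by (meson not_le)
        moreover have "e0 \<in> F"
        proof (rule ccontr)
          assume "e0 \<notin> F"
          then have "?g (D z) F = ?g A F"
            by (intro sum.cong arg_cong[where f = "r _"]) (auto simp: D_def split: if_splits)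
          then show False using F less.prems(2)[of F] by simp
        qed
        ultimately show ?thesis by blast
      qed
      obtain F1 where F1: "F1 \<subseteq> E" "e0 \<in> F1" "?g (D x) F1 < card F1" using viol[OF x] by blast
      obtain F2 where F2: "F2 \<subseteq> E" "e0 \<in> F2" "?g (D y) F2 < card F2" using viol[OF y(1)] by blast
      have fin12: "finite F1" "finite F2" using F1 F2 assms(1) finite_subset by blast+
      \<comment> \<open>As \<open>x\<close> and \<open>y\<close> differ, each label of
        \<open>e0\<close> survives one of the two deletions, so the union recovers the full lists.
        The intersection may lose labels of \<open>e0\<close>, hence \<open>e0\<close> is removed
        there.\<close>
      have "r i {e \<in> F1 \<union> F2. i \<in> A e} + r i {e \<in> F1 \<inter> F2 - {e0}. i \<in> A e}
            \<le> r i {e\<in>F1. i \<in> D x e} + r i {e\<in>F2. i \<in> D y e}" if i: "i \<in> I" for i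
      proof -
        let ?X = "{e\<in>F1. i \<in> D x e}" and ?Y = "{e\<in>F2. i \<in> D y e}"
        have "{e \<in> F1 \<union> F2. i \<in> A e} = ?X \<union> ?Y"
          using F1(2) F2(2) y(2) by (auto simp: D_def)
        then have un: "r i {e \<in> F1 \<union> F2. i \<in> A e} = r i (?X \<union> ?Y)" by (rule arg_cong)
        have "{e \<in> F1 \<inter> F2 - {e0}. i \<in> A e} \<subseteq> ?X \<inter> ?Y"
          by (auto simp: D_def)
        then have "r i {e \<in> F1 \<inter> F2 - {e0}. i \<in> A e} \<le> r i (?X \<inter> ?Y)"
          using r[OF i] fin12 unfolding submod_rank_def by simp
        moreover have "r i (?X \<union> ?Y) + r i (?X \<inter> ?Y) \<le> r i ?X + r i ?Y"
          using r[OF i] fin12 unfolding submod_rank_def by simp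
        ultimately show ?thesis unfolding un by linarith
      qed
      then have "?g A (F1 \<union> F2) + ?g A (F1 \<inter> F2 - {e0}) \<le> ?g (D x) F1 + ?g (D y) F2"
        unfolding sum.distrib[symmetric] by (intro sum_mono) simp
      moreover have "card (F1 \<union> F2) \<le> ?g A (F1 \<union> F2)" "card (F1 \<inter> F2 - {e0}) \<le> ?g A (F1 \<inter> F2 - {e0})"
        using F1(1) F2(1) by (intro less.prems(2); blast)+
      moreover have "card (F1 \<union> F2) + card (F1 \<inter> F2) = card F1 + card F2"
        using card_Un_Int[OF fin12] by simp
      moreover have "card (F1 \<inter> F2 - {e0}) + 1 = card (F1 \<inter> F2)"
        using card_Suc_Diff1[of "F1 \<inter> F2" e0] F1(2) F2(2) fin12 by simp
      \<comment> \<open>The two strict violations gain 2, while removing \<open>e0\<close> from the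
        intersection costs only 1.\<close>
      ultimately show False using F1(3) F2(3) by linarith
    qed
  qed
qed

section \<open>Incidence vectors and spanning trees\<close>

text \<open>A row of the oriented incidence matrix. A loop has the zero vector, so it never belongs
  to an independent family.\<close>

definition inc :: "('e \<Rightarrow> 'v) \<Rightarrow> ('e \<Rightarrow> 'v) \<Rightarrow> 'e \<Rightarrow> 'v \<Rightarrow> real" where
  "inc s t e v = of_bool (t e = v) - of_bool (s e = v)"

lemma sum_inc:
  assumes "finite V"
  shows "(\<Sum>v\<in>V. h v * inc s t e v) = of_bool (t e \<in> V) * h (t e) - of_bool (s e \<in> V) * h (s e)"
  using assms by (simp add: inc_def algebra_simps sum_subtractf)

lemma sum_inc_combination:
  assumes "finite V" "\<And>e. e \<in> T \<Longrightarrow> s e \<in> V \<longleftrightarrow> t e \<in> V"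
  shows "(\<Sum>v\<in>V. \<Sum>e\<in>T. l e * inc s t e v) = 0"
proof -
  have "(\<Sum>v\<in>V. \<Sum>e\<in>T. l e * inc s t e v) = (\<Sum>e\<in>T. l e * (\<Sum>v\<in>V. 1 * inc s t e v))"
    by (subst sum.swap) (simp add: sum_distrib_left)
  also have "\<dots> = 0"
    unfolding sum_inc[OF assms(1)] using assms(2) by (intro sum.neutral) auto
  finally show ?thesis .
qed

lemma sum_eq_0_at:
  fixes f :: "'v \<Rightarrow> real"
  assumes "finite C" "x \<in> C" "(\<Sum>v\<in>C. f v) = 0" "\<And>v. v \<in> C - {x} \<Longrightarrow> f v = 0"
  shows "f x = 0"
proof -
  have "(\<Sum>v\<in>C. f v) = (\<Sum>v\<in>{x}. f v)"
    by (rule sum.mono_neutral_right) (use assms in auto)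
  then show ?thesis using assms(3) by simp
qed

text \<open>No edge leaves a class of \<open>\<rho>\<close>, so a combination of incidence vectors
  sums to zero over each class. As \<open>R\<close> has at most one vertex per class, the values
  outside \<open>R\<close> force those on \<open>R\<close>.\<close>

lemma inc_combination_eq_0:
  assumes "finite V" "s ` T \<subseteq> V" "t ` T \<subseteq> V" "\<And>e. e \<in> T \<Longrightarrow> \<rho> (s e) = \<rho> (t e)"
    and "R \<subseteq> V" "inj_on \<rho> R" "\<And>v. v \<in> V - R \<Longrightarrow> (\<Sum>e\<in>T. l e * inc s t e v) = 0"
  shows "(\<Sum>e\<in>T. l e * inc s t e v) = 0"
proof (cases "v \<in> R")
  case True
  let ?C = "{u \<in> V. \<rho> u = \<rho> v}"
  have "?C - {v} \<subseteq> V - R" using assms(6) True by (auto dest: inj_onD)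
  then show ?thesis
    using assms True by (intro sum_eq_0_at[OF _ _ sum_inc_combination, of ?C v T s t l]) auto
next
  case False
  then show ?thesis
  proof (cases "v \<in> V")
    case out: False
    then show ?thesis using assms(2,3) by (intro sum.neutral) (auto simp: inc_def)
  qed (use assms(7) in auto)
qed

lemma row_indep_inc_drop:
  assumes "row_indep T UNIV (inc s t)" "finite V" "s ` T \<subseteq> V" "t ` T \<subseteq> V"
    "\<And>e. e \<in> T \<Longrightarrow> \<rho> (s e) = \<rho> (t e)" "R \<subseteq> V" "inj_on \<rho> R"
  shows "row_indep T (V - R) (inc s t)"
  using assms(1) inc_combination_eq_0[OF assms(2-7)] unfolding row_indep_def by blast

text \<open>Trees are described by linear algebra, as independent incidence vectors of the right
  number; connectedness is recovered in \<open>spanning_tree_closed\<close>.\<close>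

definition spanning_tree :: "('e \<Rightarrow> 'v) \<Rightarrow> ('e \<Rightarrow> 'v) \<Rightarrow> 'v set \<Rightarrow> 'e set \<Rightarrow> bool" where
  "spanning_tree s t V T \<longleftrightarrow> finite T \<and> s ` T \<subseteq> V \<and> t ` T \<subseteq> V
     \<and> row_indep T UNIV (inc s t) \<and> card T + 1 = card V"

text \<open>If \<open>C\<close> were a proper part, one column could be dropped on each side of it,
  leaving \<open>card V - 2\<close> columns for \<open>card V - 1\<close> independent rows. The
  lemma serves as induction along the tree: what tree edges preserve holds at every vertex.\<close>

lemma spanning_tree_closed:
  assumes "spanning_tree s t V T" "finite V" "C \<subseteq> V" "C \<noteq> {}"
    and "\<And>e. e \<in> T \<Longrightarrow> s e \<in> C \<longleftrightarrow> t e \<in> C"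
  shows "C = V"
proof (rule ccontr)
  assume "C \<noteq> V"
  then obtain x y where xy: "x \<in> C" "y \<in> V" "y \<notin> C" using assms(3,4) by blast
  have "row_indep T (V - {x, y}) (inc s t)"
    using assms xy unfolding spanning_tree_def
    by (intro row_indep_inc_drop[where \<rho> = "\<lambda>v. v \<in> C"]) auto
  then have "card T \<le> card (V - {x, y})"
    using assms unfolding spanning_tree_def by (intro row_indep_card_le) auto
  also have "card (V - {x, y}) = card V - 2"
    using assms(2,3) xy by (subst card_Diff_subset) (auto simp: card_insert_if)
  finally show False
    using assms(1) xy(1,2,3) assms(2,3) card_mono[of V "{x, y}"]
    unfolding spanning_tree_def by (auto simp: card_insert_if split: if_splits)
qed

text \<open>A linear functional that takes the value one on all incidence vectors of the tree provides the
  heights up to an additive constant.\<close>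

lemma spanning_tree_heights:
  assumes "spanning_tree s t V T" "finite V"
  shows "\<exists>h :: 'v \<Rightarrow> int. \<forall>e\<in>T. h (t e) - h (s e) = 1"
proof (cases "V = {}")
  case True
  then show ?thesis using assms unfolding spanning_tree_def by auto
next
  case False
  then obtain x where x: "x \<in> V" by blast
  interpret vp: vector_space_pair "\<lambda>(a::real) (f :: 'v \<Rightarrow> real) j. a * f j" "(*) :: real \<Rightarrow> real \<Rightarrow> real"
    by (intro vector_space_pair.intro vector_space_fun, unfold_locales) (simp_all add: algebra_simps)
  have "fv.independent (inc s t ` T)"
    using assms family_independent_iff[of T "inc s t"] unfolding spanning_tree_def by blast
  from vp.linear_independent_extend[OF this, of "\<lambda>_. 1"]
  obtain \<psi> where lin: "Vector_Spaces.linear (\<lambda>(a::real) (f :: 'v \<Rightarrow> real) j. a * f j) (*) \<psi>"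
    and one: "\<And>e. e \<in> T \<Longrightarrow> \<psi> (inc s t e) = 1" by auto
  interpret lin: Vector_Spaces.linear "\<lambda>(a::real) (f :: 'v \<Rightarrow> real) j. a * f j" "(*)" \<psi> by (fact lin)
  \<comment> \<open>The values of the functional at the unit functions form a potential with
    increment 1 along every tree edge.\<close>
  define g where "g v = \<psi> (\<lambda>u. of_bool (v = u))" for v
  have "inc s t e = (\<lambda>u. of_bool (t e = u)) - (\<lambda>u. of_bool (s e = u))" for e
    by (auto simp: inc_def fun_eq_iff)
  then have g: "g (t e) - g (s e) = 1" if "e \<in> T" for e
    using one[OF that] lin.diff by (simp add: g_def)
  define C where "C = {v \<in> V. g v - g x \<in> \<int>}"
  have "C = V"
  proof (rule spanning_tree_closed[OF assms])
    show "C \<noteq> {}" using x by (auto simp: C_def)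
    show "s e \<in> C \<longleftrightarrow> t e \<in> C" if "e \<in> T" for e
    proof -
      have "g (t e) - g x = (g (s e) - g x) + 1" using g[OF that] by simp
      then have "g (t e) - g x \<in> \<int> \<longleftrightarrow> g (s e) - g x \<in> \<int>"
        by (metis Ints_1 Ints_add Ints_diff add_diff_cancel_right')
      then show ?thesis using assms(1) that unfolding C_def spanning_tree_def by auto
    qed
  qed (auto simp: C_def)
  \<comment> \<open>Rounding down commutes with adding 1, so integer heights keep the unit
    increments.\<close>
  have "\<lfloor>g (t e) - g x\<rfloor> - \<lfloor>g (s e) - g x\<rfloor> = 1" if "e \<in> T" for e
  proof -
    have "g (t e) - g x = (g (s e) - g x) + 1" using g[OF that] by simp
    then show ?thesis by (simp only:) simp
  qed
  then show ?thesis by (intro exI[of _ "\<lambda>v. \<lfloor>g v - g x\<rfloor>"]) blast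
qed

text \<open>\<open>\<rho> v\<close> stands for a representative of the connected component of \<open>v\<close>.\<close>

lemma card_le_dim_inc:
  assumes "finite T" "finite V"
    and conn: "\<And>v. v \<in> V \<Longrightarrow> (v, \<rho> v) \<in> {(u, w). \<exists>e\<in>T. {u, w} = {s e, t e}}\<^sup>*"
  shows "card (V - \<rho> ` V) \<le> fv.dim (inc s t ` T)"
proof -
  \<comment> \<open>Differences of unit functions telescope along a path, each step being an
    incidence vector up to sign.\<close>
  let ?d = "\<lambda>u w x. of_bool (u = x) - of_bool (w = x) :: real"
  have path: "?d u w \<in> fv.span (inc s t ` T)" if "(u, w) \<in> {(u, w). \<exists>e\<in>T. {u, w} = {s e, t e}}\<^sup>*" for u w
    using that
  proof (induction rule: rtrancl_induct)
    case base
    have "?d u u = 0" by auto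
    then show ?case by (simp only: fv.span_zero)
  next
    case (step w z)
    then obtain e where e: "e \<in> T" "{w, z} = {s e, t e}" by blast
    then have "?d w z = inc s t e \<or> ?d w z = - inc s t e"
      by (auto simp: doubleton_eq_iff inc_def fun_eq_iff)
    moreover have "inc s t e \<in> fv.span (inc s t ` T)" using e by (auto intro: fv.span_base)
    ultimately have "?d w z \<in> fv.span (inc s t ` T)"
      using fv.span_neg[of "inc s t e"] by (auto simp only: fun_Compl_def)
    moreover have "?d u z = ?d u w + ?d w z" by auto
    ultimately show ?case using fv.span_add[OF step.IH] by (simp only:)
  qed
  let ?w = "\<lambda>v. ?d v (\<rho> v)"
  have "row_indep (V - \<rho> ` V) UNIV ?w"
    unfolding row_indep_def
  proof (intro allI impI ballI)
    fix l v assume l: "\<forall>x\<in>UNIV. (\<Sum>v\<in>V - \<rho> ` V. l v * ?w v x) = 0" and v: "v \<in> V - \<rho> ` V"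
    \<comment> \<open>At a vertex that represents no component, only its own vector is nonzero: the
      vectors are triangular.\<close>
    have "(\<Sum>u\<in>V - \<rho> ` V. l u * ?w u v) = (\<Sum>u\<in>{v}. l u * ?w u v)"
      using v assms(2) by (intro sum.mono_neutral_right) auto
    then show "l v = 0" using l v by (auto simp: image_iff)
  qed
  then have "card (V - \<rho> ` V) = fv.dim (?w ` (V - \<rho> ` V))"
    using fv_dim_image_eq_card_iff[of "V - \<rho> ` V" ?w] assms(2) by simp
  also have "\<dots> \<le> fv.dim (inc s t ` T)"
  proof -
    obtain B where B: "B \<subseteq> inc s t ` T" "inc s t ` T \<subseteq> fv.span B" "card B = fv.dim (inc s t ` T)"
      using fv.basis_exists by metis
    have "?w ` (V - \<rho> ` V) \<subseteq> fv.span (inc s t ` T)" using path conn by auto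
    also have "\<dots> \<subseteq> fv.span B" using B(2) by (simp add: fv.span_minimal)
    finally show ?thesis
      using fv.dim_le_card[of _ B] finite_subset[OF B(1)] B(3) assms(1) by simp
  qed
  finally show ?thesis .
qed

section \<open>Counting the coordinates of plates\<close>

lemma coord_index_less: "coord_index (a :: 'd::{finite,linorder}) < CARD('d)"
  unfolding coord_index_def by (rule psubset_card_mono) auto

lemma coord_index_strict_mono: "a < b \<Longrightarrow> coord_index a < coord_index (b :: 'd::{finite,linorder})"
  unfolding coord_index_def by (rule psubset_card_mono) auto

lemma bij_coord_index: "bij_betw coord_index (UNIV :: 'd::{finite,linorder} set) {..<CARD('d)}"
proof -
  have inj: "inj (coord_index :: 'd \<Rightarrow> nat)"
    by (rule injI) (metis coord_index_strict_mono less_irrefl linorder_neqE)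
  have "range (coord_index :: 'd \<Rightarrow> nat) = {..<CARD('d)}"
    by (rule card_subset_eq) (use coord_index_less inj in \<open>auto simp: card_image\<close>)
  with inj show ?thesis by (simp add: bij_betw_def)
qed

lemma card_greater: "card {b. (a :: 'd::{finite,linorder}) < b} = CARD('d) - 1 - coord_index a"
proof -
  have "(UNIV :: 'd set) = insert a ({b. b < a} \<union> {b. a < b})" by auto
  then have "CARD('d) = card (insert a ({b. b < a} \<union> {b. a < b}))" by (rule arg_cong)
  also have "\<dots> = Suc (card {b. b < a} + card {b. a < b})"
    by (subst card_insert_disjoint) (auto intro!: card_Un_disjoint)
  finally show ?thesis unfolding coord_index_def by simp
qed

text \<open>The pair \<open>(a, b)\<close> stands for the rotation in the plane of these
  coordinates. If both indices are at least \<open>k\<close>, the rotation fixes every point of the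
  plate, and the pair is left out.\<close>

definition plate_pairs :: "nat \<Rightarrow> ('d::{finite,linorder} \<times> 'd) set" where
  "plate_pairs k = {(a, b). a < b \<and> coord_index a < k}"

lemma card_plate_pairs:
  assumes "k \<le> CARD('d::{finite,linorder})"
  shows "int (card (plate_pairs k :: ('d \<times> 'd) set)) = plate_dof CARD('d) k"
proof -
  have "plate_pairs k = Sigma {a :: 'd. coord_index a < k} (\<lambda>a. {b. a < b})"
    by (auto simp: plate_pairs_def)
  then have "card (plate_pairs k :: ('d \<times> 'd) set) =
      (\<Sum>a | coord_index (a :: 'd) < k. CARD('d) - 1 - coord_index a)"
    by (simp add: card_SigmaI card_greater)
  also have "\<dots> = (\<Sum>i<k. CARD('d) - 1 - i)"
  proof (rule sum.reindex_bij_betw)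
    have "coord_index ` {a :: 'd. coord_index a < k} = {..<k}"
    proof (intro equalityI subsetI)
      fix i assume i: "i \<in> {..<k}"
      with assms have "i \<in> range (coord_index :: 'd \<Rightarrow> nat)"
        using bij_coord_index[where 'd = 'd] by (simp add: bij_betw_def)
      then show "i \<in> coord_index ` {a :: 'd. coord_index a < k}" using i by auto
    qed auto
    then show "bij_betw coord_index {a :: 'd. coord_index a < k} {..<k}"
      using bij_coord_index[where 'd = 'd] by (auto simp: bij_betw_def intro: inj_on_subset)
  qed
  finally have "int (card (plate_pairs k :: ('d \<times> 'd) set)) = (\<Sum>i<k. int (CARD('d) - 1 - i))" by simp
  also have "\<dots> = plate_dof CARD('d) k"
    using assms
  proof (induction k)
    case (Suc k)
    then show ?case by (simp add: plate_dof_def algebra_simps numeral_2_eq_2)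
  qed (simp add: plate_dof_def)
  finally show ?thesis .
qed

text \<open>The entries of a symmetric matrix: of the \<open>d * d\<close> period derivatives, the
  rotations of the whole framework take away the skew-symmetric ones. This is the origin of the
  constant \<open>(d + 1) choose 2\<close>.\<close>

definition sym_pairs :: "('d::{finite,linorder} \<times> 'd) set" where
  "sym_pairs = {(a, b). a \<le> b}"

lemma card_sym_pairs: "card (sym_pairs :: ('d::{finite,linorder} \<times> 'd) set) = (CARD('d) + 1) choose 2"
proof -
  have eq: "(sym_pairs :: ('d \<times> 'd) set) = plate_pairs CARD('d) \<union> (\<lambda>a. (a, a)) ` UNIV"
    by (auto simp: sym_pairs_def plate_pairs_def coord_index_less)
  have "card (sym_pairs :: ('d \<times> 'd) set) = card (plate_pairs CARD('d) :: ('d \<times> 'd) set) + CARD('d)"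
    unfolding eq by (subst card_Un_disjoint) (auto simp: plate_pairs_def card_image inj_on_def)
  then have "int (card (sym_pairs :: ('d \<times> 'd) set)) = plate_dof CARD('d) CARD('d) + int CARD('d)"
    using card_plate_pairs[of "CARD('d)", where 'd = 'd] by simp
  moreover have "2 * ((n + 1) choose 2) = n * (n + 1)" for n :: nat
    by (simp add: choose_two)
  from this[of "CARD('d)"] have "2 * int ((CARD('d) + 1) choose 2) = int CARD('d) * (int CARD('d) + 1)"
    by (metis (no_types) of_nat_1 of_nat_add of_nat_mult of_nat_numeral)
  ultimately have "int (card (sym_pairs :: ('d \<times> 'd) set)) = int ((CARD('d) + 1) choose 2)"
    unfolding plate_dof_def by (simp add: algebra_simps)
  then show ?thesis by simp
qed

section \<open>Decomposing a sparse graph\<close>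

lemma equiv_connectivity: "equiv (verts G) (connectivity G)"
proof -
  have "sym ((adjacency G)\<^sup>*)"
    by (intro sym_rtrancl) (unfold sym_def adjacency_def, auto, metis Upair_inject)
  then show ?thesis
    unfolding equiv_def refl_on_def sym_def trans_def connectivity_def
    by (auto intro: rtrancl_trans)
qed

lemma num_components_eq: "num_components G = card ((\<lambda>v. connectivity G `` {v}) ` verts G)"
  unfolding num_components_def quotient_def by (rule arg_cong[where f = card]) auto

locale oriented =
  fixes Q :: "('v, 'e) mgraph" and s t :: "'e \<Rightarrow> 'v"
  assumes ends: "e \<in> edges Q \<Longrightarrow> ends Q e = Upair (s e) (t e)"
begin

lemma verts_edge_subgraph: "F \<subseteq> edges Q \<Longrightarrow> verts (edge_subgraph Q F) = s ` F \<union> t ` F"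
  by (auto simp: edge_subgraph_def subset_eq ends)

lemma adjacency_edge_subgraph:
  "F \<subseteq> edges Q \<Longrightarrow> adjacency (edge_subgraph Q F) = {(u, w). \<exists>e\<in>F. {u, w} = {s e, t e}}"
  by (auto simp: edge_subgraph_def adjacency_def subset_eq ends doubleton_eq_iff; force)

lemma connectivity_ends:
  assumes "F \<subseteq> edges Q" "e \<in> F"
  shows "connectivity (edge_subgraph Q F) `` {s e} = connectivity (edge_subgraph Q F) `` {t e}"
proof (rule equiv_class_eq[OF equiv_connectivity])
  show "(s e, t e) \<in> connectivity (edge_subgraph Q F)"
    using assms unfolding connectivity_def verts_edge_subgraph[OF assms(1)] adjacency_edge_subgraph[OF assms(1)]
    by auto
qed

text \<open>Translates the graph-theoretic term of the count into the linear rank on which the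
  assignment of labels rests; \<open>\<rho>\<close> chooses one vertex in each component.\<close>

lemma components_le_dim_inc:
  assumes "F \<subseteq> edges Q" "finite F"
  shows "card (verts (edge_subgraph Q F)) \<le> num_components (edge_subgraph Q F) + fv.dim (inc s t ` F)"
proof -
  let ?H = "edge_subgraph Q F"
  let ?V = "verts ?H"
  define \<rho> where "\<rho> v = (SOME u. u \<in> connectivity ?H `` {v})" for v
  have fin: "finite ?V" using assms by (simp add: verts_edge_subgraph)
  have \<rho>: "(v, \<rho> v) \<in> connectivity ?H" if "v \<in> ?V" for v
  proof -
    have "v \<in> connectivity ?H `` {v}" using that by (auto simp: connectivity_def)
    then have "\<rho> v \<in> connectivity ?H `` {v}" unfolding \<rho>_def by (rule someI)
    then show ?thesis by simp
  qed
  have "\<rho> ` ?V = (\<lambda>C. SOME u. u \<in> C) ` (\<lambda>v. connectivity ?H `` {v}) ` ?V"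
    unfolding \<rho>_def image_image ..
  then have "card (\<rho> ` ?V) \<le> num_components ?H"
    unfolding num_components_eq using fin by (metis card_image_le finite_imageI)
  moreover have "card (?V - \<rho> ` ?V) \<le> fv.dim (inc s t ` F)"
    using \<rho> fin assms(2) unfolding connectivity_def adjacency_edge_subgraph[OF assms(1)]
    by (intro card_le_dim_inc) auto
  moreover have "\<rho> ` ?V \<subseteq> ?V" using \<rho> by (auto simp: connectivity_def)
  then have "card (?V - \<rho> ` ?V) = card ?V - card (\<rho> ` ?V)"
    using fin by (intro card_Diff_subset) (auto intro: finite_subset)
  ultimately show ?thesis by linarith
qed

end

section \<open>Labels of edges, one for each rank function\<close>

datatype ('v, 'd) label = Tree 'd | Sym 'd 'd | Plate 'v 'd 'd

definition labels :: "'v set \<Rightarrow> ('v \<Rightarrow> nat) \<Rightarrow> ('v, 'd::{finite,linorder}) label set" where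
  "labels V k = range Tree \<union> (\<lambda>(a, b). Sym a b) ` sym_pairs
     \<union> (\<lambda>(v, a, b). Plate v a b) ` (SIGMA v:V. plate_pairs (k v))"

lemma sum_labels:
  fixes f :: "('v, 'd::{finite,linorder}) label \<Rightarrow> nat"
  assumes "finite V"
  shows "(\<Sum>i\<in>labels V k. f i) = (\<Sum>a\<in>UNIV. f (Tree a)) + (\<Sum>(a, b)\<in>sym_pairs. f (Sym a b))
    + (\<Sum>v\<in>V. \<Sum>(a, b)\<in>plate_pairs (k v). f (Plate v a b))"
proof -
  let ?S = "(\<lambda>(a, b). Sym a b) ` sym_pairs :: ('v, 'd) label set"
  let ?P = "(\<lambda>(v, a, b). Plate v a b) ` (SIGMA v:V. plate_pairs (k v)) :: ('v, 'd) label set"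
  have fin: "finite (range Tree :: ('v, 'd) label set)" "finite ?S" "finite ?P"
    using assms by auto
  have "(\<Sum>i\<in>labels V k. f i) = sum f (range Tree) + sum f ?S + sum f ?P"
    unfolding labels_def using fin
    by (subst sum.union_disjoint; (subst sum.union_disjoint)?) auto
  moreover have "sum f (range Tree) = (\<Sum>a\<in>UNIV. f (Tree a))"
    by (simp add: sum.reindex inj_on_def)
  moreover have "sum f ?S = (\<Sum>(a, b)\<in>sym_pairs. f (Sym a b))"
    by (subst sum.reindex) (auto simp: inj_on_def intro!: sum.cong)
  moreover have "sum f ?P = (\<Sum>v\<in>V. \<Sum>(a, b)\<in>plate_pairs (k v). f (Plate v a b))"
    using assms by (subst sum.reindex) (auto simp: inj_on_def sum.Sigma intro!: sum.cong)
  ultimately show ?thesis by simp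
qed

lemma finite_labels: "finite V \<Longrightarrow> finite (labels V k)"
  unfolding labels_def by auto

lemma label_decomposition:
  fixes s t :: "'e \<Rightarrow> 'v" and k :: "'v \<Rightarrow> nat"
  assumes fin: "finite E" "finite V" and st: "s ` E \<subseteq> V" "t ` E \<subseteq> V" and ne: "V \<noteq> {}"
    and k: "\<And>v. v \<in> V \<Longrightarrow> k v \<le> CARD('d::{finite,linorder})"
    and total: "int (card E) = int CARD('d) * (int (card V) - 1) + (\<Sum>v\<in>V. plate_dof CARD('d) (k v))
      + int ((CARD('d) + 1) choose 2)"
    and sparse: "\<And>F. F \<subseteq> E \<Longrightarrow> F \<noteq> {} \<Longrightarrow> int (card F) \<le> int CARD('d) * int (fv.dim (inc s t ` F))
      + (\<Sum>v\<in>s ` F \<union> t ` F. plate_dof CARD('d) (k v)) + int ((CARD('d) + 1) choose 2)"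
  shows "\<exists>\<phi> :: 'e \<Rightarrow> ('v, 'd) label. \<phi> ` E \<subseteq> labels V k
    \<and> (\<forall>a. spanning_tree s t V {e\<in>E. \<phi> e = Tree a})
    \<and> (\<forall>i\<in>labels V k. i \<notin> range Tree \<longrightarrow> card {e\<in>E. \<phi> e = i} = 1)
    \<and> (\<forall>e\<in>E. \<forall>v a b. \<phi> e = Plate v a b \<longrightarrow> v \<in> {s e, t e})"
proof -
  \<comment> \<open>A \<open>Sym\<close> label accepts any edge; a \<open>Plate\<close> label counts
    only edges at its vertex.\<close>
  define meets where "meets i = (case i of Plate v a b \<Rightarrow> {e. v \<in> {s e, t e}} | _ \<Rightarrow> UNIV)"
    for i :: "('v, 'd) label"
  define r where "r i = (if i \<in> range Tree then (\<lambda>X. fv.dim (inc s t ` X))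
      else (\<lambda>X. of_bool (X \<inter> meets i \<noteq> {})))" for i :: "('v, 'd) label"
  let ?I = "labels V k :: ('v, 'd) label set"
  have r: "submod_rank (r i)" for i
    unfolding r_def
    by (cases "i \<in> range Tree") (simp_all only: if_True if_False submod_rank_fv_dim submod_rank_meets)
  \<comment> \<open>Every edge starts with the full list of labels. That a plate label lands at its
    vertex is left to its rank function, which vanishes on sets of edges away from that
    vertex.\<close>
  have "card F \<le> (\<Sum>i\<in>?I. r i {e\<in>F. i \<in> ?I})" if F: "F \<subseteq> E" for F
  proof (cases "F = {}")
    case False
    have VF: "s ` F \<union> t ` F \<subseteq> V" using F st by blast
    have meets_plate: "F \<inter> meets (Plate v a b) \<noteq> {} \<longleftrightarrow> v \<in> s ` F \<union> t ` F" for v a b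
      by (auto simp: meets_def)
    have "(\<Sum>i\<in>?I. r i F) = (\<Sum>a\<in>(UNIV :: 'd set). fv.dim (inc s t ` F)) + (\<Sum>(a, b)\<in>(sym_pairs :: ('d \<times> 'd) set). 1)
        + (\<Sum>v\<in>V. \<Sum>(a, b)\<in>(plate_pairs (k v) :: ('d \<times> 'd) set). of_bool (v \<in> s ` F \<union> t ` F))"
      unfolding sum_labels[OF fin(2)]
      by (intro arg_cong2[where f = "(+)"] sum.cong refl)
        (use False in \<open>auto simp: r_def meets_plate[unfolded Un_iff] meets_def image_iff\<close>)
    also have "\<dots> = CARD('d) * fv.dim (inc s t ` F) + card (sym_pairs :: ('d \<times> 'd) set)
        + (\<Sum>v\<in>s ` F \<union> t ` F. card (plate_pairs (k v) :: ('d \<times> 'd) set))"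
    proof -
      have "(\<Sum>v\<in>V. \<Sum>(a, b)\<in>(plate_pairs (k v) :: ('d \<times> 'd) set). of_bool (v \<in> s ` F \<union> t ` F))
        = (\<Sum>v\<in>V. if v \<in> s ` F \<union> t ` F then card (plate_pairs (k v) :: ('d \<times> 'd) set) else 0)"
        by (intro sum.cong) (auto simp: case_prod_beta)
      also have "\<dots> = (\<Sum>v\<in>s ` F \<union> t ` F. card (plate_pairs (k v) :: ('d \<times> 'd) set))"
        using VF fin(2) by (intro sum.mono_neutral_cong_right) auto
      finally show ?thesis by (simp add: case_prod_beta)
    qed
    finally have "int (\<Sum>i\<in>?I. r i F) = int CARD('d) * int (fv.dim (inc s t ` F))
        + int ((CARD('d) + 1) choose 2) + (\<Sum>v\<in>s ` F \<union> t ` F. int (card (plate_pairs (k v) :: ('d \<times> 'd) set)))"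
      by (simp add: card_sym_pairs)
    also have "(\<Sum>v\<in>s ` F \<union> t ` F. int (card (plate_pairs (k v) :: ('d \<times> 'd) set)))
        = (\<Sum>v\<in>s ` F \<union> t ` F. plate_dof CARD('d) (k v))"
      using VF k by (intro sum.cong card_plate_pairs) auto
    finally have "int (card F) \<le> int (\<Sum>i\<in>?I. r i F)" using sparse[OF F False] by linarith
    then have "card F \<le> (\<Sum>i\<in>?I. r i F)" unfolding of_nat_le_iff .
    also have "\<dots> = (\<Sum>i\<in>?I. r i {e\<in>F. i \<in> ?I})" by (intro sum.cong) auto
    finally show ?thesis .
  qed simp
  then obtain \<phi> where \<phi>: "\<phi> ` E \<subseteq> ?I"
    and ind: "\<And>F. F \<subseteq> E \<Longrightarrow> card F \<le> (\<Sum>i\<in>?I. r i {e\<in>F. \<phi> e = i})"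
    using independent_assignment[OF fin(1) finite_labels[OF fin(2), of k], of r "\<lambda>_. ?I"] r by blast
  define X where "X i = {e\<in>E. \<phi> e = i}" for i
  have finX: "finite (X i)" for i using fin by (simp add: X_def)
  \<comment> \<open>On one fibre of \<open>\<phi>\<close>, every other summand is the rank of the
    empty set.\<close>
  have X_le: "card (X i) \<le> r i (X i)" if i: "i \<in> ?I" for i
  proof -
    have "card (X i) \<le> (\<Sum>j\<in>?I. r j {e\<in>X i. \<phi> e = j})" by (rule ind) (auto simp: X_def)
    also have "\<dots> = (\<Sum>j\<in>{i}. r j {e\<in>X i. \<phi> e = j})"
    proof (rule sum.mono_neutral_right)
      show "\<forall>j\<in>?I - {i}. r j {e\<in>X i. \<phi> e = j} = 0"
      proof
        fix j assume "j \<in> ?I - {i}"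
        then have empty: "{e\<in>X i. \<phi> e = j} = {}" by (auto simp: X_def)
        show "r j {e\<in>X i. \<phi> e = j} = 0" unfolding empty using r[of j] by (simp add: submod_rank_def)
      qed
    qed (use i finite_labels[OF fin(2)] in auto)
    also have "\<dots> = r i (X i)" by (auto simp: X_def intro!: arg_cong[where f = "r i"])
    finally show ?thesis .
  qed
  have tree_indep: "row_indep (X (Tree a)) UNIV (inc s t)" for a
  proof -
    have "card (X (Tree a)) \<le> fv.dim (inc s t ` X (Tree a))"
      using X_le[of "Tree a"] by (auto simp: labels_def r_def)
    moreover have "fv.dim (inc s t ` X (Tree a)) \<le> card (inc s t ` X (Tree a))"
      using finX by (intro fv.dim_le_card) (auto intro: fv.span_base)
    moreover have "card (inc s t ` X (Tree a)) \<le> card (X (Tree a))" using finX by (rule card_image_le)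
    ultimately have "fv.dim (inc s t ` X (Tree a)) = card (X (Tree a))" by linarith
    then show ?thesis unfolding fv_dim_image_eq_card_iff[OF finX] .
  qed
  define R where "R i = (if i \<in> range Tree then card V - 1 else 1)" for i :: "('v, 'd) label"
  have X_le_R: "card (X i) \<le> R i" if "i \<in> ?I" for i
  proof (cases "i \<in> range Tree")
    case True
    then obtain a where a: "i = Tree a" by blast
    obtain x where x: "x \<in> V" using ne by blast
    have "row_indep (X i) (V - {x}) (inc s t)"
      unfolding a using st x fin(2) tree_indep
      by (intro row_indep_inc_drop[where \<rho> = "\<lambda>_. ()"]) (auto simp: X_def)
    then have "card (X i) \<le> card (V - {x})" using finX fin(2) by (intro row_indep_card_le) auto
    then show ?thesis using True x fin(2) by (simp add: R_def)
  next
    case False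
    then have "r i (X i) \<le> 1" by (simp add: r_def)
    then show ?thesis using False X_le[OF that] by (simp add: R_def)
  qed
  have "(\<Sum>i\<in>?I. R i) = CARD('d) * (card V - 1) + card (sym_pairs :: ('d \<times> 'd) set)
      + (\<Sum>v\<in>V. card (plate_pairs (k v) :: ('d \<times> 'd) set))"
    unfolding sum_labels[OF fin(2)] by (simp add: R_def case_prod_beta image_iff)
  moreover have "card V \<ge> 1" using ne fin(2) by (simp add: Suc_le_eq card_gt_0_iff)
  ultimately have "int (\<Sum>i\<in>?I. R i) = int (card E)"
    unfolding total using k by (simp add: card_sym_pairs card_plate_pairs of_nat_diff)
  moreover have "card E = (\<Sum>i\<in>?I. card (X i))"
  proof -
    have "E = (\<Union>i\<in>?I. X i)" using \<phi> by (auto simp: X_def)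
    then have "card E = card (\<Union>i\<in>?I. X i)" by (rule arg_cong)
    also have "\<dots> = (\<Sum>i\<in>?I. card (X i))"
      using finX finite_labels[OF fin(2)] by (intro card_UN_disjoint) (auto simp: X_def)
    finally show ?thesis .
  qed
  ultimately have "(\<Sum>i\<in>?I. card (X i)) = (\<Sum>i\<in>?I. R i)" by (simp only: of_nat_eq_iff)
  \<comment> \<open>The fibres partition \<open>E\<close> and their upper bounds add up to
    \<open>card E\<close>, so no bound is strict.\<close>
  then have X_eq: "card (X i) = R i" if "i \<in> ?I" for i
    using sum_mono_inv[of "\<lambda>i. card (X i)" ?I R i] X_le_R that finite_labels[OF fin(2), of k] by simp
  show ?thesis
  proof (intro exI[of _ \<phi>] conjI \<phi> allI ballI impI)
    fix a
    have "card (X (Tree a)) = card V - 1" using X_eq[of "Tree a"] by (simp add: labels_def R_def)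
    then show "spanning_tree s t V {e\<in>E. \<phi> e = Tree a}"
      using \<open>card V \<ge> 1\<close> tree_indep[of a] finX[of "Tree a"] st unfolding spanning_tree_def X_def by auto
  next
    fix i assume "i \<in> ?I" "i \<notin> range Tree"
    then show "card {e\<in>E. \<phi> e = i} = 1" using X_eq[of i] by (simp add: X_def R_def)
  next
    fix e v a b assume e: "e \<in> E" "\<phi> e = Plate v a b"
    then have i: "Plate v a b \<in> ?I" using \<phi> by force
    have "X (Plate v a b) \<noteq> {}" using e by (auto simp: X_def)
    then have "1 \<le> card (X (Plate v a b))" using finX by (simp add: Suc_le_eq card_gt_0_iff)
    \<comment> \<open>A nonempty fibre needs positive rank, so its single edge is incident to
      \<open>v\<close>.\<close>
    then have "card (X (Plate v a b)) = 1" "X (Plate v a b) \<inter> meets (Plate v a b) \<noteq> {}"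
      using X_le[OF i] X_eq[OF i] by (auto simp: r_def R_def split: if_splits)
    moreover have "e \<in> X (Plate v a b)" using e by (simp add: X_def)
    ultimately have "e \<in> meets (Plate v a b)" by (metis IntE card_1_singletonE ex_in_conv singletonD)
    then show "v \<in> {s e, t e}" by (simp add: meets_def)
  qed
qed

section \<open>Upper bounds for the rank of the rigidity matrix\<close>

lemma matrix_vector_sum_inner:
  fixes A :: "real ^ 'd ^ 'd"
  shows "(A *v q) \<bullet> w = (\<Sum>a\<in>UNIV. \<Sum>b\<in>UNIV. A $ a $ b * (w $ a * q $ b))"
  by (simp add: inner_vec_def matrix_vector_mult_def sum_distrib_left sum_distrib_right mult_ac)

lemma sum_elem_matrix:
  fixes f :: "'d::finite \<Rightarrow> 'd::finite \<Rightarrow> real"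
  shows "(\<Sum>a'\<in>UNIV. \<Sum>b'\<in>UNIV. elem_matrix a b $ a' $ b' * f a' b') = f a b"
proof -
  have "(\<Sum>a'\<in>UNIV. \<Sum>b'\<in>UNIV. elem_matrix a b $ a' $ b' * f a' b')
      = (\<Sum>a'\<in>UNIV. \<Sum>b'\<in>UNIV. if b' = b then (if a' = a then f a' b' else 0) else 0)"
    by (intro sum.cong) (auto simp: elem_matrix_def)
  then show ?thesis by simp
qed

lemma sum_skew_sym_eq_0:
  fixes A :: "real ^ 'd ^ 'd"
  assumes "transpose A = - A" "\<And>a b. f a b = f b a"
  shows "(\<Sum>a\<in>UNIV. \<Sum>b\<in>UNIV. A $ a $ b * f a b) = 0"
proof -
  have "A $ a $ b = - (A $ b $ a)" for a b
    using arg_cong[OF assms(1), of "\<lambda>M. M $ b $ a"] by (simp add: transpose_def)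
  then have "A $ a $ b * f a b = - (A $ b $ a * f b a)" for a b
    using assms(2)[of a b] by (metis mult_minus_left)
  then have "(\<Sum>a\<in>UNIV. \<Sum>b\<in>UNIV. A $ a $ b * f a b) = (\<Sum>a\<in>UNIV. \<Sum>b\<in>UNIV. - (A $ b $ a * f b a))"
    by (intro sum.cong refl)
  also have "\<dots> = - (\<Sum>a\<in>UNIV. \<Sum>b\<in>UNIV. A $ b $ a * f b a)"
    by (simp only: sum_negf)
  also have "(\<Sum>a\<in>UNIV. \<Sum>b\<in>UNIV. A $ b $ a * f b a) = (\<Sum>a\<in>UNIV. \<Sum>b\<in>UNIV. A $ a $ b * f a b)"
    by (rule sum.swap)
  finally show ?thesis by simp
qed

lemma skew_inner_self:
  fixes A :: "real ^ 'd ^ 'd"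
  assumes "transpose A = - A"
  shows "(A *v w) \<bullet> w = 0"
  unfolding matrix_vector_sum_inner by (rule sum_skew_sym_eq_0[OF assms]) (simp add: mult_ac)

lemma transpose_elem_matrix: "transpose (elem_matrix a b) = elem_matrix b a"
  by (simp add: transpose_def elem_matrix_def conj_commute)

lemma transpose_diff: "transpose (A - B) = transpose A - transpose B"
  for A B :: "real ^ 'n ^ 'm"
  by (simp add: transpose_def vec_eq_iff)

lemma matrix_mult_minus: "A ** - B = - (A ** B)" "- A ** B = - (A ** B)"
  for A :: "real ^ 'n ^ 'm" and B :: "real ^ 'p ^ 'n"
  by (simp_all add: matrix_matrix_mult_def vec_eq_iff sum_negf)

lemma inner_matrix_vector: "(M *v x) \<bullet> w = x \<bullet> (transpose M *v w)"
  for M :: "real ^ 'm ^ 'n"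
  by (simp add: transpose_matrix_vector inner_commute[of x] dot_lmul_matrix inner_commute[of w])

lemma skew_elem_matrix: "transpose (elem_matrix a b - elem_matrix b a) = - (elem_matrix a b - elem_matrix b a)"
  by (simp add: transpose_diff transpose_elem_matrix)

text \<open>Only the data that enter the bar equations, so that the linear algebra is independent of
  the group action.\<close>

locale bar_system =
  fixes s t :: "'y \<Rightarrow> 'x" and c qs qt :: "'y \<Rightarrow> real ^ 'd::{finite,linorder}"
    and p :: "'x \<Rightarrow> real ^ 'd::{finite,linorder}" and M :: "'x \<Rightarrow> real ^ 'd::{finite,linorder} ^ 'd::{finite,linorder}"
    and \<Lambda> :: "real ^ 'd::{finite,linorder} ^ 'd::{finite,linorder}"
begin

definition dir where
  "dir e = \<Lambda> *v c e + M (t e) *v qt e - M (s e) *v qs e + p (t e) - p (s e)"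

definition row :: "'y \<Rightarrow> ('x, 'd::{finite,linorder}) motion \<Rightarrow> real" where
  "row e = (\<lambda>(p', A, L). (L *v c e + M (t e) *v (A (t e) *v qt e) - M (s e) *v (A (s e) *v qs e)
     + p' (t e) - p' (s e)) \<bullet> dir e)"

lemma row_split: "row e (p', A, L) = row e (p', \<lambda>_. 0, 0) + row e (\<lambda>_. 0, A, 0) + row e (\<lambda>_. 0, \<lambda>_. 0, L)"
  by (simp add: row_def inner_simps)

lemma row_pos: "row e (p', \<lambda>_. 0, 0) = (\<Sum>a\<in>UNIV. (p' (t e) $ a - p' (s e) $ a) * dir e $ a)"
  by (simp add: row_def inner_vec_def)

lemma row_rot: "row e (\<lambda>_. 0, A, 0) =
   (\<Sum>a\<in>UNIV. \<Sum>b\<in>UNIV. A (t e) $ a $ b * ((transpose (M (t e)) *v dir e) $ a * qt e $ b))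
   - (\<Sum>a\<in>UNIV. \<Sum>b\<in>UNIV. A (s e) $ a $ b * ((transpose (M (s e)) *v dir e) $ a * qs e $ b))"
proof -
  have "row e (\<lambda>_. 0, A, 0) = (A (t e) *v qt e) \<bullet> (transpose (M (t e)) *v dir e)
      - (A (s e) *v qs e) \<bullet> (transpose (M (s e)) *v dir e)"
    by (simp add: row_def inner_simps inner_matrix_vector[of "M _"])
  then show ?thesis by (simp only: matrix_vector_sum_inner)
qed

lemma row_per: "row e (\<lambda>_. 0, \<lambda>_. 0, B ** \<Lambda>) = (\<Sum>a\<in>UNIV. \<Sum>b\<in>UNIV. B $ a $ b * (dir e $ a * (\<Lambda> *v c e) $ b))"
  unfolding row_def prod.case matrix_vector_mul_assoc[symmetric] by (simp add: matrix_vector_sum_inner)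

text \<open>The derivative of a plate frame is \<open>M i ** A i\<close>, so the global rotation
  \<open>A\<close> reads \<open>transpose (M i) ** A ** M i\<close> in the coordinates of the plate.
  It turns every bar vector into \<open>A *v dir e\<close>, which is orthogonal to
  \<open>dir e\<close>.\<close>

lemma row_rotation:
  assumes "transpose A = - A" "orthogonal_matrix (M (s e))" "orthogonal_matrix (M (t e))"
  shows "row e (\<lambda>i. A *v p i, \<lambda>i. transpose (M i) ** A ** M i, A ** \<Lambda>) = 0"
proof -
  have *: "M i *v ((transpose (M i) ** A ** M i) *v q) = A *v (M i *v q)" if "orthogonal_matrix (M i)" for i q
  proof -
    have "M i ** (transpose (M i) ** A ** M i) = (M i ** transpose (M i)) ** A ** M i"
      by (simp add: matrix_mul_assoc)
    also have "\<dots> = A ** M i" using that by (simp add: orthogonal_matrix_def)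
    finally show ?thesis by (simp add: matrix_vector_mul_assoc)
  qed
  have "row e (\<lambda>i. A *v p i, \<lambda>i. transpose (M i) ** A ** M i, A ** \<Lambda>) = (A *v dir e) \<bullet> dir e"
    unfolding row_def prod.case *[OF assms(2)] *[OF assms(3)]
    by (simp add: dir_def matrix_vector_right_distrib matrix_vector_mult_diff_distrib
        matrix_vector_mul_assoc)
  then show ?thesis using skew_inner_self[OF assms(1)] by simp
qed

lemma row_Pos: "row e (unit_motion (Pos i a)) = dir e $ a * inc s t e i"
  by (simp add: row_pos inc_def axis_def if_distrib sum.delta algebra_simps cong: if_cong)

text \<open>Writing period derivatives as \<open>B ** \<Lambda>\<close> separates the symmetric
  \<open>B\<close>, tested here, from the skew-symmetric \<open>B\<close>, which belong to rotations
  of the whole framework.\<close>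

definition test_motion :: "('x, 'd::{finite,linorder}) unknown \<Rightarrow> ('x, 'd) motion" where
  "test_motion u = (case u of Per a b \<Rightarrow> (\<lambda>_. 0, \<lambda>_. 0, (elem_matrix a b + elem_matrix b a) ** \<Lambda>)
     | _ \<Rightarrow> unit_motion u)"

text \<open>Testing the rows on the positions outside \<open>R\<close>, the rotations, and the symmetric period
  derivatives suffices: the remaining directions are spanned by translations of the components and
  rotations of the whole framework.\<close>

lemma row_indep_test_motions:
  fixes k :: "'x \<Rightarrow> nat"
  assumes S: "finite S" and V: "V = s ` S \<union> t ` S"
    and \<rho>: "\<And>e. e \<in> S \<Longrightarrow> \<rho> (s e) = \<rho> (t e)" "R \<subseteq> V" "inj_on \<rho> R"
    and M: "\<And>i. i \<in> V \<Longrightarrow> orthogonal_matrix (M i)" and \<Lambda>: "invertible \<Lambda>"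
    and qs: "\<And>e a. e \<in> S \<Longrightarrow> k (s e) \<le> coord_index a \<Longrightarrow> qs e $ a = 0"
    and qt: "\<And>e a. e \<in> S \<Longrightarrow> k (t e) \<le> coord_index a \<Longrightarrow> qt e $ a = 0"
    and U: "V \<subseteq> U"
    and indep: "row_indep S ({Pos i a | i a. i \<in> U} \<union> {Rot i a b | i a b. i \<in> U \<and> a < b \<and> coord_index a < k i}
      \<union> {Per a b | a b. True}) (\<lambda>e u. row e (unit_motion u))"
  shows "row_indep S ((\<lambda>(i, a). Pos i a) ` ((V - R) \<times> UNIV)
      \<union> (\<lambda>(i, a, b). Rot i a b) ` (SIGMA i:V. plate_pairs (k i)) \<union> (\<lambda>(a, b). Per a b) ` sym_pairs)
    (\<lambda>e u. row e (test_motion u))" (is "row_indep S ?X _")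
  unfolding row_indep_def
proof (intro allI impI)
  fix l assume l: "\<forall>u\<in>?X. (\<Sum>e\<in>S. l e * row e (test_motion u)) = 0"
  define g where "g m = (\<Sum>e\<in>S. l e * row e m)" for m
  have finV: "finite V" using S V by simp
  have sV: "s ` S \<subseteq> V" and tV: "t ` S \<subseteq> V" using V by auto
  have g_split: "g (p', A, L) = g (p', \<lambda>_. 0, 0) + g (\<lambda>_. 0, A, 0) + g (\<lambda>_. 0, \<lambda>_. 0, L)" for p' A L
    unfolding g_def by (subst row_split) (simp add: algebra_simps sum.distrib)

  \<comment> \<open>The position columns at \<open>R\<close> follow from the others by translating
    each component.\<close>
  have pos0: "(\<Sum>e\<in>S. (l e * dir e $ a) * inc s t e i) = 0" for i a
  proof (rule inc_combination_eq_0[OF finV sV tV \<rho>])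
    fix v assume "v \<in> V - R"
    then have "Pos v a \<in> ?X" by force
    with l have "(\<Sum>e\<in>S. l e * row e (test_motion (Pos v a))) = 0" by blast
    then show "(\<Sum>e\<in>S. (l e * dir e $ a) * inc s t e v) = 0"
      by (simp only: test_motion_def unknown.case row_Pos mult.assoc)
  qed
  have g_pos: "g (p', \<lambda>_. 0, 0) = 0" for p'
  proof -
    have "g (p', \<lambda>_. 0, 0) = (\<Sum>e\<in>S. \<Sum>a\<in>UNIV. l e * dir e $ a * (p' (t e) $ a - p' (s e) $ a))"
      by (simp add: g_def row_pos sum_distrib_left mult_ac)
    also have "\<dots> = (\<Sum>e\<in>S. \<Sum>a\<in>UNIV. l e * dir e $ a * (\<Sum>i\<in>V. p' i $ a * inc s t e i))"
      using sV tV by (intro sum.cong refl) (auto simp: sum_inc[OF finV] image_subset_iff)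
    also have "\<dots> = (\<Sum>a\<in>UNIV. \<Sum>e\<in>S. \<Sum>i\<in>V. p' i $ a * (l e * dir e $ a * inc s t e i))"
      by (subst sum.swap) (simp add: sum_distrib_left mult_ac)
    also have "\<dots> = (\<Sum>a\<in>UNIV. \<Sum>i\<in>V. p' i $ a * (\<Sum>e\<in>S. l e * dir e $ a * inc s t e i))"
      by (subst sum.swap[of _ V]) (simp add: sum_distrib_left)
    finally show ?thesis using pos0 by simp
  qed

  \<comment> \<open>\<open>K i a b\<close> is the coefficient of entry \<open>(a, b)\<close> of
    \<open>A i\<close>. Skew-symmetric matrices see only its antisymmetric part, so it suffices that
    \<open>K i\<close> is symmetric.\<close>
  define K where "K i a b = (\<Sum>e\<in>S. l e * (of_bool (t e = i) * ((transpose (M i) *v dir e) $ a * qt e $ b)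
      - of_bool (s e = i) * ((transpose (M i) *v dir e) $ a * qs e $ b)))" for i a b
  have g_rot: "g (\<lambda>_. 0, A, 0) = (\<Sum>i\<in>V. \<Sum>a\<in>UNIV. \<Sum>b\<in>UNIV. A i $ a $ b * K i a b)" for A
  proof -
    let ?f = "\<lambda>q e i. \<Sum>a\<in>UNIV. \<Sum>b\<in>UNIV. A i $ a $ b * ((transpose (M i) *v dir e) $ a * q e $ b)"
    have delta: "(\<Sum>i\<in>V. of_bool (x = i) * f i) = f x" if "x \<in> V" for x and f :: "'x \<Rightarrow> real"
      using that finV by simp
    have "g (\<lambda>_. 0, A, 0) = (\<Sum>e\<in>S. l e * (\<Sum>i\<in>V. of_bool (t e = i) * ?f qt e i - of_bool (s e = i) * ?f qs e i))"
      unfolding g_def row_rot using sV tV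
      by (intro sum.cong refl) (auto simp: sum_subtractf delta image_subset_iff)
    also have "\<dots> = (\<Sum>i\<in>V. \<Sum>e\<in>S. l e * (of_bool (t e = i) * ?f qt e i - of_bool (s e = i) * ?f qs e i))"
      by (subst sum.swap) (simp add: sum_distrib_left)
    also have "\<dots> = (\<Sum>i\<in>V. \<Sum>a\<in>UNIV. \<Sum>b\<in>UNIV. A i $ a $ b * K i a b)"
    proof (rule sum.cong[OF refl])
      fix i
      have "(\<Sum>a\<in>UNIV. \<Sum>b\<in>UNIV. A i $ a $ b * K i a b) = (\<Sum>a\<in>UNIV. \<Sum>b\<in>UNIV. \<Sum>e\<in>S.
          l e * (of_bool (t e = i) * (A i $ a $ b * ((transpose (M i) *v dir e) $ a * qt e $ b))
          - of_bool (s e = i) * (A i $ a $ b * ((transpose (M i) *v dir e) $ a * qs e $ b))))"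
        unfolding K_def sum_distrib_left by (intro sum.cong refl) (simp add: algebra_simps)
      also have "\<dots> = (\<Sum>a\<in>UNIV. \<Sum>e\<in>S. \<Sum>b\<in>UNIV.
          l e * (of_bool (t e = i) * (A i $ a $ b * ((transpose (M i) *v dir e) $ a * qt e $ b))
          - of_bool (s e = i) * (A i $ a $ b * ((transpose (M i) *v dir e) $ a * qs e $ b))))"
        by (intro sum.cong refl sum.swap)
      also have "\<dots> = (\<Sum>e\<in>S. \<Sum>a\<in>UNIV. \<Sum>b\<in>UNIV.
          l e * (of_bool (t e = i) * (A i $ a $ b * ((transpose (M i) *v dir e) $ a * qt e $ b))
          - of_bool (s e = i) * (A i $ a $ b * ((transpose (M i) *v dir e) $ a * qs e $ b))))"
        by (rule sum.swap)
      also have "\<dots> = (\<Sum>e\<in>S. l e * (of_bool (t e = i) * ?f qt e i - of_bool (s e = i) * ?f qs e i))"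
        by (simp only: sum_distrib_left[symmetric] sum_subtractf)
      finally show "(\<Sum>e\<in>S. l e * (of_bool (t e = i) * ?f qt e i - of_bool (s e = i) * ?f qs e i))
          = (\<Sum>a\<in>UNIV. \<Sum>b\<in>UNIV. A i $ a $ b * K i a b)" ..
    qed
    finally show ?thesis .
  qed
  have K_less: "K i a b = K i b a" if i: "i \<in> V" and ab: "a < b" for i a b
  proof (cases "coord_index a < k i")
    case True
    with i ab have "Rot i a b \<in> ?X" by (force simp: plate_pairs_def)
    with l have "(\<Sum>e\<in>S. l e * row e (test_motion (Rot i a b))) = 0" by blast
    then have "0 = g (unit_motion (Rot i a b))" by (simp add: g_def test_motion_def)
    also have "\<dots> = (\<Sum>j\<in>V. if j = i then K i a b - K i b a else 0)"
      unfolding unit_motion.simps g_rot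
      by (intro sum.cong refl) (auto simp: sum_elem_matrix left_diff_distrib sum_subtractf)
    finally show ?thesis using i finV by simp
  next
    case False
    \<comment> \<open>Both coordinates lie outside the plate, where attachment points vanish, so
      both coefficients are zero.\<close>
    then have "k i \<le> coord_index a" "k i \<le> coord_index b"
      using coord_index_strict_mono[OF ab] by auto
    then show ?thesis unfolding K_def using qs qt by (intro sum.cong refl) auto
  qed
  have g_skew: "g (\<lambda>_. 0, A, 0) = 0" if "\<And>i. i \<in> V \<Longrightarrow> transpose (A i) = - A i" for A
    unfolding g_rot
  proof (rule sum.neutral, rule ballI)
    fix i assume i: "i \<in> V"
    show "(\<Sum>a\<in>UNIV. \<Sum>b\<in>UNIV. A i $ a $ b * K i a b) = 0"
      by (rule sum_skew_sym_eq_0[OF that[OF i]]) (metis K_less[OF i] linorder_neqE)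
  qed

  \<comment> \<open>\<open>N a b\<close> is the coefficient of entry \<open>(a, b)\<close> of
    \<open>B\<close>. The symmetric tests make \<open>N\<close> antisymmetric, the rotations make it
    symmetric, hence it vanishes.\<close>
  define N where "N a b = (\<Sum>e\<in>S. l e * (dir e $ a * (\<Lambda> *v c e) $ b))" for a b
  have g_per: "g (\<lambda>_. 0, \<lambda>_. 0, B ** \<Lambda>) = (\<Sum>a\<in>UNIV. \<Sum>b\<in>UNIV. B $ a $ b * N a b)" for B
  proof -
    have "(\<Sum>a\<in>UNIV. \<Sum>b\<in>UNIV. B $ a $ b * N a b)
        = (\<Sum>a\<in>UNIV. \<Sum>b\<in>UNIV. \<Sum>e\<in>S. l e * (B $ a $ b * (dir e $ a * (\<Lambda> *v c e) $ b)))"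
      unfolding N_def sum_distrib_left by (intro sum.cong refl) (simp add: algebra_simps)
    also have "\<dots> = (\<Sum>a\<in>UNIV. \<Sum>e\<in>S. \<Sum>b\<in>UNIV. l e * (B $ a $ b * (dir e $ a * (\<Lambda> *v c e) $ b)))"
      by (intro sum.cong refl sum.swap)
    also have "\<dots> = (\<Sum>e\<in>S. \<Sum>a\<in>UNIV. \<Sum>b\<in>UNIV. l e * (B $ a $ b * (dir e $ a * (\<Lambda> *v c e) $ b)))"
      by (rule sum.swap)
    also have "\<dots> = g (\<lambda>_. 0, \<lambda>_. 0, B ** \<Lambda>)"
      unfolding g_def row_per by (simp only: sum_distrib_left)
    finally show ?thesis ..
  qed
  have N_le: "N a b = - N b a" if "a \<le> b" for a b
  proof -
    have "Per a b \<in> ?X" using that by (force simp: sym_pairs_def)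
    with l have "(\<Sum>e\<in>S. l e * row e (test_motion (Per a b))) = 0" by blast
    then have "0 = g (\<lambda>_. 0, \<lambda>_. 0, (elem_matrix a b + elem_matrix b a) ** \<Lambda>)"
      by (simp add: g_def test_motion_def)
    also have "\<dots> = N a b + N b a"
      unfolding g_per by (simp add: distrib_right sum.distrib sum_elem_matrix)
    finally show ?thesis by simp
  qed
  have N_sym: "N a b = N b a" for a b
  proof -
    let ?A = "elem_matrix a b - elem_matrix b a"
    have skew: "transpose (transpose (M i) ** ?A ** M i) = - (transpose (M i) ** ?A ** M i)" for i
    proof -
      have "transpose (transpose (M i) ** ?A ** M i) = transpose (M i) ** transpose ?A ** M i"
        by (simp add: matrix_transpose_mul matrix_mul_assoc)
      also have "\<dots> = - (transpose (M i) ** ?A ** M i)"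
        unfolding skew_elem_matrix by (simp only: matrix_mult_minus)
      finally show ?thesis .
    qed
    \<comment> \<open>A global rotation annihilates every row; its position and plate parts are
      already known to contribute zero, so its period part does too.\<close>
    have "0 = g (\<lambda>i. ?A *v p i, \<lambda>i. transpose (M i) ** ?A ** M i, ?A ** \<Lambda>)"
      unfolding g_def using M V
      by (intro sum.neutral[symmetric] ballI) (simp add: row_rotation[OF skew_elem_matrix])
    also have "\<dots> = g (\<lambda>_. 0, \<lambda>_. 0, ?A ** \<Lambda>)"
      by (subst g_split) (simp add: g_pos g_skew skew)
    also have "\<dots> = N a b - N b a"
      unfolding g_per by (simp add: left_diff_distrib sum_subtractf sum_elem_matrix)
    finally show ?thesis by simp
  qed
  have N0: "N a b = 0" for a b
  proof -
    have "N a b = - N b a"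
      using N_le[of a b] N_le[of b a] by (cases "a \<le> b") auto
    then show ?thesis using N_sym[of a b] by simp
  qed
  have g_period: "g (\<lambda>_. 0, \<lambda>_. 0, L) = 0" for L
  proof -
    obtain \<Lambda>' where "\<Lambda>' ** \<Lambda> = mat 1" using \<Lambda> by (auto simp: invertible_def)
    then have "L = (L ** \<Lambda>') ** \<Lambda>" by (simp flip: matrix_mul_assoc)
    then have "g (\<lambda>_. 0, \<lambda>_. 0, L) = g (\<lambda>_. 0, \<lambda>_. 0, (L ** \<Lambda>') ** \<Lambda>)" by simp
    then show ?thesis unfolding g_per using N0 by simp
  qed

  have "g (unit_motion u) = 0" for u
  proof (cases u)
    case (Rot i a b)
    have skew_if: "transpose (if P then B else 0) = - (if P then B else 0)"
      if "transpose B = - B" for P and B :: "real ^ 'd::{finite,linorder} ^ 'd::{finite,linorder}"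
      using that transpose_diff[of B B] by (cases P) simp_all
    show ?thesis unfolding Rot unit_motion.simps by (rule g_skew, rule skew_if, rule skew_elem_matrix)
  qed (simp_all add: g_pos g_period)
  then have "(\<Sum>e\<in>S. l e * row e (unit_motion u)) = 0" for u by (simp add: g_def)
  then show "\<forall>e\<in>S. l e = 0" using row_indepD[OF indep] by blast
qed

end

section \<open>Automorphism groups and quotients\<close>

lemma mgraph_Aut_carrier:
  "\<gamma> \<in> carrier (mgraph_Aut G) \<longleftrightarrow> fst \<gamma> \<in> Bij (verts G) \<and> snd \<gamma> \<in> Bij (edges G)
     \<and> (\<forall>e\<in>edges G. ends G (snd \<gamma> e) = map_uprod (fst \<gamma>) (ends G e))"
  by (cases \<gamma>) (simp add: mgraph_Aut_def)

lemma mgraph_Aut_mult: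
  assumes "\<gamma> \<in> carrier (mgraph_Aut G)" "\<delta> \<in> carrier (mgraph_Aut G)"
  shows "\<gamma> \<otimes>\<^bsub>mgraph_Aut G\<^esub> \<delta> = (compose (verts G) (fst \<gamma>) (fst \<delta>), compose (edges G) (snd \<gamma>) (snd \<delta>))"
  using assms unfolding mgraph_Aut_carrier
  by (cases \<gamma>; cases \<delta>) (simp add: mgraph_Aut_def DirProd_def BijGroup_def)

lemma mgraph_Aut_one: "\<one>\<^bsub>mgraph_Aut G\<^esub> = (\<lambda>x\<in>verts G. x, \<lambda>e\<in>edges G. e)"
  by (simp add: mgraph_Aut_def DirProd_def BijGroup_def)

lemma vertex_orbit_image: "vertex_orbit G \<Gamma> x = (\<lambda>\<gamma>. fst \<gamma> x) ` \<Gamma>"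
  by (force simp: vertex_orbit_def orbit_def)

lemma edge_orbit_image: "edge_orbit G \<Gamma> e = (\<lambda>\<gamma>. snd \<gamma> e) ` \<Gamma>"
  by (force simp: edge_orbit_def orbit_def)

lemma int_vec_axis: "int_vec (axis b 1) = axis b 1"
  by (auto simp: int_vec_def axis_def vec_eq_iff)

lemma int_hom_matrix:
  fixes f :: "int ^ 'd \<Rightarrow> real ^ 'n"
  assumes "\<And>x y. f (x + y) = f x + f y"
  shows "f z = (\<chi> a b. f (axis b 1) $ a) *v int_vec z"
proof -
  interpret additive f by unfold_locales (rule assms)
  have scale: "f (n *s v) = of_int n *\<^sub>R f v" for n v
  proof (induction n rule: int_induct[where k = 0])
    case (step1 i)
    then show ?case by (simp add: vector_sadd_rdistrib assms algebra_simps)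
  next
    case (step2 i)
    have "(i - 1) *s v = i *s v - v" by (simp add: vec_eq_iff algebra_simps)
    with step2 show ?case by (simp add: diff algebra_simps)
  qed (simp add: zero)
  have "f z = f (\<Sum>b\<in>UNIV. (z $ b) *s axis b 1)" by (simp add: basis_expansion)
  also have "\<dots> = (\<Sum>b\<in>UNIV. of_int (z $ b) *\<^sub>R f (axis b 1))" by (simp add: sum scale)
  also have "\<dots> = (\<chi> a b. f (axis b 1) $ a) *v int_vec z"
    by (simp add: matrix_vector_mult_def int_vec_def vec_eq_iff mult_ac)
  finally show ?thesis .
qed

section \<open>The bar equations of a framework with chosen representatives\<close>

locale rep_framework =
  fixes F :: "('x, 'y, 'd::{finite,linorder}) framework"
    and r :: "('x, 'y, 'd::{finite,linorder}) representatives"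
  assumes framework: "mixed_plate_framework F" and reps: "valid_representatives F r"
begin

abbreviation "G \<equiv> graph F"
abbreviation "\<Gamma> \<equiv> symmetries F"
abbreviation "vo \<equiv> vertex_orbit (graph F) (symmetries F)"
abbreviation "eo \<equiv> edge_orbit (graph F) (symmetries F)"

lemma periodic: "periodic_graph TYPE('d) G \<Gamma>"
  using framework by (simp add: mixed_plate_framework_def)

lemma \<Gamma>_carrier: "\<Gamma> \<subseteq> carrier (mgraph_Aut G)"
  using periodic by (auto simp: periodic_graph_def subgroup_def)

lemma basis_bij: "bij_betw (basis r) UNIV \<Gamma>"
  using reps by (simp add: valid_representatives_def iso_def additive_group_def)

lemma basis_in: "basis r z \<in> \<Gamma>"
  using basis_bij by (auto simp: bij_betw_def)

lemma basis_carrier: "basis r z \<in> carrier (mgraph_Aut G)"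
  using basis_in \<Gamma>_carrier by blast

lemma basis_add: "basis r (y + z) = basis r y \<otimes>\<^bsub>mgraph_Aut G\<^esub> basis r z"
  using reps by (simp add: valid_representatives_def iso_def hom_def additive_group_def)

lemma basis_add_vert: "x \<in> verts G \<Longrightarrow> fst (basis r (y + z)) x = fst (basis r y) (fst (basis r z) x)"
  by (simp add: basis_add mgraph_Aut_mult basis_carrier compose_def)

lemma basis_add_edge: "e \<in> edges G \<Longrightarrow> snd (basis r (y + z)) e = snd (basis r y) (snd (basis r z) e)"
  by (simp add: basis_add mgraph_Aut_mult basis_carrier compose_def)

lemma basis_vert_bij: "bij_betw (fst (basis r z)) (verts G) (verts G)"
  and basis_edge_bij: "bij_betw (snd (basis r z)) (edges G) (edges G)"
  using basis_carrier[of z] by (auto simp: mgraph_Aut_carrier Bij_def)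

lemma basis_0_vert: "x \<in> verts G \<Longrightarrow> fst (basis r 0) x = x"
proof -
  assume x: "x \<in> verts G"
  then have "fst (basis r 0) x \<in> verts G" using basis_vert_bij[of 0] by (auto simp: bij_betw_def)
  moreover have "fst (basis r 0) (fst (basis r 0) x) = fst (basis r 0) x"
    using basis_add_vert[OF x, of 0 0] by simp
  ultimately show ?thesis using x basis_vert_bij[of 0] by (auto simp: bij_betw_def dest: inj_onD)
qed

lemma basis_0_edge: "e \<in> edges G \<Longrightarrow> snd (basis r 0) e = e"
proof -
  assume e: "e \<in> edges G"
  then have "snd (basis r 0) e \<in> edges G" using basis_edge_bij[of 0] by (auto simp: bij_betw_def)
  moreover have "snd (basis r 0) (snd (basis r 0) e) = snd (basis r 0) e"
    using basis_add_edge[OF e, of 0 0] by simp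
  ultimately show ?thesis using e basis_edge_bij[of 0] by (auto simp: bij_betw_def dest: inj_onD)
qed

lemma vo_eq: "vo x = range (\<lambda>z. fst (basis r z) x)"
  using basis_bij image_image[of "\<lambda>\<gamma>. fst \<gamma> x" "basis r" UNIV]
  by (simp add: vertex_orbit_image bij_betw_def)

lemma eo_eq: "eo e = range (\<lambda>z. snd (basis r z) e)"
  using basis_bij image_image[of "\<lambda>\<gamma>. snd \<gamma> e" "basis r" UNIV]
  by (simp add: edge_orbit_image bij_betw_def)

lemma vo_translate: "x \<in> verts G \<Longrightarrow> vo (fst (basis r z) x) = vo x"
proof -
  assume x: "x \<in> verts G"
  have "range (\<lambda>w. fst (basis r w) (fst (basis r z) x)) = (\<lambda>w. fst (basis r w) x) ` range (\<lambda>w. w + z)"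
    by (simp only: image_image basis_add_vert[OF x])
  also have "range (\<lambda>w. w + z) = UNIV" by (metis add_diff_cancel_right' diff_add_cancel surj_def)
  finally show ?thesis by (simp add: vo_eq)
qed

lemma vo_self: "x \<in> verts G \<Longrightarrow> x \<in> vo x"
  using basis_0_vert[of x] by (auto simp: vo_eq image_iff intro: exI[of _ 0])

lemma eo_self: "e \<in> edges G \<Longrightarrow> e \<in> eo e"
  using basis_0_edge[of e] by (auto simp: eo_eq image_iff intro: exI[of _ 0])

lemma vreps: "vreps r \<subseteq> verts G" and ereps: "ereps r \<subseteq> edges G"
  and vreps_bij: "bij_betw vo (vreps r) (vo ` verts G)"
  and ereps_bij: "bij_betw eo (ereps r) (eo ` edges G)"
  using reps by (auto simp: valid_representatives_def quotient_mgraph_def)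

lemma src: "e \<in> ereps r \<Longrightarrow> src r e \<in> vreps r" and tgt: "e \<in> ereps r \<Longrightarrow> tgt r e \<in> vreps r"
  and ends: "e \<in> ereps r \<Longrightarrow> ends G e = Upair (src r e) (fst (basis r (shift r e)) (tgt r e))"
  using reps by (auto simp: valid_representatives_def)

text \<open>The quotient reads the ends off an arbitrary edge of the orbit. That edge is a translate
  of \<open>e\<close>, and passing to vertex orbits absorbs the translation.\<close>

lemma quotient_ends:
  assumes e: "e \<in> ereps r"
  shows "ends (quotient_mgraph G \<Gamma>) (eo e) = Upair (vo (src r e)) (vo (tgt r e))"
proof -
  have eG: "e \<in> edges G" using e ereps by blast
  have "(SOME e'. e' \<in> eo e) \<in> eo e" using eo_self[OF eG] by (rule someI)
  then obtain z where z: "(SOME e'. e' \<in> eo e) = snd (basis r z) e" by (auto simp: eo_eq)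
  have verts: "src r e \<in> verts G" "tgt r e \<in> verts G" using src[OF e] tgt[OF e] vreps by auto
  have "ends G (snd (basis r z) e) = map_uprod (fst (basis r z)) (ends G e)"
    using basis_carrier[of z] eG by (simp add: mgraph_Aut_carrier)
  also have "\<dots> = Upair (fst (basis r z) (src r e)) (fst (basis r (z + shift r e)) (tgt r e))"
    using verts by (simp add: ends[OF e] basis_add_vert)
  finally show ?thesis using verts by (simp add: quotient_mgraph_def z vo_translate)
qed

abbreviation "\<Lambda> \<equiv> lattice_matrix F r"

lemma lattice_matrix_int_vec: "\<Lambda> *v int_vec z = period F (basis r z)"
proof -
  have "period F \<in> hom (subgroup_of \<Gamma> (mgraph_Aut G)) additive_group"
    using framework by (simp add: mixed_plate_framework_def)
  then have "period F (basis r (y + z)) = period F (basis r y) + period F (basis r z)" for y z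
    using basis_in by (simp add: basis_add hom_def additive_group_def)
  from int_hom_matrix[of "\<lambda>z. period F (basis r z)", OF this, of z] show ?thesis
    unfolding lattice_matrix_def ..
qed

text \<open>The lattice has some invertible generating matrix \<open>\<Lambda>0\<close>. Its columns
  are integer combinations of those of \<open>\<Lambda>\<close>, so \<open>\<Lambda>0\<close>
  factors through \<open>\<Lambda>\<close> and yields a right inverse.\<close>

lemma invertible_lattice_matrix: "invertible \<Lambda>"
proof -
  obtain \<Lambda>0 :: "real ^ 'd::{finite,linorder} ^ 'd::{finite,linorder}" where inv: "invertible \<Lambda>0"
    and range: "period F ` \<Gamma> = range (\<lambda>c :: int ^ 'd::{finite,linorder}. \<Lambda>0 *v int_vec c)"
    using framework by (auto simp: mixed_plate_framework_def full_rank_lattice_def)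
  have "\<exists>c. \<Lambda>0 *v axis b 1 = \<Lambda> *v int_vec c" for b
  proof -
    have "\<Lambda>0 *v axis b 1 \<in> period F ` \<Gamma>"
      unfolding range by (metis int_vec_axis rangeI)
    then have "\<Lambda>0 *v axis b 1 \<in> period F ` range (basis r)" using basis_bij by (simp add: bij_betw_def)
    then show ?thesis by (auto simp only: image_image lattice_matrix_int_vec)
  qed
  then obtain n where n: "\<And>b. \<Lambda>0 *v axis b 1 = \<Lambda> *v int_vec (n b)" by metis
  define N where "N = (\<chi> a b. int_vec (n b) $ a)"
  have "(\<Lambda> ** N) $ a $ b = \<Lambda>0 $ a $ b" for a b
  proof -
    have "(\<Lambda> ** N) $ a $ b = (\<Lambda> *v int_vec (n b)) $ a"
      by (simp add: matrix_matrix_mult_def matrix_vector_mult_def N_def)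
    also have "\<dots> = (\<Lambda>0 *v axis b 1) $ a" using n by simp
    also have "\<dots> = \<Lambda>0 $ a $ b" by (simp add: matrix_vector_mul_component inner_axis)
    finally show ?thesis .
  qed
  then have "\<Lambda> ** N = \<Lambda>0" by (simp add: vec_eq_iff)
  moreover obtain L where "\<Lambda>0 ** L = mat 1" using inv by (auto simp: invertible_def)
  ultimately have "\<Lambda> ** (N ** L) = mat 1" by (simp add: matrix_mul_assoc)
  then show ?thesis using invertible_right_inverse by blast
qed

sublocale bar_system "src r" "tgt r" "\<lambda>e. int_vec (shift r e)" "\<lambda>e. attach F e (src r e)"
  "\<lambda>e. attach F e (fst (basis r (shift r e)) (tgt r e))" "pos F" "rot F" \<Lambda> .

lemma bar_functional_eq: "bar_functional F r e = row e"
  by (simp add: bar_functional_def row_def dir_def Let_def fun_eq_iff)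

text \<open>The bound is the number of test motions. For a \<open>\<rho>\<close> that separates
  components, the omitted set \<open>R\<close> has one vertex per component, which accounts for the
  subtracted translations.\<close>

lemma rank_bound:
  assumes S: "finite S" "S \<subseteq> ereps r" and V: "V = src r ` S \<union> tgt r ` S"
    and \<rho>: "\<And>e. e \<in> S \<Longrightarrow> \<rho> (src r e) = \<rho> (tgt r e)"
    and indep: "row_indep S (unknowns F (vreps r)) (rigidity_matrix F r)"
  shows "int (card S) \<le> int CARD('d) * (int (card V) - int (card (\<rho> ` V)))
    + (\<Sum>i\<in>V. plate_dof CARD('d) (weight F i)) + int ((CARD('d) + 1) choose 2)"
proof -
  have finV: "finite V" using S V by simp
  have V_vreps: "V \<subseteq> vreps r" using V S src tgt by blast
  obtain R where R: "R \<subseteq> V" "inj_on \<rho> R" "\<rho> ` V = \<rho> ` R"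
    using subset_image_inj[of "\<rho> ` V" \<rho> V] by auto
  have weight_le: "weight F i \<le> CARD('d)" if "i \<in> V" for i
    using that V_vreps vreps framework by (auto simp: mixed_plate_framework_def)
  have supp: "attach F e x $ a = 0"
    if "e \<in> S" "x \<in> {src r e, fst (basis r (shift r e)) (tgt r e)}" "weight F x \<le> coord_index a" for e x a
  proof -
    have "e \<in> edges G" "x \<in> set_uprod (ends G e)" using that S ereps ends by auto
    then show ?thesis using framework that(3) unfolding mixed_plate_framework_def by blast
  qed
  have weight_tgt: "weight F (fst (basis r (shift r e)) (tgt r e)) = weight F (tgt r e)" if "e \<in> S" for e
  proof -
    have "tgt r e \<in> verts G" using that S tgt vreps by blast
    then show ?thesis using framework basis_in unfolding mixed_plate_framework_def by blast
  qed
  let ?X = "(\<lambda>(i, a). Pos i a) ` ((V - R) \<times> UNIV)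
      \<union> (\<lambda>(i, a, b). Rot i a b) ` (SIGMA i:V. plate_pairs (weight F i))
      \<union> (\<lambda>(a, b). Per a b) ` sym_pairs :: ('x, 'd) unknown set"
  have "row_indep S ?X (\<lambda>e u. row e (test_motion u))"
  proof (rule row_indep_test_motions[OF S(1) V \<rho> R(1,2) _ invertible_lattice_matrix _ _ V_vreps])
    show "orthogonal_matrix (rot F i)" if "i \<in> V" for i
      using that V_vreps vreps framework by (auto simp: mixed_plate_framework_def rotation_matrix_def)
    show "row_indep S ({Pos i a | i a. i \<in> vreps r}
        \<union> {Rot i a b | i a b. i \<in> vreps r \<and> a < b \<and> coord_index a < weight F i} \<union> {Per a b | a b. True})
        (\<lambda>e u. row e (unit_motion u))"
      using indep unfolding unknowns_def rigidity_matrix_def bar_functional_eq .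
  qed (use supp weight_tgt in auto)
  then have "card S \<le> card ?X"
    using S(1) finV by (intro row_indep_card_le) auto
  also have "card ?X = (card V - card R) * CARD('d)
      + (\<Sum>i\<in>V. card (plate_pairs (weight F i) :: ('d \<times> 'd) set)) + card (sym_pairs :: ('d \<times> 'd) set)"
  proof -
    have "card ?X = card ((\<lambda>(i, a). Pos i a) ` ((V - R) \<times> UNIV) :: ('x, 'd) unknown set)
      + card ((\<lambda>(i, a, b). Rot i a b) ` (SIGMA i:V. plate_pairs (weight F i)) :: ('x, 'd) unknown set)
      + card ((\<lambda>(a, b). Per a b) ` sym_pairs :: ('x, 'd) unknown set)"
      using finV by (subst card_Un_disjoint; (subst card_Un_disjoint)?) auto
    also have "card ((\<lambda>(i, a). Pos i a) ` ((V - R) \<times> UNIV) :: ('x, 'd) unknown set) = (card V - card R) * CARD('d)"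
      using finV R(1) by (subst card_image) (auto simp: inj_on_def card_cartesian_product card_Diff_subset finite_subset)
    also have "card ((\<lambda>(i, a, b). Rot i a b) ` (SIGMA i:V. plate_pairs (weight F i)) :: ('x, 'd) unknown set)
        = (\<Sum>i\<in>V. card (plate_pairs (weight F i) :: ('d \<times> 'd) set))"
      using finV by (subst card_image) (auto simp: inj_on_def)
    also have "card ((\<lambda>(a, b). Per a b) ` sym_pairs :: ('x, 'd) unknown set) = card (sym_pairs :: ('d \<times> 'd) set)"
      by (subst card_image) (auto simp: inj_on_def)
    finally show ?thesis .
  qed
  finally have "int (card S) \<le> int ((card V - card R) * CARD('d)
      + (\<Sum>i\<in>V. card (plate_pairs (weight F i) :: ('d \<times> 'd) set)) + card (sym_pairs :: ('d \<times> 'd) set))"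
    by (simp only: of_nat_le_iff)
  also have "\<dots> = int CARD('d) * (int (card V) - int (card (\<rho> ` V)))
    + (\<Sum>i\<in>V. plate_dof CARD('d) (weight F i)) + int ((CARD('d) + 1) choose 2)"
    using R weight_le card_mono[OF finV R(1)]
    by (simp add: card_plate_pairs card_sym_pairs card_image of_nat_diff)
  finally show ?thesis .
qed

end

text \<open>With as many edges as the required rank, rigidity makes all rows independent, hence also
  the rows of the edges in \<open>E\<close>, and \<open>rank_bound\<close> applies to these.\<close>

lemma rigid_imp_sparse:
  fixes Q :: "('v, 'e) mgraph" and k :: "'v \<Rightarrow> nat" and F :: "('x, 'y, 'd::{finite,linorder}) framework"
  assumes Q: "finite_mgraph Q"
    and total: "int (card (edges Q)) = int CARD('d) * (int (card (verts Q)) - 1)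
       + (\<Sum>v\<in>verts Q. plate_dof CARD('d) (k v)) + int ((CARD('d) + 1) choose 2)"
    and fw: "mixed_plate_framework F" and rigid: "infinitesimally_rigid F"
    and quot: "is_weighted_quotient Q k F" and E: "E \<subseteq> edges Q"
  shows "int (card E) \<le> int CARD('d) * (int (card (verts (edge_subgraph Q E))) - int (num_components (edge_subgraph Q E)))
      + (\<Sum>v\<in>verts (edge_subgraph Q E). plate_dof CARD('d) (k v)) + int ((CARD('d) + 1) choose 2)"
proof -
  obtain r where r: "valid_representatives F r"
    and rank: "int (matrix_rank (ereps r) (unknowns F (vreps r)) (rigidity_matrix F r))
      = int CARD('d) * (int (card (vreps r)) - 1) + (\<Sum>i\<in>vreps r. plate_dof CARD('d) (weight F i))
        + int ((CARD('d) + 1) choose 2)"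
    using rigid unfolding infinitesimally_rigid_def by blast
  interpret rep_framework F r using fw r by unfold_locales
  obtain f g where iso: "mgraph_iso f g Q (quotient_mgraph (graph F) (symmetries F))"
    and k: "\<And>v x. v \<in> verts Q \<Longrightarrow> x \<in> f v \<Longrightarrow> weight F x = k v"
    using quot unfolding is_weighted_quotient_def by blast
  have f: "bij_betw f (verts Q) (vo ` verts G)" and g: "bij_betw g (edges Q) (eo ` edges G)"
    and fg: "\<And>e. e \<in> edges Q \<Longrightarrow> Defs.ends (quotient_mgraph G \<Gamma>) (g e) = map_uprod f (Defs.ends Q e)"
    using iso by (auto simp: mgraph_iso_def quotient_mgraph_def)
  have finQ: "finite (verts Q)" "finite (edges Q)" and wf: "wf_mgraph Q"
    using Q by (auto simp: finite_mgraph_def)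
  \<comment> \<open>\<open>u\<close> and \<open>w\<close> pick the chosen representatives of the
    orbits that \<open>f\<close> and \<open>g\<close> name; through them \<open>Q\<close> inherits
    the orientation of the representatives.\<close>
  define u where "u = inv_into (vreps r) vo \<circ> f"
  define w where "w = inv_into (ereps r) eo \<circ> g"
  have u: "bij_betw u (verts Q) (vreps r)" and w: "bij_betw w (edges Q) (ereps r)"
    unfolding u_def w_def using f g vreps_bij ereps_bij by (blast intro: bij_betw_trans bij_betw_inv_into)+
  have vo_u: "vo (u v) = f v" if "v \<in> verts Q" for v
    unfolding u_def o_def by (rule bij_betw_inv_into_right[OF vreps_bij]) (use f that in \<open>auto simp: bij_betw_def\<close>)
  have eo_w: "eo (w e) = g e" if "e \<in> edges Q" for e
    unfolding w_def o_def by (rule bij_betw_inv_into_right[OF ereps_bij]) (use g that in \<open>auto simp: bij_betw_def\<close>)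
  have weight_u: "weight F (u v) = k v" if v: "v \<in> verts Q" for v
  proof -
    have "u v \<in> verts G" using u v vreps by (auto simp: bij_betw_def)
    then show ?thesis using k[OF v] vo_self vo_u[OF v] by blast
  qed
  define u' where "u' = inv_into (verts Q) u"
  have u': "u' x \<in> verts Q" "u (u' x) = x" if "x \<in> vreps r" for x
    using u that unfolding u'_def by (auto simp: bij_betw_def inv_into_into f_inv_into_f)
  have u'u: "u' (u v) = v" if "v \<in> verts Q" for v
    using u that unfolding u'_def by (auto simp: bij_betw_def)
  define s where "s e = u' (src r (w e))" for e
  define t where "t e = u' (tgt r (w e))" for e
  have wE: "w e \<in> ereps r" if "e \<in> edges Q" for e using w that by (auto simp: bij_betw_def)
  interpret Q: oriented Q s t
  proof
    fix e assume e: "e \<in> edges Q"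
    obtain x y where xy: "Defs.ends Q e = Upair x y" by (cases "Defs.ends Q e")
    then have xyQ: "x \<in> verts Q" "y \<in> verts Q" using wf e by (force simp: wf_mgraph_def)+
    have st: "s e \<in> verts Q" "t e \<in> verts Q" unfolding s_def t_def using u' src tgt wE[OF e] by auto
    have "Upair (f x) (f y) = Upair (vo (src r (w e))) (vo (tgt r (w e)))"
      using fg[OF e] quotient_ends[OF wE[OF e]] by (simp add: xy eo_w[OF e])
    also have "\<dots> = Upair (f (s e)) (f (t e))"
      using vo_u[OF st(1)] vo_u[OF st(2)] u' src tgt wE[OF e] by (simp add: s_def t_def)
    finally show "Defs.ends Q e = Upair (s e) (t e)"
      using f xyQ st by (auto simp: xy bij_betw_def dest: inj_onD)
  qed
  have cards: "card (vreps r) = card (verts Q)" "card (ereps r) = card (edges Q)"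
    using bij_betw_same_card[OF u] bij_betw_same_card[OF w] by simp_all
  have dofs: "(\<Sum>i\<in>vreps r. plate_dof CARD('d) (weight F i)) = (\<Sum>v\<in>verts Q. plate_dof CARD('d) (k v))"
    using weight_u by (subst sum.reindex_bij_betw[OF u, symmetric]) auto
  have "matrix_rank (ereps r) (unknowns F (vreps r)) (rigidity_matrix F r) = card (ereps r)"
    using rank total unfolding cards dofs by simp
  moreover have "finite (ereps r)" using w finQ(2) by (metis bij_betw_finite)
  ultimately have indep: "row_indep (ereps r) (unknowns F (vreps r)) (rigidity_matrix F r)"
    using matrix_rank_eq_card_iff by blast
  let ?H = "edge_subgraph Q E"
  let ?S = "w ` E" and ?V = "u ` verts ?H"
  let ?\<rho> = "\<lambda>x. connectivity ?H `` {u' x}"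
  have H: "verts ?H = s ` E \<union> t ` E" using Q.verts_edge_subgraph[OF E] .
  have HQ: "verts ?H \<subseteq> verts Q"
    unfolding H s_def t_def using E wE src tgt u' by auto
  have us: "u (s e) = src r (w e)" "u (t e) = tgt r (w e)" if "e \<in> E" for e
    using that E wE src tgt u' by (auto simp: s_def t_def)
  have card_S: "card ?S = card E"
    using w E by (intro card_image) (auto simp: bij_betw_def intro: inj_on_subset)
  have inj_u: "inj_on u (verts ?H)" using u HQ by (auto simp: bij_betw_def intro: inj_on_subset)
  have "int (card ?S) \<le> int CARD('d) * (int (card ?V) - int (card (?\<rho> ` ?V)))
    + (\<Sum>i\<in>?V. plate_dof CARD('d) (weight F i)) + int ((CARD('d) + 1) choose 2)"
  proof (rule rank_bound)
    show "finite ?S" using E finQ finite_subset by blast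
    show S: "?S \<subseteq> ereps r" using E wE by blast
    show "?V = src r ` ?S \<union> tgt r ` ?S"
      unfolding H image_Un image_image using us by auto
    show "?\<rho> (src r e) = ?\<rho> (tgt r e)" if "e \<in> ?S" for e
      using that Q.connectivity_ends[OF E] by (auto simp: s_def t_def)
    show "row_indep ?S (unknowns F (vreps r)) (rigidity_matrix F r)"
      using row_indep_subset[OF indep _ S] \<open>finite (ereps r)\<close> by simp
  qed
  moreover have "card (?\<rho> ` ?V) = num_components ?H"
    unfolding num_components_eq image_image using u'u HQ by (intro arg_cong[where f = card] image_cong) auto
  moreover have "(\<Sum>i\<in>?V. plate_dof CARD('d) (weight F i)) = (\<Sum>v\<in>verts ?H. plate_dof CARD('d) (k v))"
    using weight_u HQ by (subst sum.reindex[OF inj_u]) (auto intro!: sum.cong)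
  moreover have "card ?V = card (verts ?H)" using inj_u by (rule card_image)
  ultimately show ?thesis using card_S by simp
qed

section \<open>The periodic framework over a quotient graph\<close>

text \<open>Automorphisms are compared and composed only on vertices and edges, so the compatibility
  with ends survives composition because ends are vertices.\<close>

lemma monoid_mgraph_Aut:
  assumes "wf_mgraph G"
  shows "monoid (mgraph_Aut G)"
proof (rule monoidI)
  let ?A = "mgraph_Aut G"
  have maps: "fst \<gamma> \<in> verts G \<rightarrow> verts G" "snd \<gamma> \<in> edges G \<rightarrow> edges G" if "\<gamma> \<in> carrier ?A" for \<gamma>
    using that by (auto simp: mgraph_Aut_carrier dest: Bij_imp_funcset)
  have ends: "ends G (snd \<gamma> e) = map_uprod (fst \<gamma>) (ends G e)" if "\<gamma> \<in> carrier ?A" "e \<in> edges G" for \<gamma> e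
    using that by (simp add: mgraph_Aut_carrier)
  have ends_verts: "set_uprod (ends G e) \<subseteq> verts G" if "e \<in> edges G" for e
    using assms that by (simp add: wf_mgraph_def)
  show one: "\<one>\<^bsub>?A\<^esub> \<in> carrier ?A"
    unfolding mgraph_Aut_carrier mgraph_Aut_one
  proof (simp add: id_Bij, intro ballI)
    fix e assume "e \<in> edges G"
    then show "ends G e = map_uprod (\<lambda>x\<in>verts G. x) (ends G e)"
      using ends_verts by (cases "ends G e") force
  qed
  show closed: "\<gamma> \<otimes>\<^bsub>?A\<^esub> \<delta> \<in> carrier ?A" if "\<gamma> \<in> carrier ?A" "\<delta> \<in> carrier ?A" for \<gamma> \<delta>
    unfolding mgraph_Aut_mult[OF that] mgraph_Aut_carrier
  proof (intro conjI ballI)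
    fix e assume e: "e \<in> edges G"
    then have "snd \<delta> e \<in> edges G" using maps(2)[OF that(2)] by auto
    then have "ends G (snd \<gamma> (snd \<delta> e)) = map_uprod (fst \<gamma>) (map_uprod (fst \<delta>) (ends G e))"
      using ends that e by simp
    also have "\<dots> = map_uprod (compose (verts G) (fst \<gamma>) (fst \<delta>)) (ends G e)"
      using ends_verts[OF e] by (cases "ends G e") (auto simp: compose_def)
    finally show "ends G (snd (compose (verts G) (fst \<gamma>) (fst \<delta>), compose (edges G) (snd \<gamma>) (snd \<delta>)) e)
        = map_uprod (fst (compose (verts G) (fst \<gamma>) (fst \<delta>), compose (edges G) (snd \<gamma>) (snd \<delta>))) (ends G e)"
      using e by (simp add: compose_def)
  qed (use that in \<open>auto simp: mgraph_Aut_carrier compose_Bij\<close>)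
  show "\<gamma> \<otimes>\<^bsub>?A\<^esub> \<delta> \<otimes>\<^bsub>?A\<^esub> \<epsilon> = \<gamma> \<otimes>\<^bsub>?A\<^esub> (\<delta> \<otimes>\<^bsub>?A\<^esub> \<epsilon>)"
    if "\<gamma> \<in> carrier ?A" "\<delta> \<in> carrier ?A" "\<epsilon> \<in> carrier ?A" for \<gamma> \<delta> \<epsilon>
  proof -
    have closed': "(compose (verts G) (fst \<gamma>) (fst \<delta>), compose (edges G) (snd \<gamma>) (snd \<delta>)) \<in> carrier ?A"
      "(compose (verts G) (fst \<delta>) (fst \<epsilon>), compose (edges G) (snd \<delta>) (snd \<epsilon>)) \<in> carrier ?A"
      using closed[OF that(1,2)] closed[OF that(2,3)] that by (simp_all only: mgraph_Aut_mult)
    show ?thesis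
      unfolding mgraph_Aut_mult[OF that(1,2)] mgraph_Aut_mult[OF that(2,3)]
        mgraph_Aut_mult[OF closed'(1) that(3)] mgraph_Aut_mult[OF that(1) closed'(2)] fst_conv snd_conv
        compose_assoc[OF maps(1)[OF that(3)]] compose_assoc[OF maps(2)[OF that(3)]] ..
  qed
  show "\<one>\<^bsub>?A\<^esub> \<otimes>\<^bsub>?A\<^esub> \<gamma> = \<gamma>" "\<gamma> \<otimes>\<^bsub>?A\<^esub> \<one>\<^bsub>?A\<^esub> = \<gamma>" if "\<gamma> \<in> carrier ?A" for \<gamma>
    using that maps[OF that] mgraph_Aut_mult[OF one that] mgraph_Aut_mult[OF that one]
    by (simp_all add: mgraph_Aut_one mgraph_Aut_carrier Bij_imp_extensional)
qed

lemma group_additive_group: "group (additive_group :: 'a::group_add monoid)"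
proof (rule groupI)
  fix x :: 'a
  show "\<exists>y\<in>carrier additive_group. y \<otimes>\<^bsub>additive_group\<^esub> x = \<one>\<^bsub>additive_group\<^esub>"
    by (rule bexI[of _ "- x"]) (simp_all add: additive_group_def)
qed (simp_all add: additive_group_def add.assoc)

text \<open>\<open>X (v, z)\<close> and \<open>Y (e, z)\<close> name the translates by \<open>z\<close> of representatives of the
  vertex orbit \<open>v\<close> and the edge orbit \<open>e\<close>.  The plate frames are standard, the lattice is the
  integer lattice, and all plates of the cell \<open>z = 0\<close> are placed at the origin.\<close>

locale periodic_cover = oriented Q s t
  for Q :: "('v, 'e) mgraph" and s t :: "'e \<Rightarrow> 'v" +
  fixes k :: "'v \<Rightarrow> nat" and c :: "'e \<Rightarrow> int ^ 'd::{finite,linorder}"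
    and qs qt :: "'e \<Rightarrow> real ^ 'd::{finite,linorder}"
    and X :: "'v \<times> (int ^ 'd::{finite,linorder}) \<Rightarrow> 'x" and Y :: "'e \<times> (int ^ 'd::{finite,linorder}) \<Rightarrow> 'y"
  assumes finite_Q: "finite_mgraph Q" and nonempty: "verts Q \<noteq> {}"
    and k_le: "v \<in> verts Q \<Longrightarrow> k v \<le> CARD('d)"
    and loop: "e \<in> edges Q \<Longrightarrow> s e = t e \<Longrightarrow> c e \<noteq> 0"
    and bar: "e \<in> edges Q \<Longrightarrow> int_vec (c e) + qt e - qs e \<noteq> 0"
    and qs: "e \<in> edges Q \<Longrightarrow> k (s e) \<le> coord_index a \<Longrightarrow> qs e $ a = 0"
    and qt: "e \<in> edges Q \<Longrightarrow> k (t e) \<le> coord_index a \<Longrightarrow> qt e $ a = 0"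
    and X: "inj_on X (verts Q \<times> UNIV)" and Y: "inj_on Y (edges Q \<times> UNIV)"
begin

abbreviation "V \<equiv> verts Q"
abbreviation "E \<equiv> edges Q"

lemma finite_V: "finite V" and finite_E: "finite E"
  using finite_Q by (auto simp: finite_mgraph_def)

lemma s: "e \<in> E \<Longrightarrow> s e \<in> V" and t: "e \<in> E \<Longrightarrow> t e \<in> V"
  using finite_Q ends by (auto simp: finite_mgraph_def wf_mgraph_def)

definition "Xi = inv_into (V \<times> UNIV) X"
definition "Yi = inv_into (E \<times> UNIV) Y"

lemma Xi [simp]: "v \<in> V \<Longrightarrow> Xi (X (v, z)) = (v, z)"
  using X by (simp add: Xi_def)

lemma Yi [simp]: "e \<in> E \<Longrightarrow> Yi (Y (e, z)) = (e, z)"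
  using Y by (simp add: Yi_def)

lemma X_eq [simp]: "v \<in> V \<Longrightarrow> w \<in> V \<Longrightarrow> X (v, y) = X (w, z) \<longleftrightarrow> v = w \<and> y = z"
  using X by (auto dest: inj_onD)

lemma Y_eq [simp]: "e \<in> E \<Longrightarrow> e' \<in> E \<Longrightarrow> Y (e, y) = Y (e', z) \<longleftrightarrow> e = e' \<and> y = z"
  using Y by (auto dest: inj_onD)

text \<open>The derived graph of \<open>Q\<close> as a voltage graph with voltages \<open>c\<close>
  in the integer lattice.\<close>

definition G :: "('x, 'y) mgraph" where
  "G = \<lparr>verts = X ` (V \<times> UNIV), edges = Y ` (E \<times> UNIV),
    ends = (\<lambda>y. case Yi y of (e, z) \<Rightarrow> Upair (X (s e, z)) (X (t e, z + c e)))\<rparr>"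

lemma verts_G: "verts G = X ` (V \<times> UNIV)" and edges_G: "edges G = Y ` (E \<times> UNIV)"
  by (simp_all add: G_def)

lemma ends_G: "e \<in> E \<Longrightarrow> Defs.ends G (Y (e, z)) = Upair (X (s e, z)) (X (t e, z + c e))"
  by (simp add: G_def)

lemma wf_G: "wf_mgraph G"
  by (auto simp: wf_mgraph_def edges_G ends_G verts_G s t)

text \<open>Translation by \<open>z\<close>, restricted to vertices and edges because the members of
  \<open>BijGroup\<close> are extensional.\<close>

definition \<tau> :: "int ^ 'd::{finite,linorder} \<Rightarrow> ('x \<Rightarrow> 'x) \<times> ('y \<Rightarrow> 'y)" where
  "\<tau> z = (\<lambda>x\<in>verts G. case Xi x of (v, w) \<Rightarrow> X (v, w + z), \<lambda>y\<in>edges G. case Yi y of (e, w) \<Rightarrow> Y (e, w + z))"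

lemma \<tau>_X [simp]: "v \<in> V \<Longrightarrow> fst (\<tau> z) (X (v, w)) = X (v, w + z)"
  by (simp add: \<tau>_def verts_G)

lemma \<tau>_Y [simp]: "e \<in> E \<Longrightarrow> snd (\<tau> z) (Y (e, w)) = Y (e, w + z)"
  by (simp add: \<tau>_def edges_G)

lemma \<tau>_ext: "fst (\<tau> z) \<in> extensional (verts G)" "snd (\<tau> z) \<in> extensional (edges G)"
  by (simp_all add: \<tau>_def)

lemma \<tau>_carrier: "\<tau> z \<in> carrier (mgraph_Aut G)"
  unfolding mgraph_Aut_carrier Bij_def
proof (intro conjI IntI \<tau>_ext CollectI)
  show "bij_betw (fst (\<tau> z)) (verts G) (verts G)"
    by (rule bij_betw_byWitness[where f' = "fst (\<tau> (- z))"]) (auto simp: verts_G)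
  show "bij_betw (snd (\<tau> z)) (edges G) (edges G)"
    by (rule bij_betw_byWitness[where f' = "snd (\<tau> (- z))"]) (auto simp: edges_G)
  show "\<forall>e\<in>edges G. Defs.ends G (snd (\<tau> z) e) = map_uprod (fst (\<tau> z)) (Defs.ends G e)"
    by (auto simp: edges_G ends_G s t add_ac)
qed

lemma aut_eqI:
  assumes "fst \<gamma> \<in> extensional (verts G)" "fst \<delta> \<in> extensional (verts G)"
    "snd \<gamma> \<in> extensional (edges G)" "snd \<delta> \<in> extensional (edges G)"
    "\<And>v z. v \<in> V \<Longrightarrow> fst \<gamma> (X (v, z)) = fst \<delta> (X (v, z))"
    "\<And>e z. e \<in> E \<Longrightarrow> snd \<gamma> (Y (e, z)) = snd \<delta> (Y (e, z))"
  shows "\<gamma> = \<delta>"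
proof (rule prod_eqI)
  show "fst \<gamma> = fst \<delta>" using assms(1,2) by (rule extensionalityI) (use assms(5) in \<open>auto simp: verts_G\<close>)
  show "snd \<gamma> = snd \<delta>" using assms(3,4) by (rule extensionalityI) (use assms(6) in \<open>auto simp: edges_G\<close>)
qed

lemma \<tau>_add: "\<tau> y \<otimes>\<^bsub>mgraph_Aut G\<^esub> \<tau> z = \<tau> (y + z)"
  unfolding mgraph_Aut_mult[OF \<tau>_carrier \<tau>_carrier]
  by (rule aut_eqI) (auto simp: \<tau>_ext[unfolded verts_G edges_G] compose_def verts_G edges_G add_ac)

lemma \<tau>_0: "\<one>\<^bsub>mgraph_Aut G\<^esub> = \<tau> 0"
  unfolding mgraph_Aut_one by (rule aut_eqI) (auto simp: \<tau>_ext[unfolded verts_G edges_G] verts_G edges_G)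

lemma \<tau>_inj: "inj \<tau>"
proof (rule injI)
  fix y z assume eq: "\<tau> y = \<tau> z"
  obtain v where v: "v \<in> V" using nonempty by blast
  have "fst (\<tau> y) (X (v, 0)) = fst (\<tau> z) (X (v, 0))" using eq by simp
  then show "y = z" using v by simp
qed

lemma \<tau>_inv: "inv\<^bsub>mgraph_Aut G\<^esub> (\<tau> z) = \<tau> (- z)"
  using monoid.inv_unique'[OF monoid_mgraph_Aut[OF wf_G] \<tau>_carrier \<tau>_carrier, of z "- z"]
  by (simp add: \<tau>_add \<tau>_0)

lemma \<tau>_subgroup: "subgroup (range \<tau>) (mgraph_Aut G)"
  by unfold_locales (auto simp: \<tau>_add \<tau>_0 \<tau>_inv, use \<tau>_carrier in auto)

lemma \<tau>_iso: "\<tau> \<in> iso additive_group (subgroup_of (range \<tau>) (mgraph_Aut G))"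
  using \<tau>_inj by (auto simp: iso_def hom_def additive_group_def \<tau>_add bij_betw_def)

lemma orbit_X: "v \<in> V \<Longrightarrow> vertex_orbit G (range \<tau>) (X (v, w)) = (\<lambda>z. X (v, z)) ` UNIV"
proof -
  assume v: "v \<in> V"
  have "vertex_orbit G (range \<tau>) (X (v, w)) = (\<lambda>\<gamma>. fst \<gamma> (X (v, w))) ` range \<tau>"
    by (rule vertex_orbit_image)
  also have "\<dots> = range (\<lambda>z. X (v, w + z))" using v by (simp only: image_image \<tau>_X)
  also have "\<dots> = (\<lambda>z. X (v, z)) ` range (\<lambda>z. w + z)" by (simp only: image_image)
  also have "range (\<lambda>z. w + z) = UNIV" by (metis add_diff_cancel_left' diff_add_cancel add.commute surj_def)
  finally show ?thesis .
qed

lemma orbit_Y: "e \<in> E \<Longrightarrow> edge_orbit G (range \<tau>) (Y (e, w)) = (\<lambda>z. Y (e, z)) ` UNIV"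
proof -
  assume e: "e \<in> E"
  have "edge_orbit G (range \<tau>) (Y (e, w)) = (\<lambda>\<gamma>. snd \<gamma> (Y (e, w))) ` range \<tau>"
    by (rule edge_orbit_image)
  also have "\<dots> = range (\<lambda>z. Y (e, w + z))" using e by (simp only: image_image \<tau>_Y)
  also have "\<dots> = (\<lambda>z. Y (e, z)) ` range (\<lambda>z. w + z)" by (simp only: image_image)
  also have "range (\<lambda>z. w + z) = UNIV" by (metis add_diff_cancel_left' diff_add_cancel add.commute surj_def)
  finally show ?thesis .
qed

lemma vertex_orbits: "vertex_orbit G (range \<tau>) ` verts G = (\<lambda>v. (\<lambda>z. X (v, z)) ` UNIV) ` V"
proof -
  have "vertex_orbit G (range \<tau>) ` verts G = (\<lambda>v. (\<lambda>z. X (v, z)) ` UNIV) ` fst ` (V \<times> (UNIV :: (int ^ 'd::{finite,linorder}) set))"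
    unfolding verts_G image_image by (intro image_cong) (auto simp: orbit_X)
  then show ?thesis by simp
qed

lemma edge_orbits: "edge_orbit G (range \<tau>) ` edges G = (\<lambda>e. (\<lambda>z. Y (e, z)) ` UNIV) ` E"
proof -
  have "edge_orbit G (range \<tau>) ` edges G = (\<lambda>e. (\<lambda>z. Y (e, z)) ` UNIV) ` fst ` (E \<times> (UNIV :: (int ^ 'd::{finite,linorder}) set))"
    unfolding edges_G image_image by (intro image_cong) (auto simp: orbit_Y)
  then show ?thesis by simp
qed

lemma periodic_G: "periodic_graph TYPE('d) G (range \<tau>)"
  unfolding periodic_graph_def
proof (intro conjI ballI impI)
  show "wf_mgraph G" by (rule wf_G)
  show "loopless G" using loop by (auto simp: loopless_def edges_G ends_G s t)
  obtain v where v: "v \<in> V" using nonempty by blast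
  have "infinite (UNIV :: (int ^ 'd::{finite,linorder}) set)"
  proof
    assume "finite (UNIV :: (int ^ 'd::{finite,linorder}) set)"
    then have "finite (range (\<lambda>n :: int. (\<chi> _. n) :: int ^ 'd::{finite,linorder}))" by (rule finite_subset[rotated]) simp
    then have "finite (UNIV :: int set)" by (rule finite_imageD) (auto simp: inj_on_def vec_eq_iff)
    then show False by simp
  qed
  moreover have "inj (\<lambda>z. X (v, z))" using v by (auto intro: injI)
  ultimately have "infinite (range (\<lambda>z. X (v, z)))" by (metis finite_imageD)
  moreover have "range (\<lambda>z. X (v, z)) \<subseteq> verts G" using v by (auto simp: verts_G)
  ultimately show "infinite (verts G)" by (rule infinite_super[rotated])
  show "subgroup (range \<tau>) (mgraph_Aut G)" by (rule \<tau>_subgroup)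
  show "subgroup_of (range \<tau>) (mgraph_Aut G) \<cong> (additive_group :: (int ^ 'd::{finite,linorder}) monoid)"
    using group.iso_sym[OF group_additive_group is_isoI[OF \<tau>_iso]] .
  show "fst \<gamma> x \<noteq> x" if "\<gamma> \<in> range \<tau>" "\<gamma> \<noteq> \<one>\<^bsub>mgraph_Aut G\<^esub>" "x \<in> verts G" for \<gamma> x
    using that by (auto simp: \<tau>_0 verts_G)
  show "snd \<gamma> y \<noteq> y" if "\<gamma> \<in> range \<tau>" "\<gamma> \<noteq> \<one>\<^bsub>mgraph_Aut G\<^esub>" "y \<in> edges G" for \<gamma> y
    using that by (auto simp: \<tau>_0 edges_G)
  have "orbits (subgroup_of (range \<tau>) (mgraph_Aut G)) (verts G) fst = vertex_orbit G (range \<tau>) ` verts G"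
    by (auto simp: orbits_def vertex_orbit_def)
  then show "finite (orbits (subgroup_of (range \<tau>) (mgraph_Aut G)) (verts G) fst)"
    using finite_V by (simp add: vertex_orbits)
  have "orbits (subgroup_of (range \<tau>) (mgraph_Aut G)) (edges G) snd = edge_orbit G (range \<tau>) ` edges G"
    by (auto simp: orbits_def edge_orbit_def)
  then show "finite (orbits (subgroup_of (range \<tau>) (mgraph_Aut G)) (edges G) snd)"
    using finite_E by (simp add: edge_orbits)
qed

text \<open>A plate that is not the source of the bar is taken to be its other end. This is sound
  for loops of \<open>Q\<close> too, since their nonzero period separates the two ends.\<close>

definition F :: "('x, 'y, 'd::{finite,linorder}) framework" where
  "F = \<lparr>graph = G, symmetries = range \<tau>, weight = (\<lambda>x. k (fst (Xi x))), pos = (\<lambda>x. int_vec (snd (Xi x))),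
     rot = (\<lambda>_. mat 1),
     attach = (\<lambda>y x. case Yi y of (e, z) \<Rightarrow> if x = X (s e, z) then qs e else qt e),
     period = (\<lambda>\<gamma>. int_vec (inv_into UNIV \<tau> \<gamma>))\<rparr>"

lemma F_simps [simp]: "graph F = G" "symmetries F = range \<tau>"
  "v \<in> V \<Longrightarrow> weight F (X (v, z)) = k v" "v \<in> V \<Longrightarrow> pos F (X (v, z)) = int_vec z"
  "rot F x = mat 1" "period F (\<tau> z) = int_vec z"
  using \<tau>_inj by (simp_all add: F_def)

lemma attach_s: "e \<in> E \<Longrightarrow> attach F (Y (e, z)) (X (s e, z)) = qs e"
  by (simp add: F_def)

lemma attach_t: "e \<in> E \<Longrightarrow> attach F (Y (e, z)) (X (t e, z + c e)) = qt e"
  using loop by (auto simp: F_def s t)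

lemma int_vec_add: "int_vec (y + z) = int_vec y + int_vec z"
  by (simp add: int_vec_def vec_eq_iff)

lemma inj_int_vec: "inj int_vec"
  by (auto simp: inj_def int_vec_def vec_eq_iff)

lemma framework_F:
  assumes "connected_mgraph G"
  shows "mixed_plate_framework F"
  unfolding mixed_plate_framework_def
proof (intro conjI ballI allI impI)
  show "periodic_graph TYPE('d) (graph F) (symmetries F)" using periodic_G by simp
  show "connected_mgraph (graph F)" using assms by simp
  show "weight F x \<le> CARD('d)" if "x \<in> verts (graph F)" for x
    using that k_le by (auto simp: verts_G)
  show "weight F (fst \<gamma> x) = weight F x" if "\<gamma> \<in> symmetries F" "x \<in> verts (graph F)" for \<gamma> x
    using that by (auto simp: verts_G)
  show "rotation_matrix (rot F x)" for x
    by (simp add: rotation_matrix_def orthogonal_matrix_id det_I)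
  show "period F \<in> hom (subgroup_of (symmetries F) (mgraph_Aut (graph F))) additive_group"
    by (auto simp: hom_def additive_group_def \<tau>_add int_vec_add)
  show "inj_on (period F) (symmetries F)"
    unfolding F_simps by (rule inj_onI, elim rangeE) (simp add: inj_eq[OF inj_int_vec])
  show "full_rank_lattice (period F ` symmetries F)"
    unfolding full_rank_lattice_def by (intro exI[of _ "mat 1"]) (auto simp: image_image invertible_def intro: exI[of _ "mat 1"])
  show "pos F (fst \<gamma> x) = pos F x + period F \<gamma>" if "\<gamma> \<in> symmetries F" "x \<in> verts (graph F)" for \<gamma> x
    using that by (auto simp: verts_G int_vec_add)
  show "column b (rot F (fst \<gamma> x)) = column b (rot F x)" for \<gamma> x b by simp
  show "attach F e x $ a = 0"
    if "e \<in> edges (graph F)" "x \<in> set_uprod (Defs.ends (graph F) e)" "weight F x \<le> coord_index a" for e x a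
    using that qs qt by (auto simp: edges_G ends_G attach_s attach_t s t)
  show "attach F (snd \<gamma> e) (fst \<gamma> x) = attach F e x"
    if \<gamma>: "\<gamma> \<in> symmetries F" and y: "e \<in> edges (graph F)" and x: "x \<in> set_uprod (Defs.ends (graph F) e)" for \<gamma> e x
  proof -
    obtain u where u: "\<gamma> = \<tau> u" using \<gamma> unfolding F_simps by blast
    obtain e0 z where e: "e0 \<in> E" "e = Y (e0, z)" using y by (auto simp: edges_G)
    with x consider "x = X (s e0, z)" | "x = X (t e0, z + c e0)" by (auto simp: ends_G)
    then show ?thesis
      using e u attach_s[of e0 "z + u"] attach_t[of e0 "z + u"]
      by cases (auto simp: attach_s attach_t s t add_ac)
  qed
  have bars: "bar_end F (Y (e, z)) (X (s e, z)) \<noteq> bar_end F (Y (e, z)) (X (t e, z + c e))" if "e \<in> E" for e z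
    using bar[OF that] that by (auto simp: bar_end_def attach_s attach_t s t int_vec_add algebra_simps)
  show "bar_end F e x \<noteq> bar_end F e y" if y: "e \<in> edges (graph F)" and xy: "Defs.ends (graph F) e = Upair x y" for e x y
  proof -
    obtain e0 z where e: "e0 \<in> E" "e = Y (e0, z)" using y by (auto simp: edges_G)
    then have "x = X (s e0, z) \<and> y = X (t e0, z + c e0) \<or> y = X (s e0, z) \<and> x = X (t e0, z + c e0)"
      using xy by (auto simp: ends_G)
    then show ?thesis using bars[OF e(1), of z] e(2) by auto
  qed
qed

definition r :: "('x, 'y, 'd::{finite,linorder}) representatives" where
  "r = \<lparr>basis = \<tau>, vreps = X ` (V \<times> {0}), ereps = Y ` (E \<times> {0}),
     src = (\<lambda>y. X (s (fst (Yi y)), 0)), tgt = (\<lambda>y. X (t (fst (Yi y)), 0)), shift = (\<lambda>y. c (fst (Yi y)))\<rparr>"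

lemma r_simps [simp]: "basis r = \<tau>" "vreps r = X ` (V \<times> {0})" "ereps r = Y ` (E \<times> {0})"
  "e \<in> E \<Longrightarrow> src r (Y (e, z)) = X (s e, 0)" "e \<in> E \<Longrightarrow> tgt r (Y (e, z)) = X (t e, 0)"
  "e \<in> E \<Longrightarrow> shift r (Y (e, z)) = c e"
  by (simp_all add: r_def)

lemma orbit_inj:
  assumes "v \<in> V" "w \<in> V" "range (\<lambda>z. X (v, z)) = range (\<lambda>z. X (w, z))"
  shows "v = w"
proof -
  have "X (v, 0) \<in> range (\<lambda>z. X (w, z))" unfolding assms(3)[symmetric] by (rule rangeI)
  then show ?thesis using assms(1,2) by auto
qed

lemma edge_orbit_inj:
  assumes "e \<in> E" "e' \<in> E" "range (\<lambda>z. Y (e, z)) = range (\<lambda>z. Y (e', z))"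
  shows "e = e'"
proof -
  have "Y (e, 0) \<in> range (\<lambda>z. Y (e', z))" unfolding assms(3)[symmetric] by (rule rangeI)
  then show ?thesis using assms(1,2) by auto
qed

lemma valid_r: "valid_representatives F r"
  unfolding valid_representatives_def
proof (intro conjI ballI)
  show "basis r \<in> iso additive_group (subgroup_of (symmetries F) (mgraph_Aut (graph F)))"
    using \<tau>_iso by simp
  show "bij_betw (vertex_orbit (graph F) (symmetries F)) (vreps r) (verts (quotient_mgraph (graph F) (symmetries F)))"
    unfolding bij_betw_def quotient_mgraph_def mgraph.simps F_simps r_simps vertex_orbits
  proof
    show "inj_on (vertex_orbit G (range \<tau>)) (X ` (V \<times> {0}))"
      by (rule inj_onI) (auto simp: orbit_X dest: orbit_inj)
    have "vertex_orbit G (range \<tau>) ` X ` (V \<times> {0}) = (\<lambda>v. range (\<lambda>z. X (v, z))) ` fst ` (V \<times> {0 :: int ^ 'd::{finite,linorder}})"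
      unfolding image_image by (intro image_cong) (auto simp: orbit_X)
    then show "vertex_orbit G (range \<tau>) ` X ` (V \<times> {0}) = (\<lambda>v. range (\<lambda>z. X (v, z))) ` V" by simp
  qed
  show "bij_betw (edge_orbit (graph F) (symmetries F)) (ereps r) (edges (quotient_mgraph (graph F) (symmetries F)))"
    unfolding bij_betw_def quotient_mgraph_def mgraph.simps F_simps r_simps edge_orbits
  proof
    show "inj_on (edge_orbit G (range \<tau>)) (Y ` (E \<times> {0}))"
      by (rule inj_onI) (auto simp: orbit_Y dest: edge_orbit_inj)
    have "edge_orbit G (range \<tau>) ` Y ` (E \<times> {0}) = (\<lambda>e. range (\<lambda>z. Y (e, z))) ` fst ` (E \<times> {0 :: int ^ 'd::{finite,linorder}})"
      unfolding image_image by (intro image_cong) (auto simp: orbit_Y)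
    then show "edge_orbit G (range \<tau>) ` Y ` (E \<times> {0}) = (\<lambda>e. range (\<lambda>z. Y (e, z))) ` E" by simp
  qed
qed (auto simp: verts_G edges_G ends_G s t)

lemma lattice_matrix_F: "lattice_matrix F r = mat 1"
  by (simp add: lattice_matrix_def int_vec_axis) (simp add: mat_def axis_def vec_eq_iff)

lemma bar_functional_F:
  assumes "e \<in> E"
  shows "bar_functional F r (Y (e, 0)) (p', A, L) = (L *v int_vec (c e) + A (X (t e, 0)) *v qt e
    - A (X (s e, 0)) *v qs e + p' (X (t e, 0)) - p' (X (s e, 0))) \<bullet> (int_vec (c e) + qt e - qs e)"
  using assms attach_s[OF assms, of 0] attach_t[OF assms, of 0]
  by (simp add: bar_functional_def Let_def s t lattice_matrix_F int_vec_def vec_eq_iff[of "\<chi> a. 0"])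

lemma weighted_quotient_F:
  assumes "connected_mgraph G"
  shows "is_weighted_quotient Q k F"
proof -
  interpret F: rep_framework F r using framework_F[OF assms] valid_r by unfold_locales
  let ?f = "\<lambda>v. (\<lambda>z. X (v, z)) ` UNIV" and ?g = "\<lambda>e. (\<lambda>z. Y (e, z)) ` UNIV"
  show ?thesis
    unfolding is_weighted_quotient_def
  proof (intro exI[of _ ?f] exI[of _ ?g] conjI ballI)
    show "mgraph_iso ?f ?g Q (quotient_mgraph (graph F) (symmetries F))"
      unfolding mgraph_iso_def
    proof (intro conjI ballI)
      show "bij_betw ?f V (verts (quotient_mgraph (graph F) (symmetries F)))"
        using orbit_inj by (auto simp: bij_betw_def quotient_mgraph_def vertex_orbits intro!: inj_onI)
      show "bij_betw ?g E (edges (quotient_mgraph (graph F) (symmetries F)))"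
        using edge_orbit_inj by (auto simp: bij_betw_def quotient_mgraph_def edge_orbits intro!: inj_onI)
      show "Defs.ends (quotient_mgraph (graph F) (symmetries F)) (?g e) = map_uprod ?f (Defs.ends Q e)"
        if e: "e \<in> E" for e
        using F.quotient_ends[of "Y (e, 0)"] e by (simp add: orbit_X orbit_Y s t ends)
    qed
  qed auto
qed

lemma rigid_F:
  assumes "connected_mgraph G"
    and total: "int (card E) = int CARD('d) * (int (card V) - 1) + (\<Sum>v\<in>V. plate_dof CARD('d) (k v))
      + int ((CARD('d) + 1) choose 2)"
    and indep: "row_indep E (unknowns F (vreps r)) (\<lambda>e. rigidity_matrix F r (Y (e, 0)))"
  shows "infinitesimally_rigid F"
  unfolding infinitesimally_rigid_def
proof (intro exI[of _ r] conjI valid_r)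
  have V0: "vreps r = (\<lambda>v. X (v, 0)) ` V" and E0: "ereps r = (\<lambda>e. Y (e, 0)) ` E" by auto
  have injV: "inj_on (\<lambda>v. X (v, 0)) V" and injE: "inj_on (\<lambda>e. Y (e, 0)) E" by (auto intro!: inj_onI)
  have "row_indep (ereps r) (unknowns F (vreps r)) (rigidity_matrix F r)"
    using indep unfolding E0 row_indep_reindex[OF injE] .
  then have "matrix_rank (ereps r) (unknowns F (vreps r)) (rigidity_matrix F r) = card (ereps r)"
    using finite_E by (subst matrix_rank_eq_card_iff) auto
  also have "card (ereps r) = card E" unfolding E0 using injE by (rule card_image)
  finally have "int (matrix_rank (ereps r) (unknowns F (vreps r)) (rigidity_matrix F r)) = int (card E)" by simp
  moreover have "card (vreps r) = card V" unfolding V0 using injV by (rule card_image)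
  moreover have "(\<Sum>i\<in>vreps r. plate_dof CARD('d) (weight F i)) = (\<Sum>v\<in>V. plate_dof CARD('d) (k v))"
    unfolding V0 by (subst sum.reindex[OF injV]) (auto intro!: sum.cong)
  ultimately show "int (matrix_rank (ereps r) (unknowns F (vreps r)) (rigidity_matrix F r))
      = int CARD('d) * (int (card (vreps r)) - 1) + (\<Sum>i\<in>vreps r. plate_dof CARD('d) (weight F i))
        + int ((CARD('d) + 1) choose 2)"
    using total by metis
qed

end

section \<open>Realising a decomposed graph\<close>

lemma axis_add: "axis a (m + n) = axis a m + (axis a n :: int ^ 'd)"
  by (simp add: axis_def vec_eq_iff)

lemma axis_0: "axis a 0 = (0 :: int ^ 'd)"
  by (simp add: axis_def vec_eq_iff)

lemma skew_elem_inner: "((elem_matrix a b - elem_matrix b a) *v q) \<bullet> w = w $ a * q $ b - w $ b * q $ a"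
  unfolding matrix_vector_sum_inner by (simp add: left_diff_distrib sum_subtractf sum_elem_matrix)

lemma elem_inner: "(elem_matrix a b *v q) \<bullet> w = w $ a * q $ b"
  unfolding matrix_vector_sum_inner by (simp add: sum_elem_matrix)

text \<open>The period \<open>\<sigma> a\<close> of the bar \<open>Sym a a\<close> is one step away from the period \<open>\<Delta> a\<close> gained along the tree
  path between its ends: this makes the bar independent of the tree and the periodic graph connected.
  A bar \<open>Plate v a b\<close> is the only one that sees the rotation of the plate \<open>v\<close> in the plane of the
  coordinates \<open>a\<close> and \<open>b\<close>.\<close>

locale decomposed = oriented Q s t
  for Q :: "('v, 'e) mgraph" and s t :: "'e \<Rightarrow> 'v" +
  fixes k :: "'v \<Rightarrow> nat" and \<phi> :: "'e \<Rightarrow> ('v, 'd::{finite,linorder}) label"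
  assumes finite_Q: "finite_mgraph Q" and nonempty: "verts Q \<noteq> {}"
    and k_le: "v \<in> verts Q \<Longrightarrow> k v \<le> CARD('d)"
    and \<phi>_labels: "e \<in> edges Q \<Longrightarrow> \<phi> e \<in> labels (verts Q) k"
    and tree: "spanning_tree s t (verts Q) {e\<in>edges Q. \<phi> e = Tree a}"
    and single: "i \<in> labels (verts Q) k \<Longrightarrow> i \<notin> range Tree \<Longrightarrow> card {e\<in>edges Q. \<phi> e = i} = 1"
    and plate: "e \<in> edges Q \<Longrightarrow> \<phi> e = Plate v a b \<Longrightarrow> v \<in> {s e, t e}"
begin

abbreviation "V \<equiv> verts Q"
abbreviation "E \<equiv> edges Q"

lemma finite_V: "finite V" and finite_E: "finite E"
  using finite_Q by (auto simp: finite_mgraph_def)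

lemma s: "e \<in> E \<Longrightarrow> s e \<in> V" and t: "e \<in> E \<Longrightarrow> t e \<in> V"
  using finite_Q ends by (auto simp: finite_mgraph_def wf_mgraph_def)

lemma Sym_le: "e \<in> E \<Longrightarrow> \<phi> e = Sym a b \<Longrightarrow> a \<le> b"
  using \<phi>_labels[of e] by (auto simp: labels_def sym_pairs_def)

lemma Plate_label: "e \<in> E \<Longrightarrow> \<phi> e = Plate v a b \<Longrightarrow> v \<in> V \<and> a < b \<and> coord_index a < k v"
  using \<phi>_labels[of e] by (auto simp: labels_def plate_pairs_def)

lemma label_unique:
  assumes "e \<in> E" "e' \<in> E" "\<phi> e = i" "\<phi> e' = i" "i \<notin> range Tree"
  shows "e = e'"
proof -
  obtain x where x: "{e\<in>E. \<phi> e = i} = {x}"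
    using single[of i] \<phi>_labels[of e] assms by (auto simp: card_1_singleton_iff)
  have "e \<in> {e\<in>E. \<phi> e = i}" "e' \<in> {e\<in>E. \<phi> e = i}" using assms by auto
  then show ?thesis unfolding x by simp
qed

lemma sum_label:
  fixes f :: "'e \<Rightarrow> real"
  assumes "e \<in> E" "\<phi> e = i" "i \<notin> range Tree"
  shows "(\<Sum>e\<in>E. if \<phi> e = i then f e else 0) = f e"
proof -
  have "(\<Sum>e\<in>E. if \<phi> e = i then f e else 0) = (\<Sum>e'\<in>E. if e' = e then f e else 0)"
  proof (rule sum.cong[OF refl])
    fix e' assume e': "e' \<in> E"
    show "(if \<phi> e' = i then f e' else 0) = (if e' = e then f e else 0)"
      using label_unique[OF assms(1) e' assms(2) _ assms(3)] assms(2) by (cases "\<phi> e' = i") auto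
  qed
  then show ?thesis using assms(1) finite_E by simp
qed

definition h :: "'d \<Rightarrow> 'v \<Rightarrow> int" where
  "h a = (SOME h. \<forall>e\<in>{e\<in>E. \<phi> e = Tree a}. h (t e) - h (s e) = 1)"

lemma h: "e \<in> E \<Longrightarrow> \<phi> e = Tree a \<Longrightarrow> h a (t e) = h a (s e) + 1"
  using someI_ex[OF spanning_tree_heights[OF tree finite_V], of a, folded h_def] by force

definition bar :: "'d \<Rightarrow> 'e" where
  "bar a = (SOME e. e \<in> E \<and> \<phi> e = Sym a a)"

lemma bar: "bar a \<in> E" "\<phi> (bar a) = Sym a a"
proof -
  have "Sym a a \<in> labels V k" by (force simp: labels_def sym_pairs_def)
  then have "card {e\<in>E. \<phi> e = Sym a a} = 1" by (rule single) auto
  then have "\<exists>e. e \<in> E \<and> \<phi> e = Sym a a" by (auto simp: card_1_singleton_iff)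
  from someI_ex[OF this, folded bar_def] show "bar a \<in> E" "\<phi> (bar a) = Sym a a" by auto
qed

definition \<Delta> :: "'d \<Rightarrow> int" where
  "\<Delta> a = h a (t (bar a)) - h a (s (bar a))"

text \<open>The period must not vanish, as it is also the bar vector. Where
  \<open>\<Delta> a + 1\<close> is zero, \<open>\<Delta> a - 1\<close>, that is -2, takes its
  place.\<close>

definition \<sigma> :: "'d \<Rightarrow> int" where
  "\<sigma> a = (if \<Delta> a = - 1 then - 2 else \<Delta> a + 1)"

lemma \<sigma>: "\<sigma> a \<noteq> 0" "\<sigma> a = \<Delta> a + 1 \<or> \<sigma> a = \<Delta> a - 1"
  by (auto simp: \<sigma>_def)

text \<open>Among \<open>Sym\<close> bars, only that of \<open>a < b\<close> has a product of
  coordinates \<open>a\<close> and \<open>b\<close>. The period of a plate bar is orthogonal to its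
  attachment point, so the bar has nonzero length and a nonzero moment in the plane of
  \<open>a\<close> and \<open>b\<close>.\<close>

definition c :: "'e \<Rightarrow> int ^ 'd::{finite,linorder}" where
  "c e = (case \<phi> e of Tree a \<Rightarrow> axis a 1
    | Sym a b \<Rightarrow> if a = b then axis a (\<sigma> a) else axis a 1 + axis b 1
    | Plate v a b \<Rightarrow> axis b 1)"

text \<open>The source has priority: a loop at \<open>v\<close> is attached off the origin at one
  end only, so its moments do not cancel.\<close>

definition qs :: "'e \<Rightarrow> real ^ 'd::{finite,linorder}" where
  "qs e = (case \<phi> e of Plate v a b \<Rightarrow> if s e = v then axis a 1 else 0 | _ \<Rightarrow> 0)"

definition qt :: "'e \<Rightarrow> real ^ 'd::{finite,linorder}" where
  "qt e = (case \<phi> e of Plate v a b \<Rightarrow> if s e = v then 0 else axis a 1 | _ \<Rightarrow> 0)"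

lemma c_nonzero: "c e \<noteq> 0"
proof (cases "\<phi> e")
  case (Sym a b)
  then have "c e $ a \<noteq> 0" using \<sigma>(1) by (auto simp: c_def axis_def)
  then show ?thesis by auto
qed (auto simp: c_def)

lemma bar_nonzero:
  assumes "e \<in> E"
  shows "int_vec (c e) + qt e - qs e \<noteq> 0"
proof (cases "\<phi> e")
  case (Plate v a b)
  then have "(int_vec (c e) + qt e - qs e) $ b \<noteq> 0"
    using Plate_label[OF assms Plate] by (auto simp: c_def qs_def qt_def int_vec_def axis_def)
  then show ?thesis by (metis zero_index)
next
  case (Tree a)
  then have "(int_vec (c e) + qt e - qs e) $ a \<noteq> 0"
    by (auto simp: c_def qs_def qt_def int_vec_def axis_def)
  then show ?thesis by (metis zero_index)
next
  case (Sym a b)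
  then have "(int_vec (c e) + qt e - qs e) $ a \<noteq> 0"
    using \<sigma>(1) by (auto simp: c_def qs_def qt_def int_vec_def axis_def)
  then show ?thesis by (metis zero_index)
qed

lemma periodic_cover:
  assumes "inj_on X (V \<times> UNIV)" "inj_on Y (E \<times> UNIV)"
  shows "periodic_cover Q s t k c qs qt X Y"
proof unfold_locales
  show "qs e $ a = 0" if "e \<in> E" "k (s e) \<le> coord_index a" for e a
    using that Plate_label[OF that(1)] by (auto simp: qs_def axis_def split: label.split)
  show "qt e $ a = 0" if "e \<in> E" "k (t e) \<le> coord_index a" for e a
    using that Plate_label[OF that(1)] plate[OF that(1)]
    by (auto simp: qt_def axis_def split: label.split)
qed (use finite_Q nonempty k_le c_nonzero bar_nonzero assms in auto)

end

locale realisation = decomposed Q s t k \<phi>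
  for Q :: "('v, 'e) mgraph" and s t :: "'e \<Rightarrow> 'v" and k :: "'v \<Rightarrow> nat"
    and \<phi> :: "'e \<Rightarrow> ('v, 'd::{finite,linorder}) label" +
  fixes X :: "'v \<times> (int ^ 'd::{finite,linorder}) \<Rightarrow> 'x" and Y :: "'e \<times> (int ^ 'd::{finite,linorder}) \<Rightarrow> 'y"
  assumes X_inj: "inj_on X (V \<times> UNIV)" and Y_inj: "inj_on Y (E \<times> UNIV)"
begin

sublocale cover: periodic_cover Q s t k c qs qt X Y
  using X_inj Y_inj by (rule periodic_cover)

section \<open>Connectedness of the periodic graph\<close>

definition joined :: "'x \<Rightarrow> 'x \<Rightarrow> bool" (infix "\<sim>" 50) where
  "x \<sim> y \<longleftrightarrow> (x, y) \<in> (adjacency cover.G)\<^sup>*"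

lemma joined_refl [simp]: "x \<sim> x"
  by (simp add: joined_def)

lemma joined_sym:
  assumes "x \<sim> y"
  shows "y \<sim> x"
proof -
  have "sym (adjacency cover.G)"
    unfolding sym_def adjacency_def by (auto, metis Upair_inject)
  then show ?thesis using assms unfolding joined_def by (metis sym_rtrancl symD)
qed

lemma joined_trans [trans]: "x \<sim> y \<Longrightarrow> y \<sim> z \<Longrightarrow> x \<sim> z"
  unfolding joined_def by (rule rtrancl_trans)

lemma joined_edge: "e \<in> E \<Longrightarrow> X (s e, z) \<sim> X (t e, z + c e)"
  unfolding joined_def by (rule r_into_rtrancl) (force simp: adjacency_def cover.edges_G cover.ends_G)

text \<open>A tree bar of direction \<open>a\<close> moves one cell along \<open>a\<close> exactly
  when the height rises by one, so a tree path moves by the difference of heights.\<close>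

lemma joined_tree:
  assumes x: "x \<in> V" and y: "y \<in> V"
  shows "X (x, z) \<sim> X (y, z + axis a (h a y - h a x))"
proof -
  let ?C = "{y \<in> V. \<forall>z. X (x, z) \<sim> X (y, z + axis a (h a y - h a x))}"
  have "?C = V"
  proof (rule spanning_tree_closed[OF tree[of a] finite_V])
    show "?C \<noteq> {}" using x by (auto simp: axis_0)
    show "s e \<in> ?C \<longleftrightarrow> t e \<in> ?C" if e: "e \<in> {e\<in>E. \<phi> e = Tree a}" for e
    proof -
      have step: "X (s e, z + axis a (h a (s e) - h a x)) \<sim> X (t e, z + axis a (h a (t e) - h a x))" for z
      proof -
        have "axis a (h a (t e) - h a x) = axis a (h a (s e) - h a x) + c e"
        proof -
          have "h a (t e) - h a x = (h a (s e) - h a x) + 1" using e h[of e a] by simp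
          then show ?thesis using e by (simp only: axis_add) (simp add: c_def)
        qed
        then show ?thesis using joined_edge[of e "z + axis a (h a (s e) - h a x)"] e by (simp add: add.assoc)
      qed
      have "X (x, z) \<sim> X (s e, z + axis a (h a (s e) - h a x)) \<longleftrightarrow> X (x, z) \<sim> X (t e, z + axis a (h a (t e) - h a x))" for z
        using step joined_sym joined_trans by blast
      then show ?thesis using e s t by auto
    qed
  qed auto
  then show ?thesis using y by blast
qed

lemma joined_axis_1:
  assumes v: "v \<in> V"
  shows "X (v, w) \<sim> X (v, w + axis a 1)"
proof -
  let ?y = "t (bar a)"
  have y: "?y \<in> V" using bar t by simp
  \<comment> \<open>The closed walk in \<open>Q\<close> goes back along the tree, losing
    \<open>\<Delta> a\<close>, and returns over the bar, gaining \<open>\<sigma> a\<close>.\<close>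
  have bar_step: "X (?y, w) \<sim> X (?y, w + axis a (\<sigma> a - \<Delta> a))" for w
  proof -
    have "X (?y, w) \<sim> X (s (bar a), w - axis a (\<Delta> a))"
      using joined_sym[OF joined_tree[OF s[OF bar(1)[of a]] y, where z = "w - axis a (\<Delta> a)" and a = a]] by (simp add: \<Delta>_def)
    also have "\<dots> \<sim> X (?y, w - axis a (\<Delta> a) + c (bar a))" by (rule joined_edge[OF bar(1)])
    also have "w - axis a (\<Delta> a) + c (bar a) = w + axis a (\<sigma> a - \<Delta> a)"
      by (simp add: c_def bar(2)) (simp add: axis_def vec_eq_iff)
    finally show ?thesis .
  qed
  have loop: "X (?y, w) \<sim> X (?y, w + axis a 1)" for w
    using \<sigma>(2)[of a]
  proof
    assume "\<sigma> a = \<Delta> a + 1"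
    then show ?thesis using bar_step[of w] by simp
  next
    assume *: "\<sigma> a = \<Delta> a - 1"
    \<comment> \<open>The walk now moves by -1, so it is read backwards from the shifted
      cell.\<close>
    have eq: "w + axis a 1 + axis a (\<sigma> a - \<Delta> a) = w" by (simp add: * axis_def vec_eq_iff)
    show ?thesis using joined_sym[OF bar_step[of "w + axis a 1"]] unfolding eq .
  qed
  let ?m = "h a ?y - h a v"
  have "X (v, w) \<sim> X (?y, w + axis a ?m)" using v y by (rule joined_tree)
  also have "\<dots> \<sim> X (?y, w + axis a ?m + axis a 1)" by (rule loop)
  also have "\<dots> \<sim> X (v, w + axis a 1)"
    using joined_sym[OF joined_tree[OF v y, where z = "w + axis a 1" and a = a]] by (simp add: add_ac)
  finally show ?thesis .
qed

lemma joined_axis: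
  assumes v: "v \<in> V"
  shows "X (v, w) \<sim> X (v, w + axis a n)"
proof (induction n rule: int_induct[where k = 0])
  case base
  show ?case by (simp add: axis_0)
next
  case (step1 i)
  note step1(2)
  also have "X (v, w + axis a i) \<sim> X (v, w + axis a i + axis a 1)" using v by (rule joined_axis_1)
  finally show ?case by (simp add: axis_add add.assoc)
next
  case (step2 i)
  note step2(2)
  also have "X (v, w + axis a i) \<sim> X (v, w + axis a (i - 1))"
    using joined_sym[OF joined_axis_1[OF v, of "w + axis a (i - 1)" a]]
    by (simp add: add.assoc flip: axis_add)
  finally show ?case .
qed

lemma connected_cover: "connected_mgraph cover.G"
proof -
  have shift: "X (v, w) \<sim> X (v, w + z)" if v: "v \<in> V" for v w z
  proof -
    have "X (v, w) \<sim> X (v, w + (\<Sum>a\<in>A. axis a (z $ a)))" for A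
      using finite[of A]
    proof (induction A rule: finite_induct)
      case (insert a A)
      note insert.IH
      also have "X (v, w + (\<Sum>a\<in>A. axis a (z $ a))) \<sim> X (v, w + (\<Sum>a\<in>A. axis a (z $ a)) + axis a (z $ a))"
        using v by (rule joined_axis)
      finally show ?case using insert.hyps by (simp add: add_ac)
    qed simp
    moreover have "(\<Sum>a\<in>UNIV. axis a (z $ a)) = z" by (simp add: vec_eq_iff axis_def)
    ultimately show ?thesis by metis
  qed
  have "X (v, w) \<sim> X (u, z)" if "v \<in> V" "u \<in> V" for u v w z
  proof -
    \<comment> \<open>The tree of any one direction leads from \<open>v\<close> to \<open>u\<close>;
      the cell is corrected afterwards.\<close>
    obtain a :: 'd where True by blast
    have "X (v, w) \<sim> X (u, w + axis a (h a u - h a v))" using that by (rule joined_tree)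
    also have "\<dots> \<sim> X (u, z)" using shift[OF that(2), of "w + axis a (h a u - h a v)" "z - (w + axis a (h a u - h a v))"] by simp
    finally show ?thesis .
  qed
  then show ?thesis
    by (auto simp: connected_mgraph_def connectivity_def cover.verts_G joined_def)
qed

section \<open>The block structure of the rigidity matrix\<close>

abbreviation entry :: "'e \<Rightarrow> ('x, 'd) unknown \<Rightarrow> real" where
  "entry e u \<equiv> rigidity_matrix cover.F cover.r (Y (e, 0)) u"

lemma entry_Pos:
  assumes "e \<in> E" "v \<in> V"
  shows "entry e (Pos (X (v, 0)) a) = (int_vec (c e) + qt e - qs e) $ a * inc s t e v"
proof -
  have "entry e (Pos (X (v, 0)) a) = ((if t e = v then axis a 1 else 0) - (if s e = v then axis a 1 else 0))
      \<bullet> (int_vec (c e) + qt e - qs e)"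
    using assms by (simp add: rigidity_matrix_def cover.bar_functional_F[OF assms(1)] s t)
  then show ?thesis by (auto simp: inc_def inner_axis' inner_diff_left)
qed

lemma entry_Per: "e \<in> E \<Longrightarrow> entry e (Per a b) = (int_vec (c e) + qt e - qs e) $ a * int_vec (c e) $ b"
  by (simp add: rigidity_matrix_def cover.bar_functional_F elem_inner)

text \<open>The entry is the moment of the bar about the origin of the plate. With the point
  \<open>axis a 1\<close> and the period \<open>axis b 1\<close> it lives in that one coordinate
  plane; the end of the bar decides the sign, and \<open>a < b\<close> excludes the reversed
  pair.\<close>

lemma entry_Rot:
  assumes e: "e \<in> E" and v: "v \<in> V" and ab: "a < b"
  shows "entry e (Rot (X (v, 0)) a b) = (if \<phi> e = Plate v a b then if s e = v then 1 else - 1 else 0)"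
proof -
  let ?w = "int_vec (c e) + qt e - qs e"
  have if_mult: "(if P then A else 0) *v q = (if P then A *v q else 0)" for P and A :: "real ^ 'd::{finite,linorder} ^ 'd::{finite,linorder}" and q
    by simp
  have "entry e (Rot (X (v, 0)) a b) = (if t e = v then ?w $ a * qt e $ b - ?w $ b * qt e $ a else 0)
      - (if s e = v then ?w $ a * qs e $ b - ?w $ b * qs e $ a else 0)"
    using e v by (simp add: rigidity_matrix_def cover.bar_functional_F s t if_mult inner_diff_left skew_elem_inner)
  also have "\<dots> = (if \<phi> e = Plate v a b then if s e = v then 1 else - 1 else 0)"
  proof (cases "\<phi> e")
    case (Plate v' a' b')
    have "a' < b'" "v' = s e \<or> v' = t e" using Plate_label[OF e Plate] plate[OF e Plate] by auto
    then show ?thesis using ab by (auto simp: c_def qs_def qt_def Plate int_vec_def axis_def)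
  qed (auto simp: qs_def qt_def)
  finally show ?thesis .
qed

text \<open>Plate rows also meet period and position columns, so they are eliminated first by the
  rotations, which no other row sees. Off-diagonal period columns then isolate the
  \<open>Sym\<close> rows with \<open>a < b\<close>, and what remains splits by direction.\<close>

lemma rows_independent: "row_indep E (unknowns cover.F (vreps cover.r)) entry"
  unfolding row_indep_def
proof (intro allI impI)
  fix l assume l: "\<forall>u\<in>unknowns cover.F (vreps cover.r). (\<Sum>e\<in>E. l e * entry e u) = 0"
  have plate0: "l e = 0" if e: "e \<in> E" "\<phi> e = Plate v a b" for e v a b
  proof -
    have v: "v \<in> V" "a < b" "coord_index a < k v" using Plate_label[OF e] by auto
    then have "Rot (X (v, 0)) a b \<in> unknowns cover.F (vreps cover.r)" by (auto simp: unknowns_def)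
    with l have "0 = (\<Sum>e\<in>E. l e * entry e (Rot (X (v, 0)) a b))" by simp
    also have "\<dots> = (\<Sum>e\<in>E. if \<phi> e = Plate v a b then l e * (if s e = v then 1 else - 1) else 0)"
      using v by (intro sum.cong) (simp_all add: entry_Rot)
    also have "\<dots> = l e * (if s e = v then 1 else - 1)"
      by (rule sum_label[OF e]) auto
    finally show ?thesis by (auto split: if_splits)
  qed
  have sym0: "l e = 0" if e: "e \<in> E" "\<phi> e = Sym a b" "a \<noteq> b" for e a b
  proof -
    have ab: "a < b" using Sym_le[OF e(1,2)] e(3) by simp
    have "Per a b \<in> unknowns cover.F (vreps cover.r)" by (auto simp: unknowns_def)
    with l have "0 = (\<Sum>e\<in>E. l e * entry e (Per a b))" by simp
    also have "\<dots> = (\<Sum>e\<in>E. if \<phi> e = Sym a b then l e else 0)"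
    proof (rule sum.cong[OF refl])
      fix e assume e: "e \<in> E"
      show "l e * entry e (Per a b) = (if \<phi> e = Sym a b then l e else 0)"
        using plate0[OF e] Sym_le[OF e] ab
        by (cases "\<phi> e") (auto simp: entry_Per[OF e] c_def qs_def qt_def int_vec_def axis_def)
    qed
    also have "\<dots> = l e" by (rule sum_label[OF e(1,2)]) auto
    finally show ?thesis by simp
  qed
  \<comment> \<open>Direction and period agree for the remaining rows, so the entries are the
    squares of the periods, 1 for tree bars.\<close>
  have per: "(\<Sum>e\<in>E. if \<phi> e = Tree a then l e else 0) + l (bar a) * (of_int (\<sigma> a))\<^sup>2 = 0" for a
  proof -
    have "Per a a \<in> unknowns cover.F (vreps cover.r)" by (auto simp: unknowns_def)
    with l have "0 = (\<Sum>e\<in>E. l e * entry e (Per a a))" by simp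
    also have "\<dots> = (\<Sum>e\<in>E. (if \<phi> e = Tree a then l e else 0)
        + (if \<phi> e = Sym a a then l e * (of_int (\<sigma> a))\<^sup>2 else 0))"
    proof (rule sum.cong[OF refl])
      fix e assume e: "e \<in> E"
      show "l e * entry e (Per a a) = (if \<phi> e = Tree a then l e else 0)
          + (if \<phi> e = Sym a a then l e * (of_int (\<sigma> a))\<^sup>2 else 0)"
        using plate0[OF e] sym0[OF e]
        by (cases "\<phi> e") (auto simp: entry_Per[OF e] c_def qs_def qt_def int_vec_def axis_def power2_eq_square)
    qed
    finally show ?thesis using sum_label[OF bar, of a "\<lambda>e. l e * (of_int (\<sigma> a))\<^sup>2"]
      by (simp add: sum.distrib image_iff)
  qed
  have pos: "(\<Sum>e\<in>E. ((if \<phi> e = Tree a then l e else 0) + (if \<phi> e = Sym a a then l e * of_int (\<sigma> a) else 0))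
      * inc s t e v) = 0" if v: "v \<in> V" for a v
  proof -
    have "Pos (X (v, 0)) a \<in> unknowns cover.F (vreps cover.r)" using v by (auto simp: unknowns_def)
    with l have "0 = (\<Sum>e\<in>E. l e * entry e (Pos (X (v, 0)) a))" by simp
    also have "\<dots> = (\<Sum>e\<in>E. ((if \<phi> e = Tree a then l e else 0)
        + (if \<phi> e = Sym a a then l e * of_int (\<sigma> a) else 0)) * inc s t e v)"
    proof (rule sum.cong[OF refl])
      fix e assume e: "e \<in> E"
      show "l e * entry e (Pos (X (v, 0)) a) = ((if \<phi> e = Tree a then l e else 0)
          + (if \<phi> e = Sym a a then l e * of_int (\<sigma> a) else 0)) * inc s t e v"
        using plate0[OF e] sym0[OF e]
        by (cases "\<phi> e") (auto simp: entry_Pos[OF e v] c_def qs_def qt_def int_vec_def axis_def)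
    qed
    finally show ?thesis by simp
  qed
  have bar0: "l (bar a) = 0" for a
  proof -
    let ?f = "\<lambda>e. (if \<phi> e = Tree a then l e else 0) + (if \<phi> e = Sym a a then l e * of_int (\<sigma> a) else 0)"
    \<comment> \<open>Pairing the position equations with the heights gives tree rows weight 1 and
      the bar weight \<open>\<sigma> a * \<Delta> a\<close>. The tree sum is the one in
      \<open>per\<close>, so comparison eliminates the tree.\<close>
    have "0 = (\<Sum>v\<in>V. of_int (h a v) * (\<Sum>e\<in>E. ?f e * inc s t e v))" using pos by simp
    also have "\<dots> = (\<Sum>e\<in>E. ?f e * (\<Sum>v\<in>V. of_int (h a v) * inc s t e v))"
      unfolding sum_distrib_left by (subst sum.swap) (simp only: mult.left_commute)
    also have "\<dots> = (\<Sum>e\<in>E. (if \<phi> e = Tree a then l e else 0)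
        + (if \<phi> e = Sym a a then l e * of_int (\<sigma> a) * of_int (\<Delta> a) else 0))"
    proof (rule sum.cong[OF refl])
      fix e assume e: "e \<in> E"
      have "e = bar a" if "\<phi> e = Sym a a"
        using that label_unique[OF e bar(1) _ bar(2), of a] by auto
      then show "?f e * (\<Sum>v\<in>V. of_int (h a v) * inc s t e v) = (if \<phi> e = Tree a then l e else 0)
          + (if \<phi> e = Sym a a then l e * of_int (\<sigma> a) * of_int (\<Delta> a) else 0)"
        unfolding sum_inc[OF finite_V] using s[OF e] t[OF e] h[OF e, of a] by (auto simp: \<Delta>_def)
    qed
    also have "\<dots> = (\<Sum>e\<in>E. if \<phi> e = Tree a then l e else 0) + l (bar a) * of_int (\<sigma> a) * of_int (\<Delta> a)"
      using sum_label[OF bar, of a "\<lambda>e. l e * of_int (\<sigma> a) * of_int (\<Delta> a)"] by (simp add: sum.distrib image_iff)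
    finally have eq: "(\<Sum>e\<in>E. if \<phi> e = Tree a then l e else 0) + l (bar a) * of_int (\<sigma> a) * of_int (\<Delta> a) = 0"
      by simp
    have "l (bar a) * of_int (\<sigma> a) * (of_int (\<sigma> a) - of_int (\<Delta> a))
        = l (bar a) * (of_int (\<sigma> a))\<^sup>2 - l (bar a) * of_int (\<sigma> a) * of_int (\<Delta> a)"
      by (simp add: power2_eq_square algebra_simps)
    also have "\<dots> = 0" using per[of a] eq by linarith
    finally have "l (bar a) * of_int (\<sigma> a) * (of_int (\<sigma> a) - of_int (\<Delta> a)) = 0" .
    moreover have "of_int (\<sigma> a) \<noteq> (0 :: real)" "of_int (\<sigma> a) - of_int (\<Delta> a) \<noteq> (0 :: real)"
      using \<sigma>[of a] by auto
    ultimately show ?thesis by simp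
  qed
  have tree0: "l e = 0" if e: "e \<in> E" "\<phi> e = Tree a" for e a
  proof -
    let ?T = "{e\<in>E. \<phi> e = Tree a}"
    \<comment> \<open>Once the bar has coefficient zero, the position equations of direction
      \<open>a\<close> are precisely a relation among the incidence vectors of the tree.\<close>
    have "(\<Sum>e\<in>?T. l e * inc s t e v) = 0" for v
    proof (cases "v \<in> V")
      case True
      have "(\<Sum>e\<in>?T. l e * inc s t e v) = (\<Sum>e\<in>E. ((if \<phi> e = Tree a then l e else 0)
          + (if \<phi> e = Sym a a then l e * of_int (\<sigma> a) else 0)) * inc s t e v)"
      proof (rule sum.mono_neutral_cong_left[OF finite_E])
        show "\<forall>e\<in>E - ?T. ((if \<phi> e = Tree a then l e else 0)
            + (if \<phi> e = Sym a a then l e * of_int (\<sigma> a) else 0)) * inc s t e v = 0"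
          using bar0 label_unique[OF _ bar(1) _ bar(2), of _ a] by auto
      qed auto
      then show ?thesis using pos[OF True] by simp
    next
      case False
      then show ?thesis using s t by (intro sum.neutral) (auto simp: inc_def)
    qed
    moreover have "row_indep ?T UNIV (inc s t)" using tree by (simp add: spanning_tree_def)
    ultimately show ?thesis using row_indepD[of ?T UNIV "inc s t" l e] e by blast
  qed
  show "\<forall>e\<in>E. l e = 0"
  proof
    fix e assume e: "e \<in> E"
    show "l e = 0"
    proof (cases "\<phi> e")
      case (Sym a b)
      then show ?thesis
        using sym0[OF e Sym] bar0[of a] label_unique[OF e bar(1) _ bar(2), of a] by (cases "a = b") auto
    qed (use tree0[OF e] plate0[OF e] in auto)
  qed
qed

end

theorem theorem6:
  fixes Q :: "('v, 'e) mgraph" and k :: "'v \<Rightarrow> nat"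
  assumes "finite_mgraph Q" and "verts Q \<noteq> {}"
    and "\<forall>v\<in>verts Q. k v \<le> CARD('d::{finite,linorder})"
    and "int (card (edges Q)) =
           int CARD('d) * (int (card (verts Q)) - 1)
           + (\<Sum>v\<in>verts Q. plate_dof CARD('d) (k v))
           + int ((CARD('d) + 1) choose 2)"
  shows "(\<exists>F :: ('x::infinite, 'y::infinite, 'd) framework.
            mixed_plate_framework F \<and> infinitesimally_rigid F \<and> is_weighted_quotient Q k F)
    \<longleftrightarrow> (\<forall>F \<subseteq> edges Q. F \<noteq> {} \<longrightarrow>
          (let H = edge_subgraph Q F in
             int (card F) \<le>
               int CARD('d) * (int (card (verts H)) - int (num_components H))
               + (\<Sum>v\<in>verts H. plate_dof CARD('d) (k v))
               + int ((CARD('d) + 1) choose 2)))"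
    (is "?rigid \<longleftrightarrow> ?sparse")
proof
  assume ?rigid
  then show ?sparse
    using rigid_imp_sparse[OF assms(1,4)] by (auto simp: Let_def)
next
  assume sparse: ?sparse
  have "\<exists>p. ends Q e = Upair (fst p) (snd p)" for e
    by (cases "ends Q e") auto
  then obtain p where p: "\<And>e. ends Q e = Upair (fst (p e)) (snd (p e))" by metis
  define s where "s = fst \<circ> p"
  define t where "t = snd \<circ> p"
  interpret Q: oriented Q s t by unfold_locales (simp add: p s_def t_def)
  have fin: "finite (edges Q)" "finite (verts Q)" and wf: "wf_mgraph Q"
    using assms(1) by (auto simp: finite_mgraph_def)
  have st: "s ` edges Q \<subseteq> verts Q" "t ` edges Q \<subseteq> verts Q"
    using wf Q.ends by (auto simp: wf_mgraph_def)
  \<comment> \<open>The count is weakened from components to the rank of the incidence vectors, the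
    rank function of the graphic matroid.\<close>
  have sparse': "int (card F) \<le> int CARD('d) * int (fv.dim (inc s t ` F))
      + (\<Sum>v\<in>s ` F \<union> t ` F. plate_dof CARD('d) (k v)) + int ((CARD('d) + 1) choose 2)"
    if F: "F \<subseteq> edges Q" "F \<noteq> {}" for F
  proof -
    let ?H = "edge_subgraph Q F"
    have "int (card (verts ?H)) - int (num_components ?H) \<le> int (fv.dim (inc s t ` F))"
      using Q.components_le_dim_inc[OF F(1)] finite_subset[OF F(1) fin(1)] by linarith
    then have "int CARD('d) * (int (card (verts ?H)) - int (num_components ?H))
        \<le> int CARD('d) * int (fv.dim (inc s t ` F))"
      by (intro mult_left_mono) auto
    moreover have "int (card F) \<le> int CARD('d) * (int (card (verts ?H)) - int (num_components ?H))
        + (\<Sum>v\<in>verts ?H. plate_dof CARD('d) (k v)) + int ((CARD('d) + 1) choose 2)"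
      using sparse F unfolding Let_def by blast
    ultimately show ?thesis unfolding Q.verts_edge_subgraph[OF F(1)] by linarith
  qed
  have "k v \<le> CARD('d)" if "v \<in> verts Q" for v using that assms(3) by blast
  from label_decomposition[OF fin st assms(2) this assms(4) sparse']
  obtain \<phi> :: "'e \<Rightarrow> ('v, 'd) label" where \<phi>: "\<phi> ` edges Q \<subseteq> labels (verts Q) k"
    "\<And>a. spanning_tree s t (verts Q) {e\<in>edges Q. \<phi> e = Tree a}"
    "\<And>i. i \<in> labels (verts Q) k \<Longrightarrow> i \<notin> range Tree \<Longrightarrow> card {e\<in>edges Q. \<phi> e = i} = 1"
    "\<And>e v a b. e \<in> edges Q \<Longrightarrow> \<phi> e = Plate v a b \<Longrightarrow> v \<in> {s e, t e}"
    by blast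
  \<comment> \<open>Finitely many copies of the integer lattice are countable, so they fit into any
    infinite type of vertices or edges.\<close>
  have embed: "\<exists>f :: 'a \<times> (int ^ 'd::{finite,linorder}) \<Rightarrow> 'b. inj_on f (A \<times> UNIV)"
    if finA: "finite A" and infB: "infinite (UNIV :: 'b set)"
    for A :: "'a set"
  proof -
    have "countable (A \<times> (UNIV :: (int ^ 'd::{finite,linorder}) set))"
      by (rule countable_SIGMA[OF countable_finite[OF finA] countableI_type])
    then obtain f :: "'a \<times> (int ^ 'd::{finite,linorder}) \<Rightarrow> nat" where f: "inj_on f (A \<times> UNIV)" by (rule countableE)
    obtain g :: "nat \<Rightarrow> 'b" where "inj g"
      using infinite_countable_subset[OF infB] by blast
    then have "inj_on (g \<circ> f) (A \<times> UNIV)" using f by (auto intro: comp_inj_on inj_on_subset)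
    then show ?thesis by blast
  qed
  obtain X :: "'v \<times> (int ^ 'd::{finite,linorder}) \<Rightarrow> 'x" where X: "inj_on X (verts Q \<times> UNIV)"
    using embed[OF fin(2)] infinite_UNIV by blast
  obtain Y :: "'e \<times> (int ^ 'd::{finite,linorder}) \<Rightarrow> 'y" where Y: "inj_on Y (edges Q \<times> UNIV)"
    using embed[OF fin(1)] infinite_UNIV by blast
  interpret R: realisation Q s t k \<phi> X Y
    by unfold_locales (use assms \<phi> X Y in auto)
  show ?rigid
    using R.cover.framework_F[OF R.connected_cover] R.cover.weighted_quotient_F[OF R.connected_cover]
      R.cover.rigid_F[OF R.connected_cover assms(4) R.rows_independent] by blast
qed

end
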